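(* Let $\beta>0$ and $\theta\in[0,2\pi)$. For $N\in\mathbb{N}$ let $(\theta_1,\dots,\theta_N)$ be distributed according to the circular $\beta$-ensemble, let $D_{N,\beta}(\theta)=\prod_{j=1}^N(e^{i\theta}-e^{i\theta_j})$ and $T_N=\sqrt{\mathrm{Var}(\log|D_{N,\beta}(\theta)|)}$. Then for every $\varepsilon>0$, $$\sup_{U\in\mathcal{B}(\mathbb{R})}\left|\mathbb{P}\Big(\frac{\log|D_{N,\beta}(\theta)|}{T_N}\in U\Big)-\mathbb{P}\big(\mathcal{N}(0,1)\in U\big)\right|=o\Big(\frac{1}{T_N^{3-\varepsilon}}\Big)\quad\text{as }N\to\infty,$$ where $\mathcal{B}(\mathbb{R})$ is the Borel $\sigma$-algebra and $\mathcal N(0,1)$ is a standard normal random variable.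
   Context: The circular $\beta$-ensemble with $N$ points is the random vector $(\theta_1,\dots,\theta_N)\in[0,2\pi)^N$ with law proportional to $\prod_{1\leq j<k\leq N}|e^{i\theta_j}-e^{i\theta_k}|^\beta\,d\theta_1\cdots d\theta_N$. *)

theory Defs
  imports "HOL-Probability.Probability" "HOL-Library.Landau_Symbols"
begin

definition cbe_weight :: "real \<Rightarrow> nat \<Rightarrow> (nat \<Rightarrow> real) \<Rightarrow> real" where
  "cbe_weight \<beta> N t =
     (\<Prod>k\<in>{..<N}. \<Prod>j\<in>{..<k}. cmod (cis (t j) - cis (t k)) powr \<beta>)"

definition cbe_base :: "nat \<Rightarrow> (nat \<Rightarrow> real) measure" where
  "cbe_base N = PiM {..<N} (\<lambda>_. restrict_space lborel {0..<2*pi})"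

definition cbe_partition :: "real \<Rightarrow> nat \<Rightarrow> real" where
  "cbe_partition \<beta> N = integral\<^sup>L (cbe_base N) (cbe_weight \<beta> N)"

definition circular_beta_ensemble :: "real \<Rightarrow> nat \<Rightarrow> (nat \<Rightarrow> real) measure" where
  "circular_beta_ensemble \<beta> N =
     density (cbe_base N) (\<lambda>t. ennreal (cbe_weight \<beta> N t / cbe_partition \<beta> N))"

definition char_poly_D :: "nat \<Rightarrow> real \<Rightarrow> (nat \<Rightarrow> real) \<Rightarrow> complex" where
  "char_poly_D N \<theta> t = (\<Prod>j\<in>{..<N}. cis \<theta> - cis (t j))"

definition log_abs_D :: "nat \<Rightarrow> real \<Rightarrow> (nat \<Rightarrow> real) \<Rightarrow> real" where
  "log_abs_D N \<theta> t = ln (cmod (char_poly_D N \<theta> t))"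

definition cbe_T :: "real \<Rightarrow> real \<Rightarrow> nat \<Rightarrow> real" where
  "cbe_T \<beta> \<theta> N =
     (let M = circular_beta_ensemble \<beta> N; X = log_abs_D N \<theta>
      in sqrt (\<integral>t. (X t - (\<integral>s. X s \<partial>M))\<^sup>2 \<partial>M))"

definition std_normal_measure :: "real measure" where
  "std_normal_measure = density lborel std_normal_density"

definition cbe_borel_distance :: "real \<Rightarrow> real \<Rightarrow> nat \<Rightarrow> real" where
  "cbe_borel_distance \<beta> \<theta> N =
     (SUP U \<in> sets borel.
        \<bar>measure (circular_beta_ensemble \<beta> N)
            {t \<in> space (circular_beta_ensemble \<beta> N). log_abs_D N \<theta> t / cbe_T \<beta> \<theta> N \<in> U}
         - measure std_normal_measure U\<bar>)"

end

theory Submission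
  imports Defs
begin

text \<open>
  Write \<open>X = log |D|\<close> and \<open>c = \<beta>/2\<close>.  Integration by parts in one angle, followed by
  antisymmetrisation (Aomoto's argument), shows that for \<open>Re z \<ge> 0\<close> the Mellin transform
  \<open>E exp (z X)\<close> is multiplied by
  \<open>\<Prod>j<N. (1 + z + c j) (2 + z + c j) / (1 + z/2 + c j)\<^sup>2\<close> when \<open>z\<close> is replaced by \<open>z + 2\<close>.
  Under the law tilted by \<open>|D| ^ (2 n)\<close> the variable \<open>X\<close> concentrates at its maximum \<open>N log 2\<close>
  as \<open>n\<close> grows, so iterating the recursion determines the characteristic function of \<open>X\<close>:
  \<open>E exp (i u X) = \<Prod>j<N. \<Gamma>(1 + c j) \<Gamma>(1 + c j + i u) / \<Gamma>(1 + c j + i u/2)\<^sup>2\<close>.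
  The third derivative of its logarithm is bounded uniformly in \<open>N\<close> and \<open>u\<close>, while the variance
  \<open>T\<^sup>2\<close> diverges.  Hence the normalised characteristic function and its first two derivatives differ
  from those of the standard normal law by at most a constant times \<open>T ^ -3 / (1 + t\<^sup>2)\<close>, and Fourier
  inversion turns this into a bound of order \<open>T ^ -3\<close> for the total variation distance.
\<close>

section \<open>Total variation distance via characteristic functions\<close>

text \<open>The supremum runs over all Borel sets, so a smoothing inequality for distribution
  functions would not do: the difference of the two laws must have an integrable density. That is
  why two derivatives of the characteristic functions are compared and not only their values. Two
  further obstacles shape the proof. A recursion with step 2 leaves a factor of period 2
  undetermined; the concentration at the maximum of \<open>|D|\<close> removes it without any
  uniqueness theorem for analytic functions. And the Taylor expansion of the log characteristic
  function is useful only for \<open>|t|\<close> up to a multiple of \<open>T ^ 3\<close>; beyond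
  that the decay must come from the Gamma factors. Each of them decays only like a power of
  \<open>|u|\<close>, with an exponent that grows with \<open>c\<close>, so one index
  \<open>j\<close> with \<open>\<beta> j / 2\<close> large enough is singled out and all other
  factors are bounded by 1. The mean of \<open>X\<close> is exactly 0, so no centring
  enters.\<close>

lemma has_bochner_integral_inverse_1_plus_square:
  "has_bochner_integral lborel (\<lambda>x::real. inverse (1 + x\<^sup>2)) pi"
proof -
  have ein: "einterval (-\<infinity>) \<infinity> = (UNIV :: real set)"
    by (auto simp: einterval_def)
  have "integrable lborel (\<lambda>x::real. inverse (1 + x\<^sup>2))"
    using integrable_inverse_1_plus_square unfolding ein set_integrable_def by simp
  moreover have "(\<integral>x. inverse (1 + x\<^sup>2) \<partial>lborel) = pi"
    using LBINT_inverse_1_plus_square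
    unfolding interval_lebesgue_integral_def ein set_lebesgue_integral_def by simp
  ultimately show ?thesis by (simp add: has_bochner_integral_iff)
qed

lemma
  fixes f :: "real \<Rightarrow> 'a :: {banach, second_countable_topology}"
  assumes [measurable]: "f \<in> borel_measurable borel" and bound: "\<And>t. norm (f t) \<le> C / (1 + t\<^sup>2)"
  shows integrable_Lorentz_bound: "integrable lborel f"
    and integral_Lorentz_bound: "(\<integral>t. norm (f t) \<partial>lborel) \<le> C * pi"
proof -
  note L = has_bochner_integral_mult_right[OF has_bochner_integral_inverse_1_plus_square, of C]
  have i: "integrable lborel (\<lambda>t. C * inverse (1 + t\<^sup>2))"
    using L by (simp add: has_bochner_integral_iff)
  show int: "integrable lborel f"
    by (rule Bochner_Integration.integrable_bound[OF i])
       (use bound in \<open>auto simp: divide_inverse intro!: AE_I2 order_trans[OF _ abs_ge_self]\<close>)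
  have "(\<integral>t. norm (f t) \<partial>lborel) \<le> (\<integral>t. C * inverse (1 + t\<^sup>2) \<partial>lborel)"
    using int i bound by (intro integral_mono) (auto simp: divide_inverse)
  also have "\<dots> = C * pi"
    using L has_bochner_integral_integral_eq by blast
  finally show "(\<integral>t. norm (f t) \<partial>lborel) \<le> C * pi" .
qed

text \<open>The truncated integrals over \<open>{-n..n}\<close> are boundary differences, which
  vanish in the limit. This is integration by parts on the whole line.\<close>

lemma integral_deriv_eq_0:
  fixes F f :: "real \<Rightarrow> complex"
  assumes deriv: "\<And>x. (F has_vector_derivative f x) (at x)" and cont: "continuous_on UNIV f"
    and int: "integrable lborel f"
    and lim: "(F \<longlongrightarrow> 0) at_top" "(F \<longlongrightarrow> 0) at_bot"
  shows "integral\<^sup>L lborel f = 0"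
proof -
  have [measurable]: "f \<in> borel_measurable borel"
    using cont by (rule borel_measurable_continuous_onI)
  have "(\<lambda>n. \<integral>x. indicator {- real n..real n} x *\<^sub>R f x \<partial>lborel) \<longlonglongrightarrow> (\<integral>x. f x \<partial>lborel)"
  proof (rule integral_dominated_convergence[where w = "\<lambda>x. norm (f x)"])
    show "AE x in lborel. (\<lambda>n. indicator {- real n..real n} x *\<^sub>R f x) \<longlonglongrightarrow> f x"
    proof (rule AE_I2)
      fix x :: real
      obtain n where n: "\<bar>x\<bar> \<le> real n" using real_arch_simple by blast
      have "eventually (\<lambda>m. f x = indicator {- real m..real m} x *\<^sub>R f x) sequentially"
        using eventually_ge_at_top[of n] by eventually_elim (use n in \<open>auto simp: indicator_def\<close>)
      thus "(\<lambda>n. indicator {- real n..real n} x *\<^sub>R f x) \<longlonglongrightarrow> f x"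
        by (rule Lim_transform_eventually[OF tendsto_const])
    qed
  qed (use int in \<open>auto simp: indicator_def\<close>)
  also have "(\<lambda>n. \<integral>x. indicator {- real n..real n} x *\<^sub>R f x \<partial>lborel) = (\<lambda>n. F (real n) - F (- real n))"
    using deriv cont
    by (intro ext integral_FTC_Icc) (auto intro: has_vector_derivative_at_within continuous_on_subset)
  finally have 1: "(\<lambda>n. F (real n) - F (- real n)) \<longlonglongrightarrow> integral\<^sup>L lborel f" .
  have "(\<lambda>n. F (real n) - F (- real n)) \<longlonglongrightarrow> 0 - 0"
    by (intro tendsto_diff filterlim_compose[OF lim(1) filterlim_real_sequentially]
        filterlim_compose[OF lim(2) filterlim_compose[OF filterlim_uminus_at_bot_at_top filterlim_real_sequentially]])
  with 1 show ?thesis using LIMSEQ_unique by fastforce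
qed

lemma tendsto_0_Lorentz_bound:
  fixes f :: "real \<Rightarrow> complex"
  assumes "\<And>t. norm (f t) \<le> C / (1 + t\<^sup>2)"
  shows "(f \<longlongrightarrow> 0) at_top" "(f \<longlongrightarrow> 0) at_bot"
proof -
  have "((\<lambda>t::real. C / (1 + t\<^sup>2)) \<longlongrightarrow> 0) at_top" "((\<lambda>t::real. C / (1 + t\<^sup>2)) \<longlongrightarrow> 0) at_bot"
    by real_asymp+
  note lim = this
  show "(f \<longlongrightarrow> 0) at_top"
    by (rule Lim_null_comparison[OF _ lim(1)]) (use assms in simp)
  show "(f \<longlongrightarrow> 0) at_bot"
    by (rule Lim_null_comparison[OF _ lim(2)]) (use assms in simp)
qed

text \<open>Two integrations by parts trade \<open>x^2\<close> for the second derivative; adding the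
  trivial bound gives the factor \<open>1 + x^2\<close>, hence an integrable Fourier
  transform.\<close>

lemma norm_Fourier_le:
  fixes d d1 d2 :: "real \<Rightarrow> complex"
  assumes d1: "\<And>t. (d has_vector_derivative d1 t) (at t)"
    and d2: "\<And>t. (d1 has_vector_derivative d2 t) (at t)" and cont: "continuous_on UNIV d2"
    and b: "\<And>t. norm (d t) \<le> C / (1 + t\<^sup>2)" "\<And>t. norm (d1 t) \<le> C / (1 + t\<^sup>2)" "\<And>t. norm (d2 t) \<le> C / (1 + t\<^sup>2)"
  shows "(1 + x\<^sup>2) * norm (\<integral>t. iexp (- (t * x)) * d t \<partial>lborel) \<le> 2 * C * pi"
proof -
  define E where "E = (\<lambda>t. iexp (- (t * x)))"
  have cd: "continuous_on UNIV d" "continuous_on UNIV d1"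
    using d1 d2 by (auto intro!: continuous_at_imp_continuous_on has_vector_derivative_continuous)
  have cE: "continuous_on UNIV E"
    unfolding E_def by (intro continuous_intros)
  have [measurable]: "d \<in> borel_measurable borel" "d2 \<in> borel_measurable borel" "E \<in> borel_measurable borel"
    using cd cont cE by (auto intro: borel_measurable_continuous_onI)
  have nE: "norm (E t) = 1" for t by (simp add: E_def)
  have b': "norm (E t * d t) \<le> C / (1 + t\<^sup>2)" "norm (E t * d1 t) \<le> C / (1 + t\<^sup>2)" "norm (E t * d2 t) \<le> C / (1 + t\<^sup>2)" for t
    using b by (auto simp: norm_mult nE)
  have int: "integrable lborel (\<lambda>t. E t * d t)" "integrable lborel (\<lambda>t. E t * d2 t)"
    by (rule integrable_Lorentz_bound[OF _ b'(1)] integrable_Lorentz_bound[OF _ b'(3)]; measurable)+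
  have dE: "(E has_vector_derivative (- \<i> * x) * E t) (at t)" for t
    unfolding E_def has_vector_derivative_complex_iff
    by (auto intro!: derivative_eq_intros simp: Re_exp Im_exp)
  \<comment> \<open>Both integrations by parts at once: the mixed terms with \<open>E * d1\<close>
    cancel in the derivative of this combination.\<close>
  have D: "((\<lambda>t. E t * d1 t + (\<i> * x) * (E t * d t)) has_vector_derivative
      E t * d2 t + x\<^sup>2 * (E t * d t)) (at t)" for t
  proof -
    have "((\<lambda>t. E t * d1 t + (\<i> * x) * (E t * d t)) has_vector_derivative
      (E t * d2 t + (- \<i> * x) * E t * d1 t) + (\<i> * x) * (E t * d1 t + (- \<i> * x) * E t * d t)) (at t)"
      by (intro has_vector_derivative_add has_vector_derivative_mult has_vector_derivative_mult_right dE d1 d2)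
    also have "(E t * d2 t + (- \<i> * x) * E t * d1 t) + (\<i> * x) * (E t * d1 t + (- \<i> * x) * E t * d t) =
        E t * d2 t + x\<^sup>2 * (E t * d t)"
      by (simp add: algebra_simps power2_eq_square)
    finally show ?thesis .
  qed
  have "(\<integral>t. E t * d2 t + x\<^sup>2 * (E t * d t) \<partial>lborel) = 0"
  proof (rule integral_deriv_eq_0[OF D])
    show "continuous_on UNIV (\<lambda>t. E t * d2 t + x\<^sup>2 * (E t * d t))"
      by (intro continuous_intros cd cont cE)
    show "integrable lborel (\<lambda>t. E t * d2 t + x\<^sup>2 * (E t * d t))"
      by (intro Bochner_Integration.integrable_add integrable_mult_right int)
    have "((\<lambda>t. E t * d1 t + (\<i> * x) * (E t * d t)) \<longlongrightarrow> 0 + (\<i> * x) * 0) at_top"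
      "((\<lambda>t. E t * d1 t + (\<i> * x) * (E t * d t)) \<longlongrightarrow> 0 + (\<i> * x) * 0) at_bot"
      by (intro tendsto_intros tendsto_0_Lorentz_bound[OF b'(1)] tendsto_0_Lorentz_bound[OF b'(2)])+
    thus "((\<lambda>t. E t * d1 t + (\<i> * x) * (E t * d t)) \<longlongrightarrow> 0) at_top"
      "((\<lambda>t. E t * d1 t + (\<i> * x) * (E t * d t)) \<longlongrightarrow> 0) at_bot"
      by simp_all
  qed
  hence eq: "x\<^sup>2 * (\<integral>t. E t * d t \<partial>lborel) = - (\<integral>t. E t * d2 t \<partial>lborel)"
    using int by (simp add: Bochner_Integration.integral_add add_eq_0_iff2)
  have 1: "norm (\<integral>t. E t * d t \<partial>lborel) \<le> C * pi"
    by (rule order_trans[OF integral_norm_bound integral_Lorentz_bound[OF _ b'(1)]]) measurable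
  have "norm (complex_of_real (x\<^sup>2) * (\<integral>t. E t * d t \<partial>lborel)) = norm (\<integral>t. E t * d2 t \<partial>lborel)"
    using eq by simp
  also have "\<dots> \<le> C * pi"
    by (rule order_trans[OF integral_norm_bound integral_Lorentz_bound[OF _ b'(3)]]) measurable
  finally have "x\<^sup>2 * norm (\<integral>t. E t * d t \<partial>lborel) \<le> C * pi"
    by (simp add: norm_mult norm_power)
  with 1 show ?thesis unfolding E_def by (simp add: algebra_simps)
qed

text \<open>For a single law, Levy inversion is only a limit of truncated integrals. For the
  difference the integrand is absolutely integrable, so the limit becomes a genuine integral; its
  kernel is the Fourier integral of the indicator of \<open>{a..b}\<close>, and Fubini exposes
  \<open>q\<close> as a density of the signed measure, although neither law is assumed to have
  one.\<close>

lemma Levy_difference_Ioc: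
  assumes M: "real_distribution M1" "real_distribution M2"
    and b: "\<And>t. norm (char M1 t - char M2 t) \<le> C / (1 + t\<^sup>2)"
    and ab: "a \<le> b" "measure M1 {a} = 0" "measure M1 {b} = 0" "measure M2 {a} = 0" "measure M2 {b} = 0"
  defines "q \<equiv> (\<lambda>x. 1 / (2 * pi) * (\<integral>t. iexp (- (t * x)) * (char M1 t - char M2 t) \<partial>lborel))"
  shows "complex_of_real (measure M1 {a<..b} - measure M2 {a<..b}) = (\<integral>x. indicator {a..b} x *\<^sub>R q x \<partial>lborel)"
proof -
  interpret M1: real_distribution M1 by fact
  interpret M2: real_distribution M2 by fact
  define d where "d = (\<lambda>t. char M1 t - char M2 t)"
  define F where "F = (\<lambda>t::real. (iexp (- (t * a)) - iexp (- (t * b))) / (\<i> * t))"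
  have [measurable]: "char M1 \<in> borel_measurable borel" "char M2 \<in> borel_measurable borel"
    by (rule M1.char_measurable M2.char_measurable)+
  have [measurable]: "d \<in> borel_measurable borel" unfolding d_def by measurable
  have [measurable]: "F \<in> borel_measurable borel" unfolding F_def by measurable
  have intd: "integrable lborel d"
    by (rule integrable_Lorentz_bound[where C = C]) (use b in \<open>auto simp: d_def\<close>)
  have nF: "norm (F t) \<le> b - a" for t
  proof (cases "t = 0")
    case False
    have "F t = - ((iexp (t * (- a)) - iexp (t * (- b))) / (\<i> * - t))" by (simp add: F_def)
    moreover have "norm ((iexp (t * (- a)) - iexp (t * (- b))) / (\<i> * t)) \<le> - a - - b"
      using Levy_Inversion_aux2[of "- b" "- a" t] ab False by simp
    ultimately show ?thesis by (simp add: F_def norm_divide)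
  qed (use ab in \<open>simp add: F_def\<close>)
  have intFd: "integrable lborel (\<lambda>t. F t * d t)"
  proof (rule Bochner_Integration.integrable_bound[where f = "\<lambda>t. (b - a) * norm (d t)"])
    show "AE t in lborel. norm (F t * d t) \<le> norm ((b - a) * norm (d t))"
      using nF ab by (auto simp: norm_mult intro!: AE_I2 mult_right_mono)
  qed (use intd in auto)
  have bchar: "interval_lebesgue_integrable lborel (ereal (- T)) (ereal T) (\<lambda>t. F t * char M t)" if "T \<ge> 0" "real_distribution M" for T M
  proof -
    interpret M: real_distribution M by fact
    have [measurable]: "char M \<in> borel_measurable borel" by (rule M.char_measurable)
    show ?thesis using that
      unfolding interval_lebesgue_integrable_def set_integrable_def
      by (auto intro!: integrableI_bounded_set_indicator[where B = "b - a"] AE_I2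
               simp: norm_mult intro!: order_trans[OF mult_mono[OF nF M.cmod_char_le_1]]) (use ab in auto)
  qed
  have L: "(\<lambda>T::nat. 1 / (2 * pi) * (CLBINT t=ereal (- real T)..ereal (real T). F t * char M t)) \<longlonglongrightarrow> measure M {a<..b}"
    if "real_distribution M" "measure M {a} = 0" "measure M {b} = 0" for M
    using real_distribution.Levy_Inversion[OF that(1) ab(1) that(2,3)] by (simp add: F_def)
  have "(\<lambda>T::nat. 1 / (2 * pi) * (CLBINT t=ereal (- real T)..ereal (real T). F t * char M1 t) -
       1 / (2 * pi) * (CLBINT t=ereal (- real T)..ereal (real T). F t * char M2 t)) \<longlonglongrightarrow>
       complex_of_real (measure M1 {a<..b}) - complex_of_real (measure M2 {a<..b})"
    by (intro tendsto_diff L M ab)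
  also have "(\<lambda>T::nat. 1 / (2 * pi) * (CLBINT t=ereal (- real T)..ereal (real T). F t * char M1 t) -
       1 / (2 * pi) * (CLBINT t=ereal (- real T)..ereal (real T). F t * char M2 t)) =
     (\<lambda>T::nat. 1 / (2 * pi) * (\<integral>t. indicator {- real T<..<real T} t *\<^sub>R (F t * d t) \<partial>lborel))"
  proof
    fix T :: nat
    have "(CLBINT t=ereal (- real T)..ereal (real T). F t * char M1 t) - (CLBINT t=ereal (- real T)..ereal (real T). F t * char M2 t) =
        (CLBINT t=ereal (- real T)..ereal (real T). F t * char M1 t - F t * char M2 t)"
      by (rule interval_lebesgue_integral_diff(2)[symmetric]; rule bchar) (use M in auto)
    also have "\<dots> = (\<integral>t. indicator {- real T<..<real T} t *\<^sub>R (F t * d t) \<partial>lborel)"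
      by (simp add: interval_lebesgue_integral_def set_lebesgue_integral_def d_def right_diff_distrib)
    finally show "1 / (2 * pi) * (CLBINT t=ereal (- real T)..ereal (real T). F t * char M1 t) -
       1 / (2 * pi) * (CLBINT t=ereal (- real T)..ereal (real T). F t * char M2 t) =
       1 / (2 * pi) * (\<integral>t. indicator {- real T<..<real T} t *\<^sub>R (F t * d t) \<partial>lborel)"
      by (simp only: right_diff_distrib[symmetric])
  qed
  finally have lim1: "(\<lambda>T::nat. 1 / (2 * pi) * (\<integral>t. indicator {- real T<..<real T} t *\<^sub>R (F t * d t) \<partial>lborel)) \<longlonglongrightarrow>
     complex_of_real (measure M1 {a<..b} - measure M2 {a<..b})"
    by simp
  have "(\<lambda>T::nat. \<integral>t. indicator {- real T<..<real T} t *\<^sub>R (F t * d t) \<partial>lborel) \<longlonglongrightarrow> (\<integral>t. F t * d t \<partial>lborel)"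
  proof (rule integral_dominated_convergence[where w = "\<lambda>x. norm (F x * d x)"])
    show "AE x in lborel. (\<lambda>n. indicator {- real n<..<real n} x *\<^sub>R (F x * d x)) \<longlonglongrightarrow> F x * d x"
    proof (rule AE_I2)
      fix x :: real
      obtain n where n: "\<bar>x\<bar> < real n" using reals_Archimedean2 by blast
      have "eventually (\<lambda>m. F x * d x = indicator {- real m<..<real m} x *\<^sub>R (F x * d x)) sequentially"
        using eventually_ge_at_top[of n] by eventually_elim (use n in \<open>auto simp: indicator_def\<close>)
      thus "(\<lambda>n. indicator {- real n<..<real n} x *\<^sub>R (F x * d x)) \<longlonglongrightarrow> F x * d x"
        by (rule Lim_transform_eventually[OF tendsto_const])
    qed
  qed (use intFd in \<open>auto simp: indicator_def\<close>)
  hence lim2: "(\<lambda>T::nat. 1 / (2 * pi) * (\<integral>t. indicator {- real T<..<real T} t *\<^sub>R (F t * d t) \<partial>lborel)) \<longlonglongrightarrow>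
      1 / (2 * pi) * (\<integral>t. F t * d t \<partial>lborel)"
    by (intro tendsto_intros)
  have main: "complex_of_real (measure M1 {a<..b} - measure M2 {a<..b}) = 1 / (2 * pi) * (\<integral>t. F t * d t \<partial>lborel)"
    by (rule LIMSEQ_unique[OF lim1 lim2])
  define g where "g = (\<lambda>t x. indicator {a..b} x *\<^sub>R (iexp (- (t * x)) * d t))"
  \<comment> \<open>At \<open>t = 0\<close> the quotient \<open>F\<close> has the default value 0,
    so the identity is kept away from this null point.\<close>
  have F_int: "(\<integral>x. g t x \<partial>lborel) = F t * d t" if "t \<noteq> 0" for t
  proof -
    have "(\<integral>x. indicator {a..b} x *\<^sub>R iexp (- (t * x)) \<partial>lborel) = iexp (- (t * b)) / (- \<i> * t) - iexp (- (t * a)) / (- \<i> * t)"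
    proof (rule integral_FTC_Icc[OF ab(1)])
      fix x
      have "((\<lambda>x. iexp (- (t * x))) has_vector_derivative (- \<i> * t) * iexp (- (t * x))) (at x within {a..b})"
        unfolding has_vector_derivative_complex_iff
        by (auto intro!: derivative_eq_intros simp: Re_exp Im_exp)
      from has_vector_derivative_divide[OF this, of "- \<i> * t"]
      show "((\<lambda>x. iexp (- (t * x)) / (- \<i> * t)) has_vector_derivative iexp (- (t * x))) (at x within {a..b})"
        using that by simp
    qed (intro continuous_intros)
    also have "\<dots> = F t"
      using that by (simp add: F_def field_simps)
    finally have "(\<integral>x. indicator {a..b} x *\<^sub>R iexp (- (t * x)) \<partial>lborel) * d t = F t * d t" by simp
    thus ?thesis by (simp add: g_def scaleR_conv_of_real mult.assoc[symmetric])
  qed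
  have "(\<integral>t. F t * d t \<partial>lborel) = (\<integral>t. (\<integral>x. g t x \<partial>lborel) \<partial>lborel)"
  proof (rule integral_cong_AE)
    show "AE t in lborel. F t * d t = (\<integral>x. g t x \<partial>lborel)"
      using AE_lborel_singleton[of 0] by eventually_elim (simp add: F_int)
    show "(\<lambda>t. \<integral>x. g t x \<partial>lborel) \<in> borel_measurable lborel"
      unfolding g_def by measurable
  qed measurable
  also have "\<dots> = (\<integral>x. (\<integral>t. g t x \<partial>lborel) \<partial>lborel)"
  proof (rule lborel_pair.Fubini_integral[symmetric])
    have gm: "(\<lambda>(t, x). g t x) \<in> borel_measurable (lborel \<Otimes>\<^sub>M lborel)"
      unfolding g_def by measurable
    show "integrable (lborel \<Otimes>\<^sub>M lborel) (\<lambda>(t, x). g t x)"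
    proof (rule lborel_pair.Fubini_integrable[OF gm])
      have "(\<integral>x. norm (g t x) \<partial>lborel) = norm (d t) * (b - a)" for t
      proof -
        have "norm (g t x) = norm (d t) * indicator {a..b} x" for x
          by (simp add: g_def norm_mult indicator_def)
        thus ?thesis using ab by simp
      qed
      thus "integrable lborel (\<lambda>t. \<integral>x. norm (case (t, x) of (t, x) \<Rightarrow> g t x) \<partial>lborel)"
        using intd by simp
      show "AE t in lborel. integrable lborel (\<lambda>x. case (t, x) of (t, x) \<Rightarrow> g t x)"
      proof (rule AE_I2)
        fix t
        have "integrable lborel (\<lambda>x. indicator {a..b} x *\<^sub>R (iexp (- (t * x)) * d t))"
          by (rule integrableI_bounded_set_indicator[where B = "norm (d t)"]) (use ab in \<open>auto simp: norm_mult\<close>)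
        thus "integrable lborel (\<lambda>x. case (t, x) of (t, x) \<Rightarrow> g t x)" by (simp add: g_def)
      qed
    qed
  qed
  also have "\<dots> = (\<integral>x. (2 * pi) * (indicator {a..b} x *\<^sub>R q x) \<partial>lborel)"
    by (intro Bochner_Integration.integral_cong refl) (simp add: g_def q_def d_def scaleR_conv_of_real)
  also have "\<dots> = (2 * pi) * (\<integral>x. indicator {a..b} x *\<^sub>R q x \<partial>lborel)"
    by (rule integral_mult_right_zero)
  finally show ?thesis unfolding main by simp
qed

text \<open>Approaching \<open>x\<close> strictly from the right keeps a possible atom at
  \<open>x\<close> inside the half-line. Used with \<open>f = 1\<close> for the two laws and with
  the density \<open>p\<close> of their difference.\<close>

lemma tendsto_integral_indicator_Ioc:
  fixes f :: "real \<Rightarrow> real"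
  assumes f: "integrable M f" and M: "sets M = sets borel"
    and a: "\<And>n. a n < - real n" and b: "\<And>n. x < b n" "\<And>n. b n < x + inverse (real (Suc n))"
  shows "(\<lambda>n. \<integral>y. indicator {a n<..b n} y * f y \<partial>M) \<longlonglongrightarrow> (\<integral>y. indicator {..x} y * f y \<partial>M)"
proof (rule integral_dominated_convergence[where w = "\<lambda>y. norm (f y)"])
  note [measurable_cong] = M
  have [measurable]: "f \<in> borel_measurable M" using f by simp
  show "(\<lambda>y. indicator {..x} y * f y) \<in> borel_measurable M"
    "\<And>n. (\<lambda>y. indicator {a n<..b n} y * f y) \<in> borel_measurable M"
    by measurable
  show "integrable M (\<lambda>y. norm (f y))" using f by simp
  show "AE y in M. norm (indicator {a n<..b n} y * f y) \<le> norm (f y)" for n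
    by (auto simp: indicator_def)
  show "AE y in M. (\<lambda>n. indicator {a n<..b n} y * f y) \<longlonglongrightarrow> indicator {..x} y * f y"
  proof (rule AE_I2)
    fix y
    have "eventually (\<lambda>n. indicator {..x} y * f y = indicator {a n<..b n} y * f y) sequentially"
    proof (cases "y \<le> x")
      case True
      obtain n where n: "- y \<le> real n" using real_arch_simple by blast
      show ?thesis using eventually_ge_at_top[of n]
      proof eventually_elim
        case (elim m)
        have "a m < y" using a[of m] n elim by linarith
        moreover have "y \<le> b m" using b(1)[of m] True by linarith
        ultimately show ?case using True by (simp add: indicator_def)
      qed
    next
      case False
      then obtain n where n: "inverse (real (Suc n)) < y - x"
        using reals_Archimedean[of "y - x"] by auto
      show ?thesis using eventually_ge_at_top[of n]
      proof eventually_elim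
        case (elim m)
        have "inverse (real (Suc m)) \<le> inverse (real (Suc n))"
          using elim by (intro le_imp_inverse_le) auto
        hence "b m < y" using b(2)[of m] n by linarith
        thus ?case using False by (simp add: indicator_def)
      qed
    qed
    thus "(\<lambda>n. indicator {a n<..b n} y * f y) \<longlonglongrightarrow> indicator {..x} y * f y"
      by (rule Lim_transform_eventually[OF tendsto_const])
  qed
qed

text \<open>The signed measure \<open>M1 - M2\<close> has the density \<open>p\<close>, and the
  integral of \<open>|p|\<close> over any set is at most that of \<open>C / (1 + x^2)\<close> over
  the line, which is \<open>C * pi\<close> whatever \<open>U\<close> is. The identity is obtained on
  half-lines and spread to all Borel sets by a Dynkin argument.\<close>

theorem total_variation_char_bound:
  fixes d1 d2 :: "real \<Rightarrow> complex"
  assumes M: "real_distribution M1" "real_distribution M2"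
    and d1: "\<And>t. ((\<lambda>t. char M1 t - char M2 t) has_vector_derivative d1 t) (at t)"
    and d2: "\<And>t. (d1 has_vector_derivative d2 t) (at t)" and cont: "continuous_on UNIV d2"
    and b: "\<And>t. norm (char M1 t - char M2 t) \<le> C / (1 + t\<^sup>2)"
      "\<And>t. norm (d1 t) \<le> C / (1 + t\<^sup>2)" "\<And>t. norm (d2 t) \<le> C / (1 + t\<^sup>2)"
    and U: "U \<in> sets borel"
  shows "\<bar>measure M1 U - measure M2 U\<bar> \<le> C * pi"
proof -
  interpret M1: real_distribution M1 by fact
  interpret M2: real_distribution M2 by fact
  note [simp] = M1.events_eq_borel M2.events_eq_borel
  define q where "q = (\<lambda>x. 1 / (2 * pi) * (\<integral>t. iexp (- (t * x)) * (char M1 t - char M2 t) \<partial>lborel))"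
  define p where "p = (\<lambda>x. Re (q x))"
  have [measurable]: "char M1 \<in> borel_measurable borel" "char M2 \<in> borel_measurable borel"
    by (rule M1.char_measurable M2.char_measurable)+
  have qm [measurable]: "q \<in> borel_measurable borel"
    unfolding q_def by measurable
  have pm [measurable]: "p \<in> borel_measurable borel"
    unfolding p_def by measurable
  have qb: "norm (q x) \<le> C / (1 + x\<^sup>2)" for x
  proof -
    have "(1 + x\<^sup>2) * norm (q x) = ((1 + x\<^sup>2) * norm (\<integral>t. iexp (- (t * x)) * (char M1 t - char M2 t) \<partial>lborel)) / (2 * pi)"
      by (simp add: q_def norm_mult norm_divide)
    also have "\<dots> \<le> (2 * C * pi) / (2 * pi)"
      by (intro divide_right_mono norm_Fourier_le[OF d1 d2 cont b]) auto
    also have "\<dots> = C" by simp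
    finally show ?thesis
      by (simp add: pos_le_divide_eq add_pos_nonneg mult.commute)
  qed
  have pb: "norm (p x) \<le> C / (1 + x\<^sup>2)" for x
    using order_trans[OF abs_Re_le_cmod qb] by (simp add: p_def)
  have intp: "integrable lborel p" by (rule integrable_Lorentz_bound[OF pm pb])
  have intq: "integrable lborel q" by (rule integrable_Lorentz_bound[OF qm qb])
  have "countable ({x. measure M1 {x} \<noteq> 0} \<union> {x. measure M2 {x} \<noteq> 0})"
    by (intro countable_Un M2.countable_support M1.countable_support)
  then have count: "countable {x. measure M1 {x} \<noteq> 0 \<or> measure M2 {x} \<noteq> 0}"
    by (simp add: Un_def)
  have Ioc: "measure M1 {a<..b} - measure M2 {a<..b} = (\<integral>y. indicator {a<..b} y * p y \<partial>lborel)"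
    if "a \<le> b" "measure M1 {a} = 0" "measure M1 {b} = 0" "measure M2 {a} = 0" "measure M2 {b} = 0" for a b
  proof -
    have "complex_of_real (measure M1 {a<..b} - measure M2 {a<..b}) = (\<integral>x. indicator {a..b} x *\<^sub>R q x \<partial>lborel)"
      unfolding q_def by (rule Levy_difference_Ioc[OF M b(1) that])
    hence "measure M1 {a<..b} - measure M2 {a<..b} = Re (\<integral>x. indicator {a..b} x *\<^sub>R q x \<partial>lborel)"
      by (metis Re_complex_of_real)
    also have "\<dots> = (\<integral>x. indicator {a..b} x * p x \<partial>lborel)"
      using integral_Re[of lborel "\<lambda>x. indicator {a..b} x *\<^sub>R q x"] integrable_mult_indicator[OF _ intq, of "{a..b}"]
      by (simp add: p_def)
    also have "\<dots> = (\<integral>y. indicator {a<..b} y * p y \<partial>lborel)"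
    proof (rule integral_cong_AE)
      show "AE x in lborel. indicator {a..b} x * p x = indicator {a<..b} x * p x"
        using AE_lborel_singleton[of a] by eventually_elim (auto simp: indicator_def)
    qed measurable
    finally show ?thesis .
  qed
  have basic: "measure M1 {..x} - measure M2 {..x} = (\<integral>y. indicator {..x} y * p y \<partial>lborel)" for x
  proof -
    \<comment> \<open>Inversion requires endpoints that are not atoms. The atoms of both laws form a
      countable set, so every nonempty open interval contains admissible endpoints.\<close>
    have "\<exists>a. a < - real n \<and> a < x \<and> measure M1 {a} = 0 \<and> measure M2 {a} = 0" for n
      using open_minus_countable[OF count, of "{..<min (- real n) x}"] by auto
    then obtain a where a: "\<And>n. a n < - real n" "\<And>n. a n < x" "\<And>n. measure M1 {a n} = 0" "\<And>n. measure M2 {a n} = 0"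
      by metis
    have "\<exists>b. x < b \<and> b < x + inverse (real (Suc n)) \<and> measure M1 {b} = 0 \<and> measure M2 {b} = 0" for n
      using open_minus_countable[OF count, of "{x<..<x + inverse (real (Suc n))}"] by auto
    then obtain b where b: "\<And>n. x < b n" "\<And>n. b n < x + inverse (real (Suc n))"
       "\<And>n. measure M1 {b n} = 0" "\<And>n. measure M2 {b n} = 0"
      by metis
    note T = tendsto_integral_indicator_Ioc[OF _ _ a(1) b(1,2)]
    have "(\<lambda>n. measure M1 {a n<..b n} - measure M2 {a n<..b n}) \<longlonglongrightarrow> measure M1 {..x} - measure M2 {..x}"
      using tendsto_diff[OF T[of M1 "\<lambda>_. 1"] T[of M2 "\<lambda>_. 1"]] by simp
    moreover have "(\<lambda>n. measure M1 {a n<..b n} - measure M2 {a n<..b n}) \<longlonglongrightarrow> (\<integral>y. indicator {..x} y * p y \<partial>lborel)"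
    proof -
      have "a n \<le> b n" for n using a(2)[of n] b(1)[of n] by linarith
      thus ?thesis using T[OF intp] by (simp add: Ioc a b)
    qed
    ultimately show ?thesis by (rule LIMSEQ_unique)
  qed
  \<comment> \<open>The signed measure has total mass 0; the complement case of the induction below
    rests on this.\<close>
  have int0: "integral\<^sup>L lborel p = 0"
  proof -
    have "(\<lambda>n. \<integral>y. indicator {..real n} y * p y \<partial>lborel) \<longlonglongrightarrow> (\<integral>y. p y \<partial>lborel)"
    proof (rule integral_dominated_convergence[where w = "\<lambda>y. norm (p y)"])
      show "AE x in lborel. (\<lambda>n. indicator {..real n} x * p x) \<longlonglongrightarrow> p x"
      proof (rule AE_I2)
        fix x :: real
        obtain n where n: "x \<le> real n" using real_arch_simple by blast
        have "eventually (\<lambda>m. p x = indicator {..real m} x * p x) sequentially"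
          using eventually_ge_at_top[of n] by eventually_elim (use n in \<open>auto simp: indicator_def\<close>)
        thus "(\<lambda>n. indicator {..real n} x * p x) \<longlonglongrightarrow> p x"
          by (rule Lim_transform_eventually[OF tendsto_const])
      qed
    qed (use intp in \<open>auto simp: indicator_def\<close>)
    moreover have "(\<lambda>n. cdf M1 (real n) - cdf M2 (real n)) \<longlonglongrightarrow> 1 - 1"
      by (intro tendsto_diff M1.cdf_lim_infty_prob M2.cdf_lim_infty_prob)
    ultimately show ?thesis
      by (simp add: cdf_def basic) (metis LIMSEQ_unique)
  qed
  have borel: "sets borel = sigma_sets UNIV (range (\<lambda>x::real. {..x}))"
    by (subst borel_eq_atMost) (simp add: sets_measure_of)
  have indp: "integrable lborel (\<lambda>y. indicator A y * p y)" if "A \<in> sets borel" for A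
    using integrable_mult_indicator[OF _ intp, of A] that by simp
  have "measure M1 U - measure M2 U = (\<integral>y. indicator U y * p y \<partial>lborel)"
  proof -
    have "Int_stable (range (\<lambda>x::real. {..x}))"
      by (auto simp: Int_stable_def)
    moreover have "range (\<lambda>x::real. {..x}) \<subseteq> Pow UNIV" by simp
    moreover have "U \<in> sigma_sets UNIV (range (\<lambda>x::real. {..x}))" using U borel by simp
    ultimately show ?thesis
    proof (induction rule: sigma_sets_induct_disjoint)
      case (basic A)
      thus ?case using \<open>\<And>x. measure M1 {..x} - measure M2 {..x} = (\<integral>y. indicator {..x} y * p y \<partial>lborel)\<close> by auto
    next
      case empty
      show ?case by simp
    next
      case (compl A)
      hence A: "A \<in> sets borel" using borel by simp
      have "measure M1 (UNIV - A) - measure M2 (UNIV - A) = - (measure M1 A - measure M2 A)"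
        using M1.prob_compl[of A] M2.prob_compl[of A] A by simp
      also have "\<dots> = (\<integral>y. p y \<partial>lborel) - (\<integral>y. indicator A y * p y \<partial>lborel)"
        using compl int0 by simp
      also have "\<dots> = (\<integral>y. p y - indicator A y * p y \<partial>lborel)"
        using intp indp[OF A] by simp
      also have "\<dots> = (\<integral>y. indicator (UNIV - A) y * p y \<partial>lborel)"
        by (intro Bochner_Integration.integral_cong) (auto simp: indicator_def)
      finally show ?case .
    next
      case (union A)
      have A: "A i \<in> sets borel" for i using union(2) borel by auto
      have "(\<lambda>i. measure M1 (A i) - measure M2 (A i)) sums (measure M1 (\<Union>i. A i) - measure M2 (\<Union>i. A i))"
        using A union(1) by (intro sums_diff M1.finite_measure_UNION M2.finite_measure_UNION) auto
      moreover have "(LINT x:(\<Union>i. A i)|lborel. p x) = (\<Sum>i. (LINT x:(A i)|lborel. p x))"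
        using A union(1) indp[of "\<Union>i. A i"]
        by (intro lebesgue_integral_countable_add) (auto simp: disjoint_family_on_def set_integrable_def)
      ultimately show ?case
        using union(3) by (simp add: sums_iff set_lebesgue_integral_def)
    qed
  qed
  also have "\<bar>\<dots>\<bar> \<le> (\<integral>y. norm (indicator U y * p y) \<partial>lborel)"
    using integral_norm_bound[of lborel "\<lambda>y. indicator U y * p y"] by simp
  also have "\<dots> \<le> C * pi"
    by (rule integral_Lorentz_bound) (use U pb in \<open>auto simp: indicator_def intro!: order_trans[OF _ pb]\<close>)
  finally show ?thesis .
qed

section \<open>The product measure on the angles\<close>

abbreviation angle :: "real measure" where
  "angle \<equiv> restrict_space lborel {0..<2*pi}"

lemma finite_measure_angle: "finite_measure angle"
  by (intro finite_measureI) (simp add: emeasure_restrict_space space_restrict_space)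

interpretation angle: finite_measure angle
  by (rule finite_measure_angle)

interpretation angles: product_sigma_finite "\<lambda>_::nat. angle"
  by (intro product_sigma_finite.intro angle.sigma_finite_measure)

lemma emeasure_space_cbe_base:
  "emeasure (cbe_base N) (space (cbe_base N)) = ennreal (2 * pi) ^ N"
proof -
  have "space (cbe_base N) = PiE {..<N} (\<lambda>_. space angle)"
    by (simp add: cbe_base_def space_PiM)
  also have "emeasure (cbe_base N) \<dots> = (\<Prod>i<N. emeasure angle (space angle))"
    unfolding cbe_base_def by (rule angles.emeasure_PiM) (simp, rule sets.top)
  also have "\<dots> = ennreal (2 * pi) ^ N"
    by (simp add: emeasure_restrict_space space_restrict_space)
  finally show ?thesis .
qed

lemma finite_measure_cbe_base: "finite_measure (cbe_base N)"
  by (rule finite_measureI) (simp add: emeasure_space_cbe_base power_eq_top_ennreal)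

lemma measurable_cbe_base_component:
  assumes "i < N"
  shows "(\<lambda>t. t i) \<in> borel_measurable (cbe_base N)"
proof -
  have "(\<lambda>t. t i) \<in> measurable (cbe_base N) angle"
    unfolding cbe_base_def by (rule measurable_component_singleton) (use assms in auto)
  moreover have "(\<lambda>x. x) \<in> measurable angle borel"
    by (rule measurable_restrict_space1) simp
  ultimately show ?thesis
    using measurable_compose by blast
qed

lemma cbe_base_insert:
  assumes "i < N"
  shows "cbe_base N = PiM (insert i ({..<N} - {i})) (\<lambda>_. angle)"
  using assms by (simp add: cbe_base_def insert_absorb)

text \<open>Tonelli in the single coordinate \<open>i\<close>: null slices for every choice of the
  other angles make a null set. Varying one angle is enough to rule out coincidences.\<close>

lemma AE_cbe_base_coord:
  assumes i: "i < N" and P [measurable]: "Measurable.pred (cbe_base N) P"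
    and AE: "\<And>t. AE x in lborel. P (t(i := x))"
  shows "AE t in cbe_base N. P t"
proof -
  let ?I = "{..<N} - {i}"
  let ?f = "\<lambda>t. indicator {t \<in> space (cbe_base N). \<not> P t} t :: ennreal"
  have meas: "?f \<in> borel_measurable (PiM (insert i ?I) (\<lambda>_. angle))"
    unfolding cbe_base_insert[OF i, symmetric] by measurable
  have "emeasure (cbe_base N) {t \<in> space (cbe_base N). \<not> P t} = integral\<^sup>N (cbe_base N) ?f"
    by simp
  also have "\<dots> = (\<integral>\<^sup>+ t. (\<integral>\<^sup>+ x. ?f (t(i := x)) \<partial>angle) \<partial>(PiM ?I (\<lambda>_. angle)))"
    by (subst (1) cbe_base_insert[OF i], rule angles.product_nn_integral_insert[OF _ _ meas]) auto
  also have "\<dots> = (\<integral>\<^sup>+ t. 0 \<partial>(PiM ?I (\<lambda>_. angle)))"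
  proof (intro nn_integral_cong)
    fix t
    have "AE x in angle. P (t(i := x))"
      using AE[of t] by (subst AE_restrict_space_iff) auto
    hence "AE x in angle. ?f (t(i := x)) = 0"
      by eventually_elim (auto simp: indicator_def)
    thus "(\<integral>\<^sup>+ x. ?f (t(i := x)) \<partial>angle) = 0"
      by (subst nn_integral_cong_AE[of _ "\<lambda>_. 0"]) auto
  qed
  finally have "emeasure (cbe_base N) {t \<in> space (cbe_base N). \<not> P t} = 0"
    by simp
  thus ?thesis
    by (subst AE_iff_measurable[OF _ refl]) auto
qed

section \<open>Integration by parts in one angle\<close>

lemma integral_angle_periodic_deriv:
  fixes F F' :: "real \<Rightarrow> complex"
  assumes deriv: "\<And>x. (F has_vector_derivative F' x) (at x)"
    and cont: "continuous_on UNIV F'" and per: "F (2*pi) = F 0"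
  shows "integral\<^sup>L angle F' = 0"
proof -
  have "integral\<^sup>L angle F' = (\<integral>x. indicator {0..<2*pi} x *\<^sub>R F' x \<partial>lborel)"
    by (subst integral_restrict_space) auto
  also have "\<dots> = (\<integral>x. indicator {0..2*pi} x *\<^sub>R F' x \<partial>lborel)"
  proof (rule integral_cong_AE)
    have [measurable]: "F' \<in> borel_measurable borel"
      using cont by (rule borel_measurable_continuous_onI)
    show "(\<lambda>x. indicator {0..<2*pi} x *\<^sub>R F' x) \<in> borel_measurable lborel"
         "(\<lambda>x. indicator {0..2*pi} x *\<^sub>R F' x) \<in> borel_measurable lborel"
      by measurable
    show "AE x in lborel. indicator {0..<2*pi} x *\<^sub>R F' x = indicator {0..2*pi} x *\<^sub>R F' x"
      using AE_lborel_singleton[of "2*pi"] by eventually_elim (auto simp: indicator_def)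
  qed
  also have "\<dots> = F (2*pi) - F 0"
    using deriv cont
    by (intro integral_FTC_Icc) (auto intro: has_vector_derivative_at_within continuous_on_subset)
  finally show ?thesis using per by simp
qed

text \<open>Periodicity removes the boundary terms. The differentiability at every point that is
  demanded here is what the regularised weights supply.\<close>

lemma integral_cbe_base_periodic_deriv:
  fixes F F' :: "(nat \<Rightarrow> real) \<Rightarrow> complex"
  assumes i: "i < N"
    and int: "integrable (cbe_base N) F'"
    and deriv: "\<And>t x. ((\<lambda>x. F (t(i := x))) has_vector_derivative F' (t(i := x))) (at x)"
    and cont: "\<And>t. continuous_on UNIV (\<lambda>x. F' (t(i := x)))"
    and per: "\<And>t. F (t(i := 2*pi)) = F (t(i := 0))"
  shows "integral\<^sup>L (cbe_base N) F' = 0"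
proof -
  let ?I = "{..<N} - {i}"
  have "integral\<^sup>L (cbe_base N) F' = (\<integral>t. (\<integral>x. F' (t(i := x)) \<partial>angle) \<partial>(PiM ?I (\<lambda>_. angle)))"
    using int unfolding cbe_base_insert[OF i]
    by (intro angles.product_integral_insert) auto
  also have "\<dots> = 0"
    using integral_angle_periodic_deriv[OF deriv cont per] by simp
  finally show ?thesis .
qed

section \<open>Invariance of the base measure under exchanging two angles\<close>

lemma measurable_cbe_base_transpose:
  assumes ij: "i < N" "j < N"
  shows "(\<lambda>t. t \<circ> Transposition.transpose i j) \<in> measurable (cbe_base N) (cbe_base N)"
  unfolding cbe_base_def
proof (rule measurable_PiM_single')
  have \<tau>: "Transposition.transpose i j k < N \<longleftrightarrow> k < N" for k
    using ij by (auto simp: Transposition.transpose_def)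
  show "\<And>k. k \<in> {..<N} \<Longrightarrow> (\<lambda>t. (t \<circ> Transposition.transpose i j) k) \<in> measurable (PiM {..<N} (\<lambda>_. angle)) angle"
    unfolding o_def by (rule measurable_component_singleton) (auto simp: \<tau>)
  show "(\<lambda>t. t \<circ> Transposition.transpose i j) \<in> space (PiM {..<N} (\<lambda>_. angle)) \<rightarrow> {..<N} \<rightarrow>\<^sub>E space angle"
    by (auto simp: space_PiM PiE_iff \<tau> extensional_def)
qed

text \<open>All factors are the same measure, and the exchange merely permutes the sides of a box,
  so comparing boxes suffices.\<close>

lemma distr_cbe_base_transpose:
  assumes ij: "i < N" "j < N"
  shows "distr (cbe_base N) (cbe_base N) (\<lambda>t. t \<circ> Transposition.transpose i j) = cbe_base N"
proof -
  have \<tau>: "Transposition.transpose i j k < N \<longleftrightarrow> k < N" for k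
    using ij by (auto simp: Transposition.transpose_def)
  have bij: "bij_betw (Transposition.transpose i j) {..<N} {..<N}"
    by (rule bij_betwI[where g = "Transposition.transpose i j"]) (auto simp: \<tau>)
  note meas = measurable_cbe_base_transpose[OF ij]
  show ?thesis
    unfolding cbe_base_def
  proof (rule angles.PiM_eqI)
    fix A assume A: "\<And>k. k \<in> {..<N} \<Longrightarrow> A k \<in> sets angle"
    have "emeasure (distr (cbe_base N) (cbe_base N) (\<lambda>t. t \<circ> Transposition.transpose i j)) (PiE {..<N} A) =
          emeasure (cbe_base N) ((\<lambda>t. t \<circ> Transposition.transpose i j) -` PiE {..<N} A \<inter> space (cbe_base N))"
      using A by (intro emeasure_distr meas) (auto simp: cbe_base_def intro!: sets_PiM_I_finite)
    also have "(\<lambda>t. t \<circ> Transposition.transpose i j) -` PiE {..<N} A \<inter> space (cbe_base N) =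
               PiE {..<N} (\<lambda>k. A (Transposition.transpose i j k))"
    proof (intro equalityI subsetI)
      fix t assume "t \<in> (\<lambda>t. t \<circ> Transposition.transpose i j) -` PiE {..<N} A \<inter> space (cbe_base N)"
      hence t: "t \<circ> Transposition.transpose i j \<in> PiE {..<N} A" "t \<in> extensional {..<N}"
        by (auto simp: cbe_base_def space_PiM PiE_iff)
      have "t k \<in> A (Transposition.transpose i j k)" if "k < N" for k
        using PiE_mem[OF t(1), of "Transposition.transpose i j k"] that by (simp add: \<tau>)
      thus "t \<in> PiE {..<N} (\<lambda>k. A (Transposition.transpose i j k))"
        using t(2) by (auto simp: PiE_iff)
    next
      fix t assume t: "t \<in> PiE {..<N} (\<lambda>k. A (Transposition.transpose i j k))"
      have sp: "A k \<subseteq> space angle" if "k < N" for k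
        using sets.sets_into_space[OF A[of k]] that by simp
      have "t \<in> space (cbe_base N)"
      proof -
        have "t k \<in> space angle" if "k < N" for k
          using PiE_mem[OF t, of k] sp[of "Transposition.transpose i j k"] that \<tau> by blast
        thus ?thesis
          using t by (auto simp: cbe_base_def space_PiM PiE_iff)
      qed
      moreover have "(t \<circ> Transposition.transpose i j) k \<in> A k" if "k < N" for k
        using PiE_mem[OF t, of "Transposition.transpose i j k"] that by (simp add: \<tau>)
      moreover have "t \<circ> Transposition.transpose i j \<in> extensional {..<N}"
        using t by (auto simp: PiE_iff extensional_def \<tau>)
      ultimately show "t \<in> (\<lambda>t. t \<circ> Transposition.transpose i j) -` PiE {..<N} A \<inter> space (cbe_base N)"
        by (auto simp: PiE_iff)
    qed
    also have "emeasure (cbe_base N) \<dots> = (\<Prod>k<N. emeasure angle (A (Transposition.transpose i j k)))"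
      unfolding cbe_base_def using A by (intro angles.emeasure_PiM) (auto simp: \<tau>)
    also have "\<dots> = (\<Prod>k<N. emeasure angle (A k))"
      by (rule prod.reindex_bij_betw[OF bij])
    finally show "emeasure (distr (PiM {..<N} (\<lambda>_. angle)) (PiM {..<N} (\<lambda>_. angle)) (\<lambda>t. t \<circ> Transposition.transpose i j)) (PiE {..<N} A) =
          (\<Prod>k<N. emeasure angle (A k))"
      by (simp only: cbe_base_def)
  qed auto
qed

lemma integral_cbe_base_transpose:
  fixes F :: "(nat \<Rightarrow> real) \<Rightarrow> complex"
  assumes ij: "i < N" "j < N" and F: "F \<in> borel_measurable (cbe_base N)"
  shows "(\<integral>t. F (t \<circ> Transposition.transpose i j) \<partial>cbe_base N) = integral\<^sup>L (cbe_base N) F"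
proof -
  have "integral\<^sup>L (distr (cbe_base N) (cbe_base N) (\<lambda>t. t \<circ> Transposition.transpose i j)) F =
        (\<integral>t. F (t \<circ> Transposition.transpose i j) \<partial>cbe_base N)"
    by (rule integral_distr[OF measurable_cbe_base_transpose[OF ij] F])
  thus ?thesis by (simp add: distr_cbe_base_transpose[OF ij])
qed

section \<open>Regularised weights\<close>

text \<open>The squared chord length \<open>|1 - cis x|\<^sup>2\<close> is shifted by \<open>e > 0\<close>, which makes every weight smooth and
  every logarithmic derivative bounded even for small \<open>\<beta>\<close>; only after antisymmetrisation, when all
  integrands are bounded uniformly in \<open>e\<close>, is \<open>e\<close> sent to \<open>0\<close>.\<close>

definition reg_chord :: "real \<Rightarrow> real \<Rightarrow> real" where
  "reg_chord e x = 2 - 2 * cos x + e"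

text \<open>The derivative of \<open>ln (reg_chord e x)\<close>; at \<open>e = 0\<close> it is the
  cotangent of \<open>x / 2\<close>.\<close>

definition reg_cot :: "real \<Rightarrow> real \<Rightarrow> real" where
  "reg_cot e x = 2 * sin x / reg_chord e x"

lemma reg_chord_pos: "e > 0 \<Longrightarrow> reg_chord e x > 0"
  using cos_le_one[of x] unfolding reg_chord_def by linarith

lemma reg_chord_le: "e \<le> 1 \<Longrightarrow> reg_chord e x \<le> 5"
  using cos_ge_minus_one[of x] unfolding reg_chord_def by linarith

lemma reg_chord_minus [simp]: "reg_chord e (-x) = reg_chord e x"
  by (simp add: reg_chord_def)

lemma reg_chord_commute: "reg_chord e (x - y) = reg_chord e (y - x)"
  using reg_chord_minus[of e "x - y"] by simp

lemma reg_cot_commute: "reg_cot e (x - y) = - reg_cot e (y - x)"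
  unfolding reg_cot_def reg_chord_commute[of e x y] using sin_minus[of "y - x"] by simp

lemma cmod_1_minus_cis: "(cmod (1 - cis x))\<^sup>2 = reg_chord 0 x"
proof -
  have "(cmod (1 - cis x))\<^sup>2 = (1 - cos x)\<^sup>2 + (sin x)\<^sup>2"
    by (simp add: cmod_power2)
  also have "\<dots> = 2 - 2 * cos x"
    using sin_cos_squared_add[of x] by (simp add: power2_eq_square algebra_simps)
  finally show ?thesis by (simp add: reg_chord_def)
qed

lemma cmod_cis_diff: "cmod (cis a - cis b) = cmod (1 - cis (a - b))"
proof -
  have "cis a - cis b = - (cis b * (1 - cis (a - b)))"
    by (simp add: algebra_simps cis_mult)
  thus ?thesis by (simp add: norm_mult)
qed

lemma abs_sin_le_cmod: "\<bar>sin x\<bar> \<le> cmod (1 - cis x)"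
  using abs_Im_le_cmod[of "1 - cis x"] by simp

text \<open>The zero of \<open>1 - cis x\<close> cancels the pole of the cotangent. The bound does
  not depend on \<open>e\<close>, so it supplies the dominating function for
  \<open>e \<rightarrow> 0\<close>.\<close>

lemma cmod_reg_cot_le:
  assumes "e > 0"
  shows "cmod (1 - cis x) * \<bar>reg_cot e x\<bar> \<le> 2"
proof -
  have "cmod (1 - cis x) * \<bar>reg_cot e x\<bar> = 2 * (cmod (1 - cis x) * \<bar>sin x\<bar>) / reg_chord e x"
    using reg_chord_pos[OF assms, of x] by (simp add: reg_cot_def abs_mult)
  also have "\<dots> \<le> 2 * (cmod (1 - cis x) * cmod (1 - cis x)) / reg_chord e x"
    using reg_chord_pos[OF assms, of x] abs_sin_le_cmod[of x]
    by (intro divide_right_mono mult_left_mono) auto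
  also have "\<dots> = 2 * reg_chord 0 x / reg_chord e x"
    by (simp add: cmod_1_minus_cis[symmetric] power2_eq_square)
  also have "\<dots> \<le> 2 * reg_chord e x / reg_chord e x"
    using reg_chord_pos[OF assms, of x] assms by (intro divide_right_mono) (auto simp: reg_chord_def)
  finally show ?thesis using reg_chord_pos[OF assms, of x] by simp
qed

text \<open>Multiplying the half-angle cotangent by \<open>1 - cis x\<close> leaves a polynomial of
  degree one in \<open>cis x\<close>. This is why the force terms can again be expressed by moments
  and the recursion closes.\<close>

lemma reg_cot_0:
  assumes "cos x \<noteq> 1"
  shows "(1 - cis x) * of_real (reg_cot 0 x) = -\<i> * (1 + cis x)"
proof -
  have "reg_chord 0 x \<noteq> 0"
    using assms by (simp add: reg_chord_def)
  moreover have "(1 - cis x) * of_real (2 * sin x) = -\<i> * (1 + cis x) * of_real (reg_chord 0 x)"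
  proof (rule complex_eqI)
    have "sin x * sin x = (1 + cos x) * (1 - cos x)"
      using sin_squared_eq[of x] by (simp add: power2_eq_square ring_distribs)
    hence "- (sin x * (2 * sin x)) = - ((1 + cos x) * (2 - 2 * cos x))"
      by (simp only: right_diff_distrib mult.assoc mult.left_commute[of _ 2] mult_1_right mult.commute[of _ 2])
    thus "Im ((1 - cis x) * of_real (2 * sin x)) = Im (-\<i> * (1 + cis x) * of_real (reg_chord 0 x))"
      by (simp add: reg_chord_def)
  qed (simp add: reg_chord_def algebra_simps)
  ultimately show ?thesis
    by (simp add: reg_cot_def field_simps del: of_real_mult of_real_diff)
qed

lemma AE_cos_neq_1: "AE x in lborel. cos (x - a :: real) \<noteq> 1"
proof -
  have "{x. cos (x - a) = 1} \<subseteq> range (\<lambda>n::int. a + n * 2 * pi)"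
  proof
    fix x assume "x \<in> {x. cos (x - a) = 1}"
    then obtain n :: int where "x - a = n * 2 * pi"
      by (auto simp: cos_one_2pi_int)
    hence "x = a + real_of_int n * 2 * pi" by simp
    thus "x \<in> range (\<lambda>n::int. a + n * 2 * pi)" by blast
  qed
  hence "countable {x. cos (x - a) = 1}"
    by (rule countable_subset) auto
  hence "{x. cos (x - a) = 1} \<in> null_sets lborel"
    by (rule countable_imp_null_set_lborel)
  thus ?thesis by (rule AE_I') auto
qed

text \<open>Isolates the terms containing the index \<open>i\<close>; serves both for
  differentiating the interaction in one angle and for induction on \<open>N\<close>.\<close>

lemma double_sum_split:
  fixes s :: "'a \<Rightarrow> 'a \<Rightarrow> 'b :: comm_monoid_add"
  assumes "finite I" "i \<in> I"
  shows "(\<Sum>j\<in>I. \<Sum>k\<in>I-{j}. s j k) =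
    (\<Sum>k\<in>I-{i}. s i k) + (\<Sum>j\<in>I-{i}. s j i) + (\<Sum>j\<in>I-{i}. \<Sum>k\<in>I-{j}-{i}. s j k)"
proof -
  have "(\<Sum>j\<in>I. \<Sum>k\<in>I-{j}. s j k) = (\<Sum>k\<in>I-{i}. s i k) + (\<Sum>j\<in>I-{i}. \<Sum>k\<in>I-{j}. s j k)"
    using assms by (subst sum.remove[of I i]) auto
  also have "(\<Sum>j\<in>I-{i}. \<Sum>k\<in>I-{j}. s j k) = (\<Sum>j\<in>I-{i}. s j i + (\<Sum>k\<in>I-{j}-{i}. s j k))"
    using assms by (intro sum.cong refl, subst sum.remove[of _ i]) auto
  finally show ?thesis by (simp add: sum.distrib add_ac)
qed

lemma double_sum_symmetric:
  fixes s :: "nat \<Rightarrow> nat \<Rightarrow> real"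
  assumes "\<And>j k. s j k = s k j"
  shows "(\<Sum>j<N. \<Sum>k\<in>{..<N}-{j}. s j k) = 2 * (\<Sum>k<N. \<Sum>j<k. s j k)"
proof (induction N)
  case (Suc N)
  have 1: "{..<Suc N} - {N} = {..<N}" by auto
  have "{..<Suc N} - {j} - {N} = {..<N} - {j}" for j
    by auto
  hence "(\<Sum>j<Suc N. \<Sum>k\<in>{..<Suc N}-{j}. s j k) =
      (\<Sum>k<N. s N k) + (\<Sum>j<N. s j N) + (\<Sum>j<N. \<Sum>k\<in>{..<N}-{j}. s j k)"
    using double_sum_split[of "{..<Suc N}" N s] unfolding 1 by simp
  also have "(\<Sum>k<N. s N k) = (\<Sum>j<N. s j N)"
    using assms by simp
  finally show ?case using Suc by simp
qed simp

text \<open>Outside this set \<open>log_abs_D\<close> takes the junk value \<open>ln 0 = 0\<close> or the weight vanishes.\<close>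

definition cbe_generic :: "real \<Rightarrow> nat \<Rightarrow> (nat \<Rightarrow> real) \<Rightarrow> bool" where
  "cbe_generic \<theta> N t \<longleftrightarrow> (\<forall>i<N. cos (t i - \<theta>) \<noteq> 1) \<and>
     (\<forall>i<N. \<forall>j<N. i \<noteq> j \<longrightarrow> cos (t i - t j) \<noteq> 1)"

lemma AE_cbe_generic: "AE t in cbe_base N. cbe_generic \<theta> N t"
proof -
  have "AE t in cbe_base N. cos (t i - \<theta>) \<noteq> 1" if [simp]: "i < N" for i
  proof (rule AE_cbe_base_coord[where i = i])
    note [measurable] = measurable_cbe_base_component[of i N]
    show "Measurable.pred (cbe_base N) (\<lambda>t. cos (t i - \<theta>) \<noteq> 1)"
      by measurable
  qed (use AE_cos_neq_1 in auto)
  moreover have "AE t in cbe_base N. cos (t i - t j) \<noteq> 1"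
    if [simp]: "i < N" "j < N" and ij: "i \<noteq> j" for i j
  proof (rule AE_cbe_base_coord[where i = i])
    note [measurable] = measurable_cbe_base_component[of i N] measurable_cbe_base_component[of j N]
    show "Measurable.pred (cbe_base N) (\<lambda>t. cos (t i - t j) \<noteq> 1)"
      by measurable
    show "AE x in lborel. cos ((t(i := x)) i - (t(i := x)) j) \<noteq> 1" for t :: "nat \<Rightarrow> real"
      using AE_cos_neq_1[of "t j"] ij by simp
  qed auto
  ultimately show ?thesis
    unfolding cbe_generic_def by (simp add: AE_all_countable)
qed

section \<open>The regularised weight and its derivative in one angle\<close>

locale cbe =
  fixes \<beta> \<theta> :: real and N :: nat
  assumes \<beta>: "\<beta> > 0"
begin

text \<open>Angles are measured from \<theta>, so that \<open>|D|\<close> is the product of the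
  moduli of \<open>1 - rot t l\<close>.\<close>

definition rot :: "(nat \<Rightarrow> real) \<Rightarrow> nat \<Rightarrow> complex" where
  "rot t l = cis (t l - \<theta>)"

text \<open>\<open>reg_chord\<close> is a squared length and every pair occurs twice in the double
  sum; hence \<open>z / 2\<close> and \<open>\<beta> / 4\<close>. Off coincidences, the exponential
  at \<open>e = 0\<close> is \<open>|D| ^ z\<close> times the ensemble weight.\<close>

definition reg_energy :: "real \<Rightarrow> complex \<Rightarrow> (nat \<Rightarrow> real) \<Rightarrow> complex" where
  "reg_energy e z t = z / 2 * of_real (\<Sum>l<N. ln (reg_chord e (t l - \<theta>))) +
     of_real (\<beta> / 4 * (\<Sum>j<N. \<Sum>k\<in>{..<N}-{j}. ln (reg_chord e (t j - t k))))"

definition reg_force :: "real \<Rightarrow> complex \<Rightarrow> nat \<Rightarrow> (nat \<Rightarrow> real) \<Rightarrow> complex" where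
  "reg_force e z i t = z / 2 * of_real (reg_cot e (t i - \<theta>)) +
     of_real (\<beta> / 2 * (\<Sum>k\<in>{..<N}-{i}. reg_cot e (t i - t k)))"

text \<open>For \<open>m = 1\<close> the conjugate factors complete the product of all
  \<open>1 - rot t l\<close> to \<open>|D| ^ 2\<close>, which amounts to a shift of \<open>z\<close>
  by 2.\<close>

definition reg_weight :: "real \<Rightarrow> complex \<Rightarrow> nat \<Rightarrow> (nat \<Rightarrow> real) \<Rightarrow> complex" where
  "reg_weight e z m t = (\<Prod>l<N. (1 - cnj (rot t l)) ^ m) * exp (reg_energy e z t)"

definition lim_weight :: "complex \<Rightarrow> nat \<Rightarrow> (nat \<Rightarrow> real) \<Rightarrow> complex" where
  "lim_weight z m t = (\<Prod>l<N. (1 - cnj (rot t l)) ^ m) *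
     exp (z * of_real (log_abs_D N \<theta> t)) * of_real (cbe_weight \<beta> N t)"

lemma measurable_coord: "l < N \<Longrightarrow> (\<lambda>t. t l) \<in> borel_measurable (cbe_base N)"
  by (rule measurable_cbe_base_component)

lemma measurable_cis [measurable]: "cis \<in> borel_measurable borel"
  by (intro borel_measurable_continuous_onI continuous_intros)

lemma measurable_cnj [measurable]: "cnj \<in> borel_measurable borel"
  by (intro borel_measurable_continuous_onI continuous_intros)

lemma measurable_rot: "l < N \<Longrightarrow> (\<lambda>t. rot t l) \<in> borel_measurable (cbe_base N)"
  using measurable_coord[of l] unfolding rot_def by measurable

lemma measurable_reg_chord [measurable]: "reg_chord e \<in> borel_measurable borel"
  unfolding reg_chord_def by measurable

lemma measurable_reg_cot [measurable]: "reg_cot e \<in> borel_measurable borel"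
  unfolding reg_cot_def by measurable

lemma measurable_reg_weight: "reg_weight e z m \<in> borel_measurable (cbe_base N)"
  unfolding reg_weight_def reg_energy_def
  by (intro borel_measurable_times borel_measurable_prod borel_measurable_power borel_measurable_diff
      borel_measurable_const measurable_compose[OF _ borel_measurable_exp] borel_measurable_add measurable_compose[OF _ borel_measurable_of_real]
      borel_measurable_sum borel_measurable_ln
      measurable_compose[OF _ measurable_reg_chord] measurable_compose[OF _ measurable_cnj]
      measurable_rot measurable_coord) auto

lemma measurable_log_abs_D: "log_abs_D N \<theta> \<in> borel_measurable (cbe_base N)"
  unfolding log_abs_D_def char_poly_D_def
  by (intro borel_measurable_ln measurable_compose[OF _ borel_measurable_norm] borel_measurable_prod borel_measurable_diff
      borel_measurable_const measurable_compose[OF _ measurable_cis] measurable_coord) auto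

lemma measurable_cbe_weight: "cbe_weight \<beta> N \<in> borel_measurable (cbe_base N)"
  unfolding cbe_weight_def
  by (intro borel_measurable_prod powr_real_measurable measurable_compose[OF _ borel_measurable_norm] borel_measurable_diff
      borel_measurable_const measurable_compose[OF _ measurable_cis] measurable_coord) auto

lemma measurable_lim_weight: "lim_weight z m \<in> borel_measurable (cbe_base N)"
  unfolding lim_weight_def
  by (intro borel_measurable_times borel_measurable_prod borel_measurable_power borel_measurable_diff
      borel_measurable_const measurable_compose[OF _ borel_measurable_exp] measurable_compose[OF _ borel_measurable_of_real]
      measurable_compose[OF _ measurable_cnj]
      measurable_log_abs_D measurable_cbe_weight measurable_rot) auto

lemma has_vector_derivative_reg_energy:
  assumes e: "e > 0" and i: "i < N"
  shows "((\<lambda>x. reg_energy e z (t(i := x))) has_vector_derivative reg_force e z i (t(i := x))) (at x)"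
proof -
  define c1 where "c1 = (\<Sum>l\<in>{..<N}-{i}. ln (reg_chord e (t l - \<theta>)))"
  define c2 where "c2 = (\<Sum>j\<in>{..<N}-{i}. \<Sum>k\<in>{..<N}-{j}-{i}. ln (reg_chord e (t j - t k)))"
  have 1: "(\<Sum>l<N. ln (reg_chord e ((t(i := x)) l - \<theta>))) = ln (reg_chord e (x - \<theta>)) + c1" for x
    using i sum.remove[of "{..<N}" i "\<lambda>l. ln (reg_chord e ((t(i := x)) l - \<theta>))"]
    by (simp add: c1_def)
  have 2: "(\<Sum>j<N. \<Sum>k\<in>{..<N}-{j}. ln (reg_chord e ((t(i := x)) j - (t(i := x)) k))) =
      2 * (\<Sum>k\<in>{..<N}-{i}. ln (reg_chord e (x - t k))) + c2" for x
  proof -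
    have "(\<Sum>j\<in>{..<N}-{i}. ln (reg_chord e (t j - x))) = (\<Sum>k\<in>{..<N}-{i}. ln (reg_chord e (x - t k)))"
      by (intro sum.cong refl arg_cong[where f = ln] reg_chord_commute)
    thus ?thesis
      using i double_sum_split[of "{..<N}" i "\<lambda>j k. ln (reg_chord e ((t(i := x)) j - (t(i := x)) k))"]
      by (simp add: c2_def)
  qed
  have *: "((\<lambda>x. ln (reg_chord e (x - a))) has_real_derivative reg_cot e (x - a)) (at x)" for a x
    using reg_chord_pos[OF e, of "x - a"] unfolding reg_chord_def reg_cot_def
    by (auto intro!: derivative_eq_intros simp: field_simps)
  have d1: "((\<lambda>x. ln (reg_chord e (x - \<theta>)) + c1) has_real_derivative reg_cot e (x - \<theta>)) (at x)"
    using DERIV_add[OF *[of \<theta> x] DERIV_const[of c1]] by simp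
  have d2: "((\<lambda>x. \<beta> / 4 * (2 * (\<Sum>k\<in>{..<N}-{i}. ln (reg_chord e (x - t k))) + c2)) has_real_derivative
      \<beta> / 2 * (\<Sum>k\<in>{..<N}-{i}. reg_cot e (x - t k))) (at x)"
  proof -
    have "((\<lambda>x. \<Sum>k\<in>{..<N}-{i}. ln (reg_chord e (x - t k))) has_real_derivative
        (\<Sum>k\<in>{..<N}-{i}. reg_cot e (x - t k))) (at x)"
      by (rule DERIV_sum) (rule *)
    from DERIV_cmult[OF DERIV_add[OF DERIV_cmult[OF this, of 2] DERIV_const[of c2]], of "\<beta> / 4"]
    show ?thesis by simp
  qed
  have f: "reg_force e z i (t(i := x)) = z / 2 * of_real (reg_cot e (x - \<theta>)) +
     of_real (\<beta> / 2 * (\<Sum>k\<in>{..<N}-{i}. reg_cot e (x - t k)))"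
    by (simp add: reg_force_def)
  show ?thesis
    unfolding reg_energy_def 1 2 f
    by (intro has_vector_derivative_add has_vector_derivative_mult_right has_vector_derivative_of_real)
       (use d1 d2 in auto)
qed

text \<open>Multiplying by \<open>1 - rot t i\<close> before differentiating compensates the pole
  that the force acquires at \<theta> as \<open>e\<close> tends to 0, and leads to a relation
  between the products over \<open>insert i B\<close> and over \<open>B\<close>.\<close>

lemma has_vector_derivative_reg:
  assumes e: "e > 0" and i: "i < N" "i \<notin> B" and B: "B \<subseteq> {..<N}"
  shows "((\<lambda>x. (\<Prod>l\<in>insert i B. 1 - rot (t(i := x)) l) * reg_weight e z m (t(i := x)))
     has_vector_derivative
       (\<lambda>t. (\<Prod>l\<in>B. 1 - rot t l) * reg_weight e z m t *
          (-\<i> * (rot t i + of_nat m) + (1 - rot t i) * reg_force e z i t)) (t(i := x))) (at x)"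
proof -
  have fin: "finite B" using B finite_subset by blast
  define C where "C = (\<Prod>l\<in>B. 1 - rot t l) * (\<Prod>l\<in>{..<N}-{i}. (1 - cnj (rot t l)) ^ m)"
  have P: "(\<Prod>l\<in>B. 1 - rot (t(i := x)) l) = (\<Prod>l\<in>B. 1 - rot t l)" for x
    using i by (intro prod.cong) (auto simp: rot_def)
  have R: "rot (t(i := x)) i = cis (x - \<theta>)" for x
    by (simp add: rot_def)
  have Q: "(\<Prod>l<N. (1 - cnj (rot (t(i := x)) l)) ^ m) =
     (1 - cnj (cis (x - \<theta>))) ^ m * (\<Prod>l\<in>{..<N}-{i}. (1 - cnj (rot t l)) ^ m)" for x
    using i prod.remove[of "{..<N}" i "\<lambda>l. (1 - cnj (rot (t(i := x)) l)) ^ m"]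
    by (simp add: R) (simp add: rot_def)
  have F: "(\<Prod>l\<in>insert i B. 1 - rot (t(i := x)) l) * reg_weight e z m (t(i := x)) =
     C * ((1 - cis (x - \<theta>)) * (1 - cnj (cis (x - \<theta>))) ^ m * exp (reg_energy e z (t(i := x))))" for x
    unfolding prod.insert[OF fin i(2)] P Q R reg_weight_def C_def by (simp only: mult_ac)
  have dcis: "((\<lambda>x. cis (x - \<theta>)) has_vector_derivative \<i> * cis (x - \<theta>)) (at x)"
    unfolding has_vector_derivative_complex_iff
    by (auto intro!: derivative_eq_intros)
  have dcnj: "((\<lambda>x. cnj (cis (x - \<theta>))) has_vector_derivative - \<i> * cnj (cis (x - \<theta>))) (at x)"
    using has_vector_derivative_cnj[OF dcis] by simp
  have d1: "((\<lambda>x. (1 - cis (x - \<theta>))) has_vector_derivative - \<i> * cis (x - \<theta>)) (at x)"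
    using has_vector_derivative_diff[OF has_vector_derivative_const[of 1] dcis] by simp
  have d2: "((\<lambda>x. (1 - cnj (cis (x - \<theta>)))) has_vector_derivative \<i> * cnj (cis (x - \<theta>))) (at x)"
    using has_vector_derivative_diff[OF has_vector_derivative_const[of 1] dcnj] by simp
  have d3: "((\<lambda>x. (1 - cnj (cis (x - \<theta>))) ^ m) has_vector_derivative
      \<i> * cnj (cis (x - \<theta>)) * (of_nat m * (1 - cnj (cis (x - \<theta>))) ^ (m - 1))) (at x)"
    using field_vector_diff_chain_at[OF d2 DERIV_power[OF DERIV_ident, of m]] by (simp add: o_def mult_ac)
  have d4: "((\<lambda>x. exp (reg_energy e z (t(i := x)))) has_vector_derivative
      reg_force e z i (t(i := x)) * exp (reg_energy e z (t(i := x)))) (at x)"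
    using field_vector_diff_chain_at[OF has_vector_derivative_reg_energy[OF e i(1)] DERIV_exp]
    by (simp add: o_def)
  \<comment> \<open>On the unit circle \<open>(1 - w) * cnj w = - (1 - cnj w)\<close>, so the factor
    \<open>1 - rot t i\<close> restores the power of \<open>1 - cnj (rot t i)\<close> lost by
    differentiation.\<close>
  have key: "(1 - cis (x - \<theta>)) * (\<i> * cnj (cis (x - \<theta>)) * (of_nat m * (1 - cnj (cis (x - \<theta>))) ^ (m - 1))) =
      - \<i> * of_nat m * (1 - cnj (cis (x - \<theta>))) ^ m"
  proof (cases m)
    case (Suc n)
    have "(1 - cis (x - \<theta>)) * cnj (cis (x - \<theta>)) = - (1 - cnj (cis (x - \<theta>)))"
      by (simp add: algebra_simps cis_cnj cis_mult)
    moreover have "(1 - cis (x - \<theta>)) * (\<i> * cnj (cis (x - \<theta>)) * (of_nat m * (1 - cnj (cis (x - \<theta>))) ^ (m - 1))) =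
      \<i> * of_nat m * (((1 - cis (x - \<theta>)) * cnj (cis (x - \<theta>))) * (1 - cnj (cis (x - \<theta>))) ^ n)"
      by (simp add: Suc mult_ac)
    ultimately show ?thesis
      by (simp only: Suc power_Suc mult.assoc mult_minus_left mult_minus_right)
  qed simp
  have D: "((\<lambda>x. C * ((1 - cis (x - \<theta>)) * (1 - cnj (cis (x - \<theta>))) ^ m * exp (reg_energy e z (t(i := x)))))
      has_vector_derivative C * ((1 - cis (x - \<theta>)) * (1 - cnj (cis (x - \<theta>))) ^ m *
         (reg_force e z i (t(i := x)) * exp (reg_energy e z (t(i := x)))) +
         ((1 - cis (x - \<theta>)) * (\<i> * cnj (cis (x - \<theta>)) * (of_nat m * (1 - cnj (cis (x - \<theta>))) ^ (m - 1))) +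
          - \<i> * cis (x - \<theta>) * (1 - cnj (cis (x - \<theta>))) ^ m) * exp (reg_energy e z (t(i := x))))) (at x)"
    by (rule has_vector_derivative_mult_right has_vector_derivative_mult d1 d3 d4)+
  have E: "C * (a * b * (f * E) + (- \<i> * of_nat m * b + - \<i> * c * b) * E) =
     C * b * E * (- \<i> * (c + of_nat m) + a * f)" for a b c f E :: complex
    by (simp add: algebra_simps)
  have G: "(\<Prod>l\<in>B. 1 - rot (t(i := x)) l) * reg_weight e z m (t(i := x)) =
     C * (1 - cnj (cis (x - \<theta>))) ^ m * exp (reg_energy e z (t(i := x)))"
    unfolding reg_weight_def P Q C_def by (simp only: mult_ac)
  show ?thesis
    unfolding F R G using D unfolding key E .
qed

end

section \<open>Integration by parts\<close>

text \<open>This bound degenerates as \<open>e\<close> tends to 0; it serves integrability at fixed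
  \<open>e\<close>, before antisymmetrisation.\<close>

lemma abs_reg_cot_le:
  assumes e: "e > 0"
  shows "\<bar>reg_cot e x\<bar> \<le> 2 / e"
proof -
  have "2 * \<bar>sin x\<bar> / reg_chord e x \<le> 2 / e"
    using e cos_le_one[of x] abs_sin_le_one[of x]
    by (intro frac_le) (auto simp: reg_chord_def)
  thus ?thesis
    using reg_chord_pos[OF e, of x] by (simp add: reg_cot_def abs_mult)
qed

context cbe
begin

lemma cmod_1_minus_rot_le: "cmod (1 - rot t l) \<le> 2"
  using norm_triangle_ineq4[of 1 "rot t l"] by (simp add: rot_def)

lemma cmod_prod_1_minus_rot_le:
  assumes "B \<subseteq> {..<N}"
  shows "cmod (\<Prod>l\<in>B. 1 - rot t l) \<le> 2 ^ N"
proof -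
  have "cmod (\<Prod>l\<in>B. 1 - rot t l) \<le> (\<Prod>l\<in>B. 2)"
    unfolding prod_norm[symmetric] by (intro prod_mono) (simp add: cmod_1_minus_rot_le)
  also have "\<dots> \<le> 2 ^ N"
    using card_mono[OF _ assms] by simp
  finally show ?thesis .
qed

text \<open>The bound is uniform in \<open>e\<close> and \<open>t\<close> and later dominates the
  passage to \<open>e = 0\<close>. The condition \<open>Re z \<ge> 0\<close> keeps the zeros of
  \<open>D\<close> harmless.\<close>

lemma cmod_reg_weight_le:
  assumes "0 < e" "e \<le> 1" "Re z \<ge> 0"
  shows "cmod (reg_weight e z m t) \<le> (2 ^ m) ^ N * exp (Re z / 2 * (N * 2) + \<beta> / 4 * (N * (N * 2)))"
proof -
  have ln_le: "ln (reg_chord e x) \<le> 2" for x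
  proof -
    have "ln (reg_chord e x) \<le> ln 5"
      using reg_chord_pos[OF assms(1), of x] reg_chord_le[OF assms(2), of x] by simp
    \<comment> \<open>The quadratic Taylor polynomial of \<open>exp\<close> at 2 is exactly 5, the
      upper bound for \<open>reg_chord e\<close> with \<open>e \<le> 1\<close>.\<close>
    also have "ln 5 \<le> ln (exp 2 :: real)"
      using exp_lower_Taylor_quadratic[of 2] by (subst ln_le_cancel_iff) auto
    finally show ?thesis by simp
  qed
  have "cmod (\<Prod>l<N. (1 - cnj (rot t l)) ^ m) \<le> (\<Prod>l<N. 2 ^ m)"
    unfolding prod_norm[symmetric]
  proof (intro prod_mono conjI)
    fix l
    have "cmod (1 - cnj (rot t l)) = cmod (1 - rot t l)"
      by (metis complex_cnj_diff complex_cnj_one complex_mod_cnj)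
    thus "cmod ((1 - cnj (rot t l)) ^ m) \<le> 2 ^ m"
      using cmod_1_minus_rot_le[of t l] by (simp add: norm_power power_mono)
  qed simp
  moreover have "cmod (exp (reg_energy e z t)) \<le> exp (Re z / 2 * (N * 2) + \<beta> / 4 * (N * (N * 2)))"
  proof -
    have "(\<Sum>l<N. ln (reg_chord e (t l - \<theta>))) \<le> (\<Sum>l<N. 2)"
      by (intro sum_mono ln_le)
    moreover have "(\<Sum>j<N. \<Sum>k\<in>{..<N}-{j}. ln (reg_chord e (t j - t k))) \<le> (\<Sum>j<N. real N * 2)"
    proof (rule sum_mono)
      fix j assume "j \<in> {..<N}"
      have "(\<Sum>k\<in>{..<N}-{j}. ln (reg_chord e (t j - t k))) \<le> (\<Sum>k\<in>{..<N}-{j}. 2)"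
        by (intro sum_mono ln_le)
      also have "\<dots> \<le> (\<Sum>k\<in>{..<N}. 2)"
        by (rule sum_mono2) auto
      finally show "(\<Sum>k\<in>{..<N}-{j}. ln (reg_chord e (t j - t k))) \<le> real N * 2"
        by simp
    qed
    ultimately have "Re (reg_energy e z t) \<le> Re z / 2 * (N * 2) + \<beta> / 4 * (N * (N * 2))"
    proof -
      assume le: "(\<Sum>l<N. ln (reg_chord e (t l - \<theta>))) \<le> (\<Sum>l<N. 2)"
        "(\<Sum>j<N. \<Sum>k\<in>{..<N}-{j}. ln (reg_chord e (t j - t k))) \<le> (\<Sum>j<N. real N * 2)"
      have "Re (reg_energy e z t) = Re z / 2 * (\<Sum>l<N. ln (reg_chord e (t l - \<theta>))) +
          \<beta> / 4 * (\<Sum>j<N. \<Sum>k\<in>{..<N}-{j}. ln (reg_chord e (t j - t k)))"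
        unfolding reg_energy_def by (simp del: of_real_sum of_real_mult)
      also have "\<dots> \<le> Re z / 2 * (N * 2) + \<beta> / 4 * (N * (N * 2))"
        using assms(3) \<beta> le by (intro add_mono mult_left_mono) auto
      finally show ?thesis .
    qed
    thus ?thesis by (simp add: norm_exp_eq_Re)
  qed
  ultimately show ?thesis
    unfolding reg_weight_def norm_mult by (intro mult_mono) auto
qed

lemma integrable_bounded:
  assumes "f \<in> borel_measurable (cbe_base N)" "\<And>t. cmod (f t) \<le> C"
  shows "integrable (cbe_base N) f"
  using assms by (intro finite_measure.integrable_const_bound[OF finite_measure_cbe_base, where B = C]) auto

lemma measurable_prod_rot: "B \<subseteq> {..<N} \<Longrightarrow> (\<lambda>t. \<Prod>l\<in>B. 1 - rot t l) \<in> borel_measurable (cbe_base N)"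
  by (intro borel_measurable_prod borel_measurable_diff borel_measurable_const measurable_rot) auto

lemma integrable_mult_reg_weight:
  assumes "0 < e" "e \<le> 1" "Re z \<ge> 0"
    and h: "h \<in> borel_measurable (cbe_base N)" "\<And>t. cmod (h t) \<le> C"
  shows "integrable (cbe_base N) (\<lambda>t. h t * reg_weight e z m t)"
proof (rule integrable_bounded)
  show "(\<lambda>t. h t * reg_weight e z m t) \<in> borel_measurable (cbe_base N)"
    by (intro borel_measurable_times h measurable_reg_weight)
  have "C \<ge> 0" using h(2)[of undefined] norm_ge_zero order_trans by blast
  thus "cmod (h t * reg_weight e z m t) \<le>
      C * ((2 ^ m) ^ N * exp (Re z / 2 * (N * 2) + \<beta> / 4 * (N * (N * 2))))" for t
    unfolding norm_mult using h(2)[of t] cmod_reg_weight_le[OF assms(1-3), of m t]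
    by (intro mult_mono) auto
qed

lemma measurable_reg_cot_diff:
  "i < N \<Longrightarrow> (\<lambda>t. reg_cot e (t i - a)) \<in> borel_measurable (cbe_base N)"
  "i < N \<Longrightarrow> j < N \<Longrightarrow> (\<lambda>t. reg_cot e (t i - t j)) \<in> borel_measurable (cbe_base N)"
  by (intro measurable_compose[OF _ measurable_reg_cot] borel_measurable_diff borel_measurable_const
      measurable_coord; assumption)+

lemma rot_diff: "rot t j - rot t i = (1 - cis (t i - t j)) * rot t j"
  by (simp add: rot_def algebra_simps cis_mult)

lemma reg_weight_transpose:
  assumes "i < N" "j < N"
  shows "reg_weight e z m (t \<circ> Transposition.transpose i j) = reg_weight e z m t"
proof -
  let ?\<tau> = "Transposition.transpose i j"
  have \<tau>: "?\<tau> k < N \<longleftrightarrow> k < N" for k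
    using assms by (auto simp: Transposition.transpose_def)
  have bij: "bij_betw ?\<tau> {..<N} {..<N}"
    by (rule bij_betwI[where g = ?\<tau>]) (auto simp: \<tau>)
  have inj: "?\<tau> a = ?\<tau> b \<longleftrightarrow> a = b" for a b
    by (metis Transposition.transpose_involutory)
  have bij': "bij_betw ?\<tau> ({..<N} - {k}) ({..<N} - {?\<tau> k})" for k
    by (rule bij_betwI[where g = ?\<tau>]) (auto simp: \<tau> inj)
  have "(\<Prod>l<N. (1 - cnj (rot (t \<circ> ?\<tau>) l)) ^ m) = (\<Prod>l<N. (1 - cnj (rot t l)) ^ m)"
    using prod.reindex_bij_betw[OF bij, of "\<lambda>l. (1 - cnj (rot t l)) ^ m"]
    by (simp add: rot_def)
  moreover have "(\<Sum>l<N. ln (reg_chord e ((t \<circ> ?\<tau>) l - \<theta>))) = (\<Sum>l<N. ln (reg_chord e (t l - \<theta>)))"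
    using sum.reindex_bij_betw[OF bij, of "\<lambda>l. ln (reg_chord e (t l - \<theta>))"] by simp
  moreover have "(\<Sum>j<N. \<Sum>k\<in>{..<N}-{j}. ln (reg_chord e ((t \<circ> ?\<tau>) j - (t \<circ> ?\<tau>) k))) =
      (\<Sum>j<N. \<Sum>k\<in>{..<N}-{j}. ln (reg_chord e (t j - t k)))"
  proof -
    have "(\<Sum>k\<in>{..<N}-{j}. ln (reg_chord e ((t \<circ> ?\<tau>) j - (t \<circ> ?\<tau>) k))) =
        (\<Sum>k\<in>{..<N}-{?\<tau> j}. ln (reg_chord e (t (?\<tau> j) - t k)))" for j
      using sum.reindex_bij_betw[OF bij', of "\<lambda>k. ln (reg_chord e (t (?\<tau> j) - t k))" j] by simp
    thus ?thesis
      using sum.reindex_bij_betw[OF bij, of "\<lambda>j. \<Sum>k\<in>{..<N}-{j}. ln (reg_chord e (t j - t k))"] by simp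
  qed
  ultimately show ?thesis
    by (simp only: reg_weight_def reg_energy_def)
qed

lemma prod_rot_transpose:
  assumes "i \<notin> B" "j \<notin> B"
  shows "(\<Prod>l\<in>B. 1 - rot (t \<circ> Transposition.transpose i j) l) = (\<Prod>l\<in>B. 1 - rot t l)"
  using assms by (intro prod.cong) (auto simp: rot_def Transposition.transpose_def)

lemma prod_rot_insert_transpose:
  assumes "j \<in> B"
  shows "(\<Prod>l\<in>insert i B. 1 - rot (t \<circ> Transposition.transpose i j) l) = (\<Prod>l\<in>insert i B. 1 - rot t l)"
proof -
  let ?\<tau> = "Transposition.transpose i j"
  have "bij_betw ?\<tau> (insert i B) (insert i B)"
    using assms by (intro bij_betwI[where g = ?\<tau>]) (auto simp: Transposition.transpose_def)
  from prod.reindex_bij_betw[OF this, of "\<lambda>l. 1 - rot t l"] show ?thesis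
    by (simp add: rot_def)
qed

lemma rot_transpose: "rot (t \<circ> Transposition.transpose i j) i = rot t j"
  "rot (t \<circ> Transposition.transpose i j) j = rot t i"
  by (simp_all add: rot_def)

text \<open>Exchanging \<open>i\<close> and \<open>j\<close> flips the sign of the cotangent. If
  \<open>j\<close> lies in \<open>B\<close>, the rest of the integrand is symmetric and the integral
  vanishes. Otherwise averaging with the exchanged form replaces \<open>1 - rot t i\<close> by half
  of \<open>rot t j - rot t i\<close>, which vanishes where the two points meet and so cancels the
  pole.\<close>

lemma integral_pair_term:
  assumes e: "0 < e" "e \<le> 1" and z: "Re z \<ge> 0" and B: "B \<subseteq> {..<N}" "i < N" "i \<notin> B"
    and j: "j < N" "j \<noteq> i"
  shows "(\<integral>t. (\<Prod>l\<in>B. 1 - rot t l) * (1 - rot t i) * reg_cot e (t i - t j) * reg_weight e z m t \<partial>cbe_base N) =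
    (if j \<in> B then 0
     else 1 / 2 * (\<integral>t. (\<Prod>l\<in>B. 1 - rot t l) * (rot t j - rot t i) * reg_cot e (t i - t j) * reg_weight e z m t \<partial>cbe_base N))"
proof -
  define f where "f = (\<lambda>t. (\<Prod>l\<in>B. 1 - rot t l) * (1 - rot t i) * reg_cot e (t i - t j) * reg_weight e z m t)"
  define g where "g = (\<lambda>t. (\<Prod>l\<in>B. 1 - rot t l) * (1 - rot t j) * reg_cot e (t i - t j) * reg_weight e z m t)"
  have fin: "finite B" using B finite_subset by blast
  have meas: "(\<lambda>t. (\<Prod>l\<in>B. 1 - rot t l) * (1 - rot t k) * reg_cot e (t i - t j)) \<in> borel_measurable (cbe_base N)"
    if "k < N" for k
    using that B j by (intro borel_measurable_times borel_measurable_diff borel_measurable_const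
      measurable_prod_rot measurable_rot measurable_compose[OF _ borel_measurable_of_real] measurable_reg_cot_diff) auto
  have bound: "cmod ((\<Prod>l\<in>B. 1 - rot t l) * (1 - rot t k) * reg_cot e (t i - t j)) \<le> 2 ^ N * 2 * (2 / e)" for t k
    unfolding norm_mult
  proof (intro mult_mono cmod_prod_1_minus_rot_le cmod_1_minus_rot_le B)
    show "cmod (complex_of_real (reg_cot e (t i - t j))) \<le> 2 / e"
      using abs_reg_cot_le[OF e(1)] by simp
  qed (use e in auto)
  have intf: "integrable (cbe_base N) f" and intg: "integrable (cbe_base N) g"
    unfolding f_def g_def using B j by (intro integrable_mult_reg_weight[OF e z meas bound]; simp)+
  let ?\<tau> = "Transposition.transpose i j"
  have swap: "(\<integral>t. f (t \<circ> ?\<tau>) \<partial>cbe_base N) = integral\<^sup>L (cbe_base N) f"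
    using B j intf by (intro integral_cbe_base_transpose) auto
  have rc: "reg_cot e ((t \<circ> ?\<tau>) i - (t \<circ> ?\<tau>) j) = - reg_cot e (t i - t j)" for t
    using reg_cot_commute[of e "t j" "t i"] by simp
  show ?thesis
  proof (cases "j \<in> B")
    case True
    have f: "f t = (\<Prod>l\<in>insert i B. 1 - rot t l) * reg_cot e (t i - t j) * reg_weight e z m t" for t
      using B fin by (simp add: f_def mult_ac)
    have "f (t \<circ> ?\<tau>) = - f t" for t
      unfolding f prod_rot_insert_transpose[OF True] rc reg_weight_transpose[OF B(2) j(1)] by simp
    hence "integral\<^sup>L (cbe_base N) f = 0"
      using swap by simp
    thus ?thesis using True by (simp add: f_def)
  next
    case False
    have "f (t \<circ> ?\<tau>) = - g t" for t
      unfolding f_def g_def prod_rot_transpose[OF B(3) False] rc reg_weight_transpose[OF B(2) j(1)] rot_transpose by simp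
    hence "integral\<^sup>L (cbe_base N) f = - integral\<^sup>L (cbe_base N) g"
      using swap by simp
    hence "integral\<^sup>L (cbe_base N) f = 1 / 2 * (integral\<^sup>L (cbe_base N) f - integral\<^sup>L (cbe_base N) g)"
      by simp
    also have "\<dots> = 1 / 2 * (\<integral>t. f t - g t \<partial>cbe_base N)"
      using intf intg by simp
    also have "(\<lambda>t. f t - g t) =
        (\<lambda>t. (\<Prod>l\<in>B. 1 - rot t l) * (rot t j - rot t i) * reg_cot e (t i - t j) * reg_weight e z m t)"
      by (rule ext) (simp add: f_def g_def algebra_simps)
    finally show ?thesis using False by (simp add: f_def)
  qed
qed

text \<open>This is the integral of a total derivative with every pair term antisymmetrised. Each
  cotangent is now multiplied by a factor vanishing at its pole, so the identity survives the limit
  \<open>e \<rightarrow> 0\<close>.\<close>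

lemma reg_integral_identity:
  assumes e: "0 < e" "e \<le> 1" and z: "Re z \<ge> 0" and B: "B \<subseteq> {..<N}" "i < N" "i \<notin> B"
  shows "(\<integral>t. (\<Prod>l\<in>B. 1 - rot t l) *
      (-\<i> * (rot t i + of_nat m) + z / 2 * ((1 - rot t i) * reg_cot e (t i - \<theta>)) +
       of_real \<beta> / 4 * (\<Sum>j\<in>{..<N} - insert i B. (rot t j - rot t i) * reg_cot e (t i - t j))) *
      reg_weight e z m t \<partial>cbe_base N) = 0"
proof -
  let ?P = "\<lambda>t. \<Prod>l\<in>B. 1 - rot t l"
  let ?W = "reg_weight e z m"
  let ?M = "cbe_base N"
  let ?J = "{..<N} - insert i B"
  define a where "a = (\<lambda>t. ?P t * (-\<i> * (rot t i + of_nat m)) * ?W t)"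
  define b where "b = (\<lambda>t. ?P t * (1 - rot t i) * reg_cot e (t i - \<theta>) * ?W t)"
  define c where "c = (\<lambda>j t. ?P t * (1 - rot t i) * reg_cot e (t i - t j) * ?W t)"
  define d where "d = (\<lambda>j t. ?P t * (rot t j - rot t i) * reg_cot e (t i - t j) * ?W t)"
  have rc_bound: "cmod (complex_of_real (reg_cot e x)) \<le> 2 / e" for x
    using abs_reg_cot_le[OF e(1)] by simp
  note meas = borel_measurable_times borel_measurable_diff borel_measurable_const borel_measurable_add
      measurable_prod_rot measurable_rot measurable_compose[OF _ borel_measurable_of_real] measurable_reg_cot_diff
  have r2: "cmod (rot t k) = 1" for t k by (simp add: rot_def)
  have inta: "integrable ?M a"
    unfolding a_def
  proof (rule integrable_mult_reg_weight[OF e z])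
    show "(\<lambda>t. ?P t * (-\<i> * (rot t i + of_nat m))) \<in> borel_measurable ?M"
      using B by (intro meas) auto
    show "cmod (?P t * (-\<i> * (rot t i + of_nat m))) \<le> 2 ^ N * (1 + real m)" for t
      unfolding norm_mult
      using norm_triangle_ineq[of "rot t i" "of_nat m"] r2[of t i]
      by (intro mult_mono cmod_prod_1_minus_rot_le B) auto
  qed
  have intb: "integrable ?M b"
    unfolding b_def
  proof (rule integrable_mult_reg_weight[OF e z])
    show "(\<lambda>t. ?P t * (1 - rot t i) * reg_cot e (t i - \<theta>)) \<in> borel_measurable ?M"
      using B by (intro meas) auto
    show "cmod (?P t * (1 - rot t i) * reg_cot e (t i - \<theta>)) \<le> 2 ^ N * 2 * (2 / e)" for t
      unfolding norm_mult
      by (intro mult_mono cmod_prod_1_minus_rot_le cmod_1_minus_rot_le rc_bound B) (use e in auto)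
  qed
  have intc: "integrable ?M (c j)" if "j < N" for j
    unfolding c_def
  proof (rule integrable_mult_reg_weight[OF e z])
    show "(\<lambda>t. ?P t * (1 - rot t i) * reg_cot e (t i - t j)) \<in> borel_measurable ?M"
      using B that by (intro meas) auto
    show "cmod (?P t * (1 - rot t i) * reg_cot e (t i - t j)) \<le> 2 ^ N * 2 * (2 / e)" for t
      unfolding norm_mult
      by (intro mult_mono cmod_prod_1_minus_rot_le cmod_1_minus_rot_le rc_bound B) (use e in auto)
  qed
  have intd: "integrable ?M (d j)" if "j < N" for j
    unfolding d_def
  proof (rule integrable_mult_reg_weight[OF e z])
    show "(\<lambda>t. ?P t * (rot t j - rot t i) * reg_cot e (t i - t j)) \<in> borel_measurable ?M"
      using B that by (intro meas) auto
    show "cmod (?P t * (rot t j - rot t i) * reg_cot e (t i - t j)) \<le> 2 ^ N * 2 * (2 / e)" for t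
    proof -
      have "cmod (rot t j - rot t i) \<le> 2"
        using norm_triangle_ineq4[of "rot t j" "rot t i"] by (simp add: r2)
      thus ?thesis unfolding norm_mult
        by (intro mult_mono cmod_prod_1_minus_rot_le rc_bound B) (use e in auto)
    qed
  qed
  define F' where "F' = (\<lambda>t. ?P t * ?W t * (-\<i> * (rot t i + of_nat m) + (1 - rot t i) * reg_force e z i t))"
  have F'_eq: "F' t = a t + z / 2 * b t + of_real (\<beta> / 2) * (\<Sum>j\<in>{..<N}-{i}. c j t)" for t
  proof -
    have "(\<Sum>j\<in>{..<N}-{i}. c j t) = ?P t * (1 - rot t i) * of_real (\<Sum>j\<in>{..<N}-{i}. reg_cot e (t i - t j)) * ?W t"
      by (simp add: c_def sum_distrib_left sum_distrib_right)
    moreover have "P * W * (A + (1 - r) * (y * q + x * S)) = P * A * W + y * (P * (1 - r) * q * W) + x * (P * (1 - r) * S * W)"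
      for P W A r y q x S :: complex
      by (simp add: algebra_simps)
    ultimately show ?thesis
      by (simp only: F'_def a_def b_def reg_force_def of_real_mult)
  qed
  have intF': "integrable ?M F'"
    unfolding F'_eq[abs_def] using inta intb intc
    by (intro Bochner_Integration.integrable_add integrable_mult_right Bochner_Integration.integrable_sum) auto
  have "integral\<^sup>L ?M F' = 0"
  proof (rule integral_cbe_base_periodic_deriv[OF B(2) intF'])
    fix t :: "nat \<Rightarrow> real" and x :: real
    show "((\<lambda>x. (\<lambda>t. (\<Prod>l\<in>insert i B. 1 - rot t l) * ?W t) (t(i := x))) has_vector_derivative F' (t(i := x))) (at x)"
      unfolding F'_def using has_vector_derivative_reg[OF e(1) B(2,3,1), of t z m x] by simp
  next
    fix t :: "nat \<Rightarrow> real"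
    have per: "rot (t(i := 2 * pi)) l = rot (t(i := 0)) l" for l
      by (simp add: rot_def complex_eq_iff)
    have chord: "reg_chord e ((t(i := 2 * pi)) j - a) = reg_chord e ((t(i := 0)) j - a)"
      "reg_chord e ((t(i := 2 * pi)) j - (t(i := 2 * pi)) k) = reg_chord e ((t(i := 0)) j - (t(i := 0)) k)" for j k a
      by (auto simp: reg_chord_def cos_diff)
    show "(\<Prod>l\<in>insert i B. 1 - rot (t(i := 2 * pi)) l) * ?W (t(i := 2 * pi)) =
      (\<Prod>l\<in>insert i B. 1 - rot (t(i := 0)) l) * ?W (t(i := 0))"
      unfolding reg_weight_def reg_energy_def per chord(2) unfolding chord(1) ..
  next
    fix t :: "nat \<Rightarrow> real"
    have c1: "continuous_on UNIV (\<lambda>x. (t(i := x)) l)" for l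
      by (cases "l = i") (auto intro: continuous_intros)
    have c2: "continuous_on UNIV (\<lambda>x. rot (t(i := x)) l)" for l
      unfolding rot_def by (intro continuous_intros c1)
    have c3: "continuous_on UNIV (\<lambda>x. reg_chord e (f x))" if "continuous_on UNIV f" for f :: "real \<Rightarrow> real"
      unfolding reg_chord_def by (intro continuous_intros that)
    have c4: "continuous_on UNIV (\<lambda>x. reg_cot e (f x))" if "continuous_on UNIV f" for f :: "real \<Rightarrow> real"
      unfolding reg_cot_def using reg_chord_pos[OF e(1)]
      by (intro continuous_intros that c3) (auto simp: less_imp_neq[symmetric])
    have c5: "continuous_on UNIV (\<lambda>x. ln (reg_chord e (f x)))" if "continuous_on UNIV f" for f :: "real \<Rightarrow> real"
      using reg_chord_pos[OF e(1)]
      by (intro continuous_intros that c3) (auto simp: less_imp_neq[symmetric])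
    show "continuous_on UNIV (\<lambda>x. F' (t(i := x)))"
      unfolding F'_def reg_force_def reg_weight_def reg_energy_def
      by (intro continuous_intros c1 c2 c4 c5)
  qed
  hence "0 = integral\<^sup>L ?M a + z / 2 * integral\<^sup>L ?M b + of_real (\<beta> / 2) * (\<Sum>j\<in>{..<N}-{i}. integral\<^sup>L ?M (c j))"
  proof -
    have "integral\<^sup>L ?M F' = integral\<^sup>L ?M a + z / 2 * integral\<^sup>L ?M b + of_real (\<beta> / 2) * (\<Sum>j\<in>{..<N}-{i}. integral\<^sup>L ?M (c j))"
      unfolding F'_eq[abs_def] using inta intb intc
      by (intro has_bochner_integral_integral_eq has_bochner_integral_add has_bochner_integral_mult_right
          has_bochner_integral_sum has_bochner_integral_integrable) auto
    moreover assume "integral\<^sup>L ?M F' = 0"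
    ultimately show ?thesis by simp
  qed
  \<comment> \<open>The factor 1/2 from antisymmetrisation will turn \<open>\<beta> / 2\<close> into
    \<open>\<beta> / 4\<close>, and the terms with \<open>j \<in> B\<close> disappear.\<close>
  also have "(\<Sum>j\<in>{..<N}-{i}. integral\<^sup>L ?M (c j)) = (\<Sum>j\<in>{..<N}-{i}. if j \<in> B then 0 else 1 / 2 * integral\<^sup>L ?M (d j))"
    unfolding c_def d_def using integral_pair_term[OF e z B] by (intro sum.cong) auto
  also have "\<dots> = (\<Sum>j\<in>?J. 1 / 2 * integral\<^sup>L ?M (d j))"
    by (rule sum.mono_neutral_cong_right) auto
  finally have "0 = integral\<^sup>L ?M a + z / 2 * integral\<^sup>L ?M b + of_real (\<beta> / 4) * (\<Sum>j\<in>?J. integral\<^sup>L ?M (d j))"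
    by (simp add: sum_divide_distrib[symmetric])
  also have "\<dots> = (\<integral>t. a t + z / 2 * b t + of_real (\<beta> / 4) * (\<Sum>j\<in>?J. d j t) \<partial>?M)"
    using inta intb intd
    by (intro has_bochner_integral_integral_eq[symmetric] has_bochner_integral_add has_bochner_integral_mult_right
          has_bochner_integral_sum has_bochner_integral_integrable) auto
  also have "\<dots> = (\<integral>t. ?P t *
      (-\<i> * (rot t i + of_nat m) + z / 2 * ((1 - rot t i) * reg_cot e (t i - \<theta>)) +
       of_real \<beta> / 4 * (\<Sum>j\<in>?J. (rot t j - rot t i) * reg_cot e (t i - t j))) * ?W t \<partial>?M)"
    by (intro Bochner_Integration.integral_cong refl)
       (simp add: a_def b_def d_def algebra_simps sum_distrib_left sum_distrib_right)
  finally show ?thesis by simp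
qed

end

section \<open>The recursion for the Mellin transform\<close>

lemma reg_chord_0_pos: "cos x \<noteq> 1 \<Longrightarrow> reg_chord 0 x > 0"
  using cos_le_one[of x] by (simp add: reg_chord_def less_le)

lemma ln_reg_chord_0: "ln (reg_chord 0 (a - b)) = 2 * ln (cmod (cis a - cis b))"
proof -
  have "reg_chord 0 (a - b) = (cmod (cis a - cis b))\<^sup>2"
    by (simp add: cmod_cis_diff cmod_1_minus_cis)
  thus ?thesis by (cases "cmod (cis a - cis b) = 0") (simp_all add: ln_realpow)
qed

lemma tendsto_reg_chord: "(\<lambda>n. reg_chord (inverse (real (Suc n))) x) \<longlonglongrightarrow> reg_chord 0 x"
proof -
  have "(\<lambda>n. 2 - 2 * cos x + inverse (real (Suc n))) \<longlonglongrightarrow> 2 - 2 * cos x + 0"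
    by (intro tendsto_intros LIMSEQ_inverse_real_of_nat)
  thus ?thesis by (simp add: reg_chord_def)
qed

lemma tendsto_reg_cot: "cos x \<noteq> 1 \<Longrightarrow> (\<lambda>n. reg_cot (inverse (real (Suc n))) x) \<longlonglongrightarrow> reg_cot 0 x"
  unfolding reg_cot_def using reg_chord_0_pos[of x]
  by (intro tendsto_intros tendsto_reg_chord) auto

lemma char_poly_D_neq_0:
  assumes "cbe_generic \<theta> N t"
  shows "char_poly_D N \<theta> t \<noteq> 0"
proof -
  have "cis \<theta> - cis (t j) \<noteq> 0" if "j < N" for j
  proof -
    have "(cmod (cis (t j) - cis \<theta>))\<^sup>2 > 0"
      using assms that reg_chord_0_pos[of "t j - \<theta>"]
      by (simp add: cmod_cis_diff cmod_1_minus_cis cbe_generic_def)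
    thus ?thesis by auto
  qed
  thus ?thesis by (auto simp: char_poly_D_def)
qed

context cbe
begin

text \<open>On generic configurations all chords are positive, so \<open>powr\<close> and
  \<open>ln\<close> are the ordinary power and logarithm and no default value enters.\<close>

lemma exp_reg_energy_0:
  assumes "cbe_generic \<theta> N t"
  shows "exp (reg_energy 0 z t) = exp (z * of_real (log_abs_D N \<theta> t)) * of_real (cbe_weight \<beta> N t)"
proof -
  have c1: "cmod (cis (t l) - cis \<theta>) > 0" if "l < N" for l
  proof -
    have "(cmod (cis (t l) - cis \<theta>))\<^sup>2 > 0"
      using assms that reg_chord_0_pos[of "t l - \<theta>"]
      by (simp add: cmod_cis_diff cmod_1_minus_cis cbe_generic_def)
    thus ?thesis by simp
  qed
  have c2: "cmod (cis (t j) - cis (t k)) > 0" if "j < N" "k < N" "j \<noteq> k" for j k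
  proof -
    have "(cmod (cis (t j) - cis (t k)))\<^sup>2 > 0"
      using assms that reg_chord_0_pos[of "t j - t k"]
      by (simp add: cmod_cis_diff cmod_1_minus_cis cbe_generic_def)
    thus ?thesis by simp
  qed
  have "log_abs_D N \<theta> t = ln (\<Prod>l<N. cmod (cis (t l) - cis \<theta>))"
    unfolding log_abs_D_def char_poly_D_def
    by (simp add: prod_norm[symmetric] norm_minus_commute)
  also have "\<dots> = (\<Sum>l<N. ln (cmod (cis (t l) - cis \<theta>)))"
    using c1 by (intro ln_prod) auto
  finally have X: "(\<Sum>l<N. ln (reg_chord 0 (t l - \<theta>))) = 2 * log_abs_D N \<theta> t"
    by (simp add: ln_reg_chord_0 sum_distrib_left)
  have "cbe_weight \<beta> N t = (\<Prod>k<N. \<Prod>j<k. exp (\<beta> * ln (cmod (cis (t j) - cis (t k)))))"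
    unfolding cbe_weight_def using c2
    by (intro prod.cong refl) (auto simp: powr_def)
  also have "\<dots> = exp (\<Sum>k<N. \<Sum>j<k. \<beta> * ln (cmod (cis (t j) - cis (t k))))"
    by (simp add: exp_sum)
  also have "(\<Sum>k<N. \<Sum>j<k. \<beta> * ln (cmod (cis (t j) - cis (t k)))) =
      \<beta> / 4 * (2 * (\<Sum>k<N. \<Sum>j<k. ln (reg_chord 0 (t j - t k))))"
    by (simp add: ln_reg_chord_0 sum_distrib_left)
  also have "2 * (\<Sum>k<N. \<Sum>j<k. ln (reg_chord 0 (t j - t k))) =
      (\<Sum>j<N. \<Sum>k\<in>{..<N}-{j}. ln (reg_chord 0 (t j - t k)))"
    by (rule double_sum_symmetric[symmetric]) (simp only: reg_chord_commute)
  finally have W: "cbe_weight \<beta> N t = exp (\<beta> / 4 * (\<Sum>j<N. \<Sum>k\<in>{..<N}-{j}. ln (reg_chord 0 (t j - t k))))" .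
  show ?thesis
    unfolding reg_energy_def X W exp_add exp_of_real[symmetric] by simp
qed

lemma tendsto_reg_weight:
  assumes t: "cbe_generic \<theta> N t"
  shows "(\<lambda>n. reg_weight (inverse (real (Suc n))) z m t) \<longlonglongrightarrow> lim_weight z m t"
proof -
  have ln: "(\<lambda>n. ln (reg_chord (inverse (real (Suc n))) x)) \<longlonglongrightarrow> ln (reg_chord 0 x)" if "cos x \<noteq> 1" for x
    using reg_chord_0_pos[OF that] by (intro tendsto_ln tendsto_reg_chord) auto
  have "(\<lambda>n. reg_weight (inverse (real (Suc n))) z m t) \<longlonglongrightarrow>
      (\<Prod>l<N. (1 - cnj (rot t l)) ^ m) * exp (reg_energy 0 z t)"
    unfolding reg_weight_def reg_energy_def using t
    by (intro tendsto_intros ln) (auto simp: cbe_generic_def)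
  thus ?thesis by (simp add: exp_reg_energy_0[OF t] lim_weight_def mult.assoc)
qed

definition weight_bound :: "complex \<Rightarrow> nat \<Rightarrow> real" where
  "weight_bound z m = (2 ^ m) ^ N * exp (Re z / 2 * (N * 2) + \<beta> / 4 * (N * (N * 2)))"

lemma cmod_reg_weight_le':
  "Re z \<ge> 0 \<Longrightarrow> cmod (reg_weight (inverse (real (Suc n))) z m t) \<le> weight_bound z m"
  unfolding weight_bound_def by (rule cmod_reg_weight_le) (auto simp: divide_simps)

text \<open>Dominated convergence along \<open>e = 1 / (n + 1)\<close>. Taking \<open>h\<close>
  constant in \<open>n\<close> also yields integrability against \<open>lim_weight\<close>.\<close>

lemma
  assumes z: "Re z \<ge> 0"
    and h: "\<And>n. h n \<in> borel_measurable (cbe_base N)" "\<And>n t. cmod (h n t) \<le> C"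
    and g: "g \<in> borel_measurable (cbe_base N)"
    and lim: "\<And>t. cbe_generic \<theta> N t \<Longrightarrow> (\<lambda>n. h n t) \<longlonglongrightarrow> g t"
  shows tendsto_integral_reg:
    "(\<lambda>n. \<integral>t. h n t * reg_weight (inverse (real (Suc n))) z m t \<partial>cbe_base N) \<longlonglongrightarrow>
       (\<integral>t. g t * lim_weight z m t \<partial>cbe_base N)"
  and integrable_lim: "integrable (cbe_base N) (\<lambda>t. g t * lim_weight z m t)"
proof -
  have C: "C \<ge> 0" using h(2)[of undefined undefined] norm_ge_zero order_trans by blast
  have m1: "(\<lambda>t. g t * lim_weight z m t) \<in> borel_measurable (cbe_base N)"
    by (intro borel_measurable_times g measurable_lim_weight)
  have m2: "(\<lambda>t. h n t * reg_weight (inverse (real (Suc n))) z m t) \<in> borel_measurable (cbe_base N)" for n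
    by (intro borel_measurable_times h measurable_reg_weight)
  have i: "integrable (cbe_base N) (\<lambda>_. C * weight_bound z m)"
    using finite_measure_cbe_base by (rule finite_measure.integrable_const)
  have l: "AE t in cbe_base N. (\<lambda>n. h n t * reg_weight (inverse (real (Suc n))) z m t) \<longlonglongrightarrow> g t * lim_weight z m t"
    using AE_cbe_generic[of \<theta> N] by eventually_elim (intro tendsto_mult lim tendsto_reg_weight)
  have b: "AE t in cbe_base N. norm (h n t * reg_weight (inverse (real (Suc n))) z m t) \<le> C * weight_bound z m" for n
    unfolding norm_mult using h(2) cmod_reg_weight_le'[OF z] C
    by (intro AE_I2 mult_mono) auto
  show "(\<lambda>n. \<integral>t. h n t * reg_weight (inverse (real (Suc n))) z m t \<partial>cbe_base N) \<longlonglongrightarrow>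
       (\<integral>t. g t * lim_weight z m t \<partial>cbe_base N)"
    using m1 m2 i l b by (rule integral_dominated_convergence)
  show "integrable (cbe_base N) (\<lambda>t. g t * lim_weight z m t)"
    using m1 m2 i l b by (rule integrable_dominated_convergence)
qed

text \<open>These averages interpolate between \<open>B = {}\<close> and \<open>B = {..<N}\<close>;
  by exchange symmetry the value depends only on the number of points in \<open>B\<close>.\<close>

definition moment :: "complex \<Rightarrow> nat \<Rightarrow> nat set \<Rightarrow> complex" where
  "moment z m B = (\<integral>t. (\<Prod>l\<in>B. 1 - rot t l) * lim_weight z m t \<partial>cbe_base N)"

text \<open>In the limit the identity involves only \<open>moment z m B\<close> and integrals
  \<open>K k\<close> with an additional factor \<open>rot t k\<close>. By symmetry all
  \<open>K k\<close> with \<open>k\<close> outside \<open>B\<close> agree, and \<open>K i\<close> is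
  the difference of the two moments, so a linear relation with \<open>N - 1 - card B\<close> equal
  interaction terms remains.\<close>

lemma moment_insert:
  assumes z: "Re z \<ge> 0" and B: "B \<subseteq> {..<N}" "i < N" "i \<notin> B"
  shows "moment z m (insert i B) * (1 + z / 2 + \<beta> / 2 * real (N - Suc (card B))) =
    moment z m B * (1 + of_nat m + z + \<beta> / 2 * real (N - Suc (card B)))"
proof -
  let ?M = "cbe_base N"
  let ?P = "\<lambda>t. \<Prod>l\<in>B. 1 - rot t l"
  let ?J = "{..<N} - insert i B"
  let ?e = "\<lambda>n. inverse (real (Suc n))"
  let ?W = "lim_weight z m"
  have fin: "finite B" using B finite_subset by blast
  have e: "0 < ?e n" "?e n \<le> 1" for n by (auto simp: divide_simps)
  have r: "cmod (rot t k) = 1" for t k by (simp add: rot_def)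
  note meas = borel_measurable_times borel_measurable_diff borel_measurable_const borel_measurable_add
      measurable_prod_rot measurable_rot measurable_compose[OF _ borel_measurable_of_real] measurable_reg_cot_diff
      borel_measurable_sum
  define K where "K = (\<lambda>k. \<integral>t. ?P t * rot t k * ?W t \<partial>?M)"
  have bP: "cmod (?P t * rot t k) \<le> 2 ^ N" for t k
    using cmod_prod_1_minus_rot_le[OF B(1)] by (simp add: norm_mult r)
  have intK: "integrable ?M (\<lambda>t. ?P t * rot t k * ?W t)" if "k < N" for k
    by (rule integrable_lim[OF z, where h = "\<lambda>_ t. ?P t * rot t k" and C = "2 ^ N"])
       (use that B bP in \<open>auto intro!: meas\<close>)
  have intJ: "integrable ?M (\<lambda>t. ?P t * ?W t)"
    by (rule integrable_lim[OF z, where h = "\<lambda>_ t. ?P t" and C = "2 ^ N"])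
       (use B cmod_prod_1_minus_rot_le in \<open>auto intro!: meas\<close>)
  have limK: "(\<lambda>n. \<integral>t. ?P t * rot t k * reg_weight (?e n) z m t \<partial>?M) \<longlonglongrightarrow> K k" if "k < N" for k
    unfolding K_def
    by (rule tendsto_integral_reg[OF z, where h = "\<lambda>_ t. ?P t * rot t k" and C = "2 ^ N"])
       (use that B bP in \<open>auto intro!: meas\<close>)
  \<comment> \<open>Symmetry is used at fixed regularisation and carried over by uniqueness of
    limits.\<close>
  have K_eq: "K j = K i" if j: "j \<in> ?J" for j
  proof -
    have "(\<integral>t. ?P t * rot t j * reg_weight (?e n) z m t \<partial>?M) = (\<integral>t. ?P t * rot t i * reg_weight (?e n) z m t \<partial>?M)" for n
    proof -
      have "(\<lambda>t. ?P t * rot t i * reg_weight (?e n) z m t) \<in> borel_measurable ?M"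
        using B by (intro meas measurable_reg_weight) auto
      from integral_cbe_base_transpose[OF B(2) _ this, of j] j B(3) show ?thesis
        by (simp add: prod_rot_transpose reg_weight_transpose B(2) rot_transpose)
    qed
    thus ?thesis
      using limK[of j] limK[of i] j B by (auto intro: LIMSEQ_unique)
  qed
  define h where "h = (\<lambda>n t. ?P t *
      (-\<i> * (rot t i + of_nat m) + z / 2 * ((1 - rot t i) * reg_cot (?e n) (t i - \<theta>)) +
       of_real \<beta> / 4 * (\<Sum>j\<in>?J. (rot t j - rot t i) * reg_cot (?e n) (t i - t j))))"
  define g where "g = (\<lambda>t. ?P t *
      (-\<i> * (rot t i + of_nat m) + z / 2 * (-\<i> * (1 + rot t i)) +
       of_real \<beta> / 4 * (\<Sum>j\<in>?J. - \<i> * (rot t j + rot t i))))"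
  have lim: "(\<lambda>n. h n t) \<longlonglongrightarrow> g t" if t: "cbe_generic \<theta> N t" for t
  proof -
    have "(\<lambda>n. (1 - rot t i) * reg_cot (?e n) (t i - \<theta>)) \<longlonglongrightarrow> (1 - rot t i) * reg_cot 0 (t i - \<theta>)"
      using t B by (intro tendsto_intros tendsto_reg_cot) (auto simp: cbe_generic_def)
    also have "(1 - rot t i) * reg_cot 0 (t i - \<theta>) = -\<i> * (1 + rot t i)"
      unfolding rot_def using t B by (intro reg_cot_0) (auto simp: cbe_generic_def)
    finally have 1: "(\<lambda>n. (1 - rot t i) * reg_cot (?e n) (t i - \<theta>)) \<longlonglongrightarrow> -\<i> * (1 + rot t i)" .
    have 2: "(\<lambda>n. (rot t j - rot t i) * reg_cot (?e n) (t i - t j)) \<longlonglongrightarrow> -\<i> * (rot t j + rot t i)" if "j \<in> ?J" for j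
    proof -
      have c: "cos (t i - t j) \<noteq> 1"
        using t B that by (auto simp: cbe_generic_def)
      have "(\<lambda>n. (rot t j - rot t i) * reg_cot (?e n) (t i - t j)) \<longlonglongrightarrow> (rot t j - rot t i) * reg_cot 0 (t i - t j)"
        by (intro tendsto_intros tendsto_reg_cot c)
      also have "(rot t j - rot t i) * reg_cot 0 (t i - t j) = rot t j * ((1 - cis (t i - t j)) * reg_cot 0 (t i - t j))"
        by (simp add: rot_diff)
      also have "\<dots> = -\<i> * (rot t j + rot t j * cis (t i - t j))"
        unfolding reg_cot_0[OF c] by (simp add: algebra_simps)
      also have "rot t j * cis (t i - t j) = rot t i"
        by (simp add: rot_def cis_mult)
      finally show ?thesis .
    qed
    show ?thesis unfolding h_def g_def by (intro tendsto_intros 1 2)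
  qed
  \<comment> \<open>Every cotangent is paired with a zero, so no regularisation parameter appears in
    the bound.\<close>
  have hb: "cmod (h n t) \<le> 2 ^ N * ((1 + real m) + cmod z / 2 * 2 + \<beta> / 4 * (\<Sum>j\<in>?J. 2))" for n t
  proof -
    have 1: "cmod (-\<i> * (rot t i + of_nat m)) \<le> 1 + real m"
      using norm_triangle_ineq[of "rot t i" "of_nat m"] by (simp add: norm_mult r)
    have 2: "cmod (z / 2 * ((1 - rot t i) * reg_cot (?e n) (t i - \<theta>))) \<le> cmod z / 2 * 2"
      using cmod_reg_cot_le[OF e(1), of "t i - \<theta>" n]
      unfolding norm_mult norm_divide by (intro mult_mono) (auto simp: rot_def)
    have "cmod (\<Sum>j\<in>?J. (rot t j - rot t i) * reg_cot (?e n) (t i - t j)) \<le> (\<Sum>j\<in>?J. 2)"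
    proof (rule sum_norm_le)
      fix j
      show "cmod ((rot t j - rot t i) * reg_cot (?e n) (t i - t j)) \<le> 2"
        using cmod_reg_cot_le[OF e(1), of "t i - t j" n]
        by (simp add: rot_diff norm_mult r)
    qed
    hence 3: "cmod (of_real \<beta> / 4 * (\<Sum>j\<in>?J. (rot t j - rot t i) * reg_cot (?e n) (t i - t j))) \<le> \<beta> / 4 * (\<Sum>j\<in>?J. 2)"
      unfolding norm_mult using \<beta> by (intro mult_mono) auto
    show ?thesis
      unfolding h_def norm_mult[of "?P t"]
      by (intro mult_mono cmod_prod_1_minus_rot_le B order_trans[OF norm_triangle_ineq] add_mono 1 2 3) auto
  qed
  have "(\<lambda>n. \<integral>t. h n t * reg_weight (?e n) z m t \<partial>?M) \<longlonglongrightarrow> (\<integral>t. g t * ?W t \<partial>?M)"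
  proof (rule tendsto_integral_reg[OF z _ hb _ lim])
    show "h n \<in> borel_measurable ?M" for n
      unfolding h_def using B by (intro meas) auto
    show "g \<in> borel_measurable ?M"
      unfolding g_def using B by (intro meas) auto
  qed
  moreover have "(\<integral>t. h n t * reg_weight (?e n) z m t \<partial>?M) = 0" for n
    unfolding h_def by (rule reg_integral_identity[OF e z B])
  ultimately have "0 = (\<integral>t. g t * ?W t \<partial>?M)"
    by (simp add: LIMSEQ_const_iff)
  also have "\<dots> = (\<integral>t. (-\<i> * (of_nat m + z / 2)) * (?P t * ?W t) + (-\<i> * (1 + z / 2)) * (?P t * rot t i * ?W t) +
       (-\<i> * of_real \<beta> / 4) * (\<Sum>j\<in>?J. ?P t * rot t j * ?W t + ?P t * rot t i * ?W t) \<partial>?M)"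
  proof (intro Bochner_Integration.integral_cong refl)
    fix t
    have "(\<Sum>j\<in>?J. ?P t * rot t j * ?W t + ?P t * rot t i * ?W t) = ?P t * ?W t * (\<Sum>j\<in>?J. rot t j + rot t i)"
      unfolding sum_distrib_left by (intro sum.cong refl) (simp add: algebra_simps)
    moreover have "(\<Sum>j\<in>?J. - \<i> * (rot t j + rot t i)) = - \<i> * (\<Sum>j\<in>?J. rot t j + rot t i)"
      by (simp only: sum_distrib_left)
    ultimately show "g t * ?W t = (-\<i> * (of_nat m + z / 2)) * (?P t * ?W t) + (-\<i> * (1 + z / 2)) * (?P t * rot t i * ?W t) +
       (-\<i> * of_real \<beta> / 4) * (\<Sum>j\<in>?J. ?P t * rot t j * ?W t + ?P t * rot t i * ?W t)"
      unfolding g_def by (simp add: ring_distribs mult_ac)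
  qed
  also have "\<dots> = (-\<i> * (of_nat m + z / 2)) * moment z m B + (-\<i> * (1 + z / 2)) * K i +
       (-\<i> * of_real \<beta> / 4) * (\<Sum>j\<in>?J. K j + K i)"
  proof -
    have HJ: "has_bochner_integral ?M (\<lambda>t. ?P t * ?W t) (moment z m B)"
      using intJ by (simp add: moment_def has_bochner_integral_integrable)
    have HK: "has_bochner_integral ?M (\<lambda>t. ?P t * rot t k * ?W t) (K k)" if "k < N" for k
      using intK[OF that] by (simp add: K_def has_bochner_integral_integrable)
    show ?thesis
      using B by (intro has_bochner_integral_integral_eq has_bochner_integral_add has_bochner_integral_mult_right
          has_bochner_integral_sum HJ HK) auto
  qed
  also have "(\<Sum>j\<in>?J. K j + K i) = (\<Sum>j\<in>?J. 2 * K i)"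
    using K_eq by (intro sum.cong) auto
  also have "\<dots> = of_nat (card ?J) * (2 * K i)"
    by simp
  also have "card ?J = N - Suc (card B)"
    using B fin by (subst card_Diff_subset) auto
  finally have 0: "0 = (of_nat m + z / 2) * moment z m B + (1 + z / 2) * K i +
      of_real \<beta> / 2 * of_nat (N - Suc (card B)) * K i"
  proof -
    assume eq: "0 = (-\<i> * (of_nat m + z / 2)) * moment z m B + (-\<i> * (1 + z / 2)) * K i +
       (-\<i> * of_real \<beta> / 4) * (of_nat (N - Suc (card B)) * (2 * K i))"
    also have "\<dots> = -\<i> * ((of_nat m + z / 2) * moment z m B + (1 + z / 2) * K i +
      of_real \<beta> / 2 * of_nat (N - Suc (card B)) * K i)"
      by (simp add: algebra_simps)
    finally show ?thesis by simp
  qed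
  \<comment> \<open>Expanding the additional factor \<open>1 - rot t i\<close> expresses
    \<open>K i\<close> by the two moments.\<close>
  have "moment z m (insert i B) = (\<integral>t. ?P t * ?W t - ?P t * rot t i * ?W t \<partial>?M)"
    unfolding moment_def using B fin
    by (intro Bochner_Integration.integral_cong refl) (simp add: algebra_simps)
  also have "\<dots> = moment z m B - K i"
    unfolding moment_def K_def using intJ intK B by simp
  finally have K: "K i = moment z m B - moment z m (insert i B)" by simp
  show ?thesis
    using 0 unfolding K by (simp add: algebra_simps)
qed

text \<open>Points are added one at a time; adding the point \<open>k\<close> contributes the factor
  with \<open>j = N - 1 - k\<close>, so the products are built from the top index downwards.\<close>

lemma moment_all:
  assumes z: "Re z \<ge> 0"
  shows "moment z m {..<N} * (\<Prod>j<N. 1 + z / 2 + \<beta> / 2 * real j) =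
    moment z m {} * (\<Prod>j<N. 1 + of_nat m + z + \<beta> / 2 * real j)"
proof -
  have alg: "a * (x * p) = c * (y * q)" if "b * p = c * q" "a * x = b * y" for a b c p q x y :: complex
    by (metis that mult.assoc mult.left_commute)
  have "moment z m {..<k} * (\<Prod>j\<in>{N-k..<N}. 1 + z / 2 + \<beta> / 2 * real j) =
    moment z m {} * (\<Prod>j\<in>{N-k..<N}. 1 + of_nat m + z + \<beta> / 2 * real j)" if "k \<le> N" for k
    using that
  proof (induction k)
    case (Suc k)
    let ?j = "N - Suc k"
    have set: "{?j..<N} = insert ?j {N-k..<N}"
      using Suc.prems by auto
    have step: "moment z m {..<Suc k} * (1 + z / 2 + \<beta> / 2 * real ?j) = moment z m {..<k} * (1 + of_nat m + z + \<beta> / 2 * real ?j)"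
      using moment_insert[OF z, of "{..<k}" k m] Suc.prems by (simp add: lessThan_Suc)
    have "?j \<notin> {N-k..<N}"
      using Suc.prems by auto
    hence prod: "prod f {?j..<N} = f ?j * prod f {N-k..<N}" for f :: "nat \<Rightarrow> complex"
      unfolding set by simp
    have "k \<le> N" using Suc.prems by simp
    from alg[OF Suc.IH[OF this] step] show ?case
      unfolding prod .
  qed simp
  from this[of N] show ?thesis by (simp add: atLeast0LessThan)
qed

definition mellin :: "complex \<Rightarrow> complex" where
  "mellin z = (\<integral>t. exp (z * of_real (log_abs_D N \<theta> t)) * of_real (cbe_weight \<beta> N t) \<partial>cbe_base N)"

lemma mellin_cnj: "mellin (cnj z) = cnj (mellin z)"
  unfolding mellin_def Bochner_Integration.integral_cnj[symmetric] by (simp add: exp_cnj)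

text \<open>One pass over all points at \<open>m = 0\<close> produces the product of the
  \<open>1 - rot t l\<close>. Complex conjugation turns it into the starting value for
  \<open>m = 1\<close>, and a second pass completes it to \<open>|D| ^ 2\<close>. The two passes
  account for the factors with \<open>1 + z\<close> and with \<open>2 + z\<close>.\<close>

lemma mellin_rec:
  assumes z: "Re z \<ge> 0"
  shows "mellin (z + 2) * (\<Prod>j<N. 1 + z / 2 + \<beta> / 2 * real j)\<^sup>2 =
    mellin z * (\<Prod>j<N. (1 + z + \<beta> / 2 * real j) * (2 + z + \<beta> / 2 * real j))"
proof -
  have 1: "moment z 0 {} = mellin z" for z
    by (simp add: moment_def mellin_def lim_weight_def)
  have 2: "moment z 1 {} = cnj (moment (cnj z) 0 {..<N})"
    unfolding moment_def Bochner_Integration.integral_cnj[symmetric]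
    by (intro Bochner_Integration.integral_cong refl) (simp add: lim_weight_def exp_cnj mult_ac)
  \<comment> \<open>Only almost everywhere: where \<open>D = 0\<close>, the default
    \<open>ln 0 = 0\<close> makes the exponential 1 while the product vanishes.\<close>
  have 3: "moment z 1 {..<N} = mellin (z + 2)"
    unfolding moment_def mellin_def
  proof (rule integral_cong_AE)
    show "AE t in cbe_base N. (\<Prod>l<N. 1 - rot t l) * lim_weight z 1 t =
        exp ((z + 2) * of_real (log_abs_D N \<theta> t)) * of_real (cbe_weight \<beta> N t)"
      using AE_cbe_generic[of \<theta> N]
    proof eventually_elim
      case (elim t)
      note D0 = char_poly_D_neq_0[OF elim]
      have "(\<Prod>l<N. 1 - rot t l) * (\<Prod>l<N. (1 - cnj (rot t l)) ^ 1) = of_real ((\<Prod>l<N. (cmod (1 - rot t l))\<^sup>2))"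
        unfolding prod.distrib[symmetric] of_real_prod
        by (intro prod.cong refl) (simp add: complex_norm_square del: of_real_power)
      also have "(\<Prod>l<N. (cmod (1 - rot t l))\<^sup>2) = (cmod (char_poly_D N \<theta> t))\<^sup>2"
        unfolding char_poly_D_def prod_norm[symmetric] prod_power_distrib
        by (intro arg_cong[where f = "\<lambda>x. x\<^sup>2"] prod.cong refl)
           (simp add: rot_def cmod_cis_diff[symmetric] norm_minus_commute)
      also have "\<dots> = exp (2 * log_abs_D N \<theta> t)"
        using D0 by (simp add: log_abs_D_def exp_double)
      finally have P: "(\<Prod>l<N. 1 - rot t l) * (\<Prod>l<N. (1 - cnj (rot t l)) ^ 1) = exp (2 * of_real (log_abs_D N \<theta> t))"
        by (simp add: exp_of_real[symmetric])
      show ?case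
        unfolding lim_weight_def mult.assoc[symmetric] P
        by (simp add: distrib_right exp_add mult_ac)
    qed
    show "(\<lambda>t. (\<Prod>l<N. 1 - rot t l) * lim_weight z 1 t) \<in> borel_measurable (cbe_base N)"
      by (intro borel_measurable_times measurable_prod_rot measurable_lim_weight) simp
    show "(\<lambda>t. exp ((z + 2) * of_real (log_abs_D N \<theta> t)) * of_real (cbe_weight \<beta> N t)) \<in> borel_measurable (cbe_base N)"
      by (intro borel_measurable_times measurable_compose[OF _ borel_measurable_exp] borel_measurable_const
        measurable_compose[OF _ borel_measurable_of_real] measurable_log_abs_D measurable_cbe_weight)
  qed
  have "moment (cnj z) 0 {..<N} * (\<Prod>j<N. 1 + cnj z / 2 + \<beta> / 2 * real j) =
    mellin (cnj z) * (\<Prod>j<N. 1 + cnj z + \<beta> / 2 * real j)"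
    using moment_all[of "cnj z" 0] z by (simp add: 1)
  from arg_cong[OF this, of cnj]
  have 4: "moment z 1 {} * (\<Prod>j<N. 1 + z / 2 + \<beta> / 2 * real j) = mellin z * (\<Prod>j<N. 1 + z + \<beta> / 2 * real j)"
    by (simp add: 2[simplified] mellin_cnj)
  have 5: "mellin (z + 2) * (\<Prod>j<N. 1 + z / 2 + \<beta> / 2 * real j) =
    moment z 1 {} * (\<Prod>j<N. 2 + z + \<beta> / 2 * real j)"
    using moment_all[OF z, of 1] by (simp add: 3[simplified])
  show ?thesis
    unfolding power2_eq_square mult.assoc[symmetric] 5 prod.distrib
    using 4 by (simp add: mult_ac)
qed

end

section \<open>The Gamma factors\<close>

definition gfac :: "real \<Rightarrow> real \<Rightarrow> complex" where
  "gfac c u = Gamma (1 + of_real c + \<i> * of_real u) * Gamma (1 + of_real c) /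
     (Gamma (1 + of_real c + \<i> * of_real u / 2))\<^sup>2"

text \<open>The product of \<open>n\<close> successive recursion factors starting on the imaginary
  axis, for one index \<open>j\<close> with \<open>c = \<beta> j / 2\<close>. Each step puts two
  consecutive linear factors into the numerator, hence \<open>2 * n\<close>.\<close>

definition pochhammer_ratio :: "real \<Rightarrow> real \<Rightarrow> nat \<Rightarrow> complex" where
  "pochhammer_ratio c u n = pochhammer (1 + of_real c + \<i> * of_real u) (2 * n) /
     (pochhammer (1 + of_real c + \<i> * of_real u / 2) n)\<^sup>2"

lemma not_nonpos_Int_if_Re_pos: "Re z > 0 \<Longrightarrow> z \<notin> \<int>\<^sub>\<le>\<^sub>0"
  by (auto elim!: nonpos_Ints_cases)

lemma prod_pochhammer_double:
  fixes z :: complex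
  shows "(\<Prod>m<n. (z + 2 * of_nat m) * (1 + z + 2 * of_nat m)) = pochhammer z (2 * n)"
  by (induction n) (simp_all add: pochhammer_Suc mult_ac add_ac)

lemma prod_pochhammer:
  fixes z :: complex
  shows "(\<Prod>m<n. z + of_nat m) = pochhammer z n"
  by (simp add: pochhammer_prod atLeast0LessThan)

lemma pochhammer_eq_Gamma_series':
  fixes z :: complex
  assumes "Re z > 0"
  shows "pochhammer z n = fact (n - 1) * exp (z * ln (real n)) / Gamma_series' z n"
proof -
  have "pochhammer z n \<noteq> 0"
    using pochhammer_eq_0_imp_nonpos_Int not_nonpos_Int_if_Re_pos[OF assms] by blast
  thus ?thesis by (simp add: Gamma_series'_def)
qed

text \<open>In Euler's limit for Gamma the factorials cancel between the parameters 0 and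
  \<open>u\<close>, and so do the powers of \<open>n\<close>; only \<open>2 ^ (- i u)\<close> is
  left over, because the numerator has length \<open>2 n\<close>. The prefactor compensates it; its
  \<open>ln 2\<close> is what one point contributes to the maximum of
  \<open>log |D|\<close>.\<close>

lemma pochhammer_ratio_tendsto_gfac:
  assumes c: "c \<ge> 0"
  shows "(\<lambda>n. exp (\<i> * of_real u * of_real (ln 2)) * (pochhammer_ratio c 0 n / pochhammer_ratio c u n)) \<longlonglongrightarrow> gfac c u"
proof -
  let ?Q = "pochhammer_ratio c"
  let ?G = "Gamma_series' :: complex \<Rightarrow> _"
  let ?z = "1 + of_real c + \<i> * of_real u" and ?w = "1 + of_real c + \<i> * of_real u / 2" and ?x = "1 + of_real c :: complex"
  have Re: "Re ?z > 0" "Re ?w > 0" "Re ?x > 0" using c by auto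
  note nz = this[THEN not_nonpos_Int_if_Re_pos]
  have dbl: "filterlim (\<lambda>n::nat. 2 * n) at_top sequentially"
    by (rule filterlim_subseq) (auto simp: strict_mono_def)
  have eq: "exp (\<i> * of_real u * of_real (ln 2)) * (?Q 0 n / ?Q u n) =
      ?G ?z (2 * n) * (?G ?x n)\<^sup>2 / (?G ?x (2 * n) * (?G ?w n)\<^sup>2)" if n: "n > 0" for n
  proof -
    define A where "A = (fact (2 * n - 1) :: complex)"
    define B where "B = (fact (n - 1) :: complex)"
    have AB: "A \<noteq> 0" "B \<noteq> 0" by (simp_all add: A_def B_def)
    have Gnz: "?G y k \<noteq> 0" if "Re y > 0" for y k
    proof -
      have "pochhammer y k \<noteq> 0"
        using pochhammer_eq_0_imp_nonpos_Int not_nonpos_Int_if_Re_pos[OF that] by blast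
      thus ?thesis by (simp add: Gamma_series'_def)
    qed
    define L where "L = complex_of_real (ln (real n))"
    have ln2n: "complex_of_real (ln (real (2 * n))) = of_real (ln 2) + L"
      using n by (simp add: ln_mult L_def)
    have ln2n': "complex_of_real (ln (real n * 2)) = of_real (ln 2) + L"
      using ln2n by (simp add: mult.commute)
    have q: "?Q v n = A * exp ((1 + of_real c + \<i> * of_real v) * (of_real (ln 2) + L)) * (?G (1 + of_real c + \<i> * of_real v / 2) n)\<^sup>2 /
        (B\<^sup>2 * (exp ((1 + of_real c + \<i> * of_real v / 2) * L))\<^sup>2 * ?G (1 + of_real c + \<i> * of_real v) (2 * n))" for v
      unfolding pochhammer_ratio_def
      apply (subst (1 2) pochhammer_eq_Gamma_series')
      using c AB Gnz[of "1 + of_real c + \<i> * of_real v / 2"] Gnz[of "1 + of_real c + \<i> * of_real v"]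
      by (simp_all add: A_def B_def ln2n' L_def[symmetric] power_divide power_mult_distrib mult_ac)
    have e: "exp (\<i> * of_real u * of_real (ln 2)) * (exp ((1 + of_real c) * (of_real (ln 2) + L)) / (exp ((1 + of_real c) * L))\<^sup>2) =
        exp ((1 + of_real c + \<i> * of_real u) * (of_real (ln 2) + L)) / (exp ((1 + of_real c + \<i> * of_real u / 2) * L))\<^sup>2"
      unfolding exp_double[symmetric] exp_diff[symmetric] exp_add[symmetric]
      by (simp add: algebra_simps)
    have alg: "E * ((A * X * G1\<^sup>2 / (B\<^sup>2 * Y\<^sup>2 * G2)) / (A * X' * G3\<^sup>2 / (B\<^sup>2 * Y'\<^sup>2 * G4))) = G4 * G1\<^sup>2 / (G2 * G3\<^sup>2)"
      if "E * (X / Y\<^sup>2) = X' / Y'\<^sup>2" "X' \<noteq> 0" "Y' \<noteq> 0" "Y \<noteq> 0" "G1 \<noteq> 0" "G2 \<noteq> 0" "G3 \<noteq> 0" "G4 \<noteq> 0"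
      for E X Y X' Y' G1 G2 G3 G4 :: complex
    proof -
      have "E * ((A * X * G1\<^sup>2 / (B\<^sup>2 * Y\<^sup>2 * G2)) / (A * X' * G3\<^sup>2 / (B\<^sup>2 * Y'\<^sup>2 * G4))) =
          (E * (X / Y\<^sup>2)) * (Y'\<^sup>2 / X') * (G4 * G1\<^sup>2 / (G2 * G3\<^sup>2))"
        using that(2-) AB by (simp add: divide_simps)
      also have "\<dots> = G4 * G1\<^sup>2 / (G2 * G3\<^sup>2)"
        unfolding that(1) using that by simp
      finally show ?thesis .
    qed
    show ?thesis
      unfolding q using alg[OF e] Gnz Re by simp
  qed
  have "(\<lambda>n. ?G ?z (2 * n) * (?G ?x n)\<^sup>2 / (?G ?x (2 * n) * (?G ?w n)\<^sup>2)) \<longlonglongrightarrow>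
      Gamma ?z * (Gamma ?x)\<^sup>2 / (Gamma ?x * (Gamma ?w)\<^sup>2)"
    using nz by (intro tendsto_intros Gamma_series'_LIMSEQ filterlim_compose[OF Gamma_series'_LIMSEQ dbl])
      (auto simp: Gamma_eq_zero_iff)
  also have "Gamma ?z * (Gamma ?x)\<^sup>2 / (Gamma ?x * (Gamma ?w)\<^sup>2) = gfac c u"
    using nz by (simp add: gfac_def power2_eq_square Gamma_eq_zero_iff)
  finally show ?thesis
    by (rule Lim_transform_eventually)
       (use eventually_gt_at_top[of 0] in eventually_elim, simp only: eq)
qed

text \<open>The factor by which the modulus of one linear factor at parameter 0 differs from that at
  parameter \<open>u\<close>.\<close>

definition hfun :: "real \<Rightarrow> real \<Rightarrow> real" where
  "hfun u x = x / cmod (x + \<i> * u)"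

lemma cmod_shift_pos: "x > 0 \<Longrightarrow> cmod (of_real x + \<i> * of_real u) > 0"
  by (auto simp: complex_eq_iff)

lemma hfun_pos: "x > 0 \<Longrightarrow> hfun u x > 0"
  unfolding hfun_def using cmod_shift_pos[of x u] by simp

lemma hfun_mono:
  assumes "0 < x" "x \<le> y"
  shows "hfun u x \<le> hfun u y"
proof -
  have "x * cmod (y + \<i> * u) \<le> y * cmod (x + \<i> * u)"
  proof (rule power2_le_imp_le)
    have "x\<^sup>2 * u\<^sup>2 \<le> y\<^sup>2 * u\<^sup>2"
      using assms by (intro mult_right_mono power_mono) auto
    thus "(x * cmod (y + \<i> * u))\<^sup>2 \<le> (y * cmod (x + \<i> * u))\<^sup>2"
      by (simp add: power_mult_distrib cmod_power2 algebra_simps)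
  qed (use assms in auto)
  thus ?thesis
    unfolding hfun_def using assms cmod_shift_pos[of x u] cmod_shift_pos[of y u] by (simp add: divide_simps mult_ac)
qed

lemma hfun_le:
  assumes "x > 0" "u \<noteq> 0"
  shows "hfun u x \<le> x / \<bar>u\<bar>"
  unfolding hfun_def using abs_Im_le_cmod[of "of_real x + \<i> * of_real u"] assms
  by (intro divide_left_mono) (auto intro!: mult_pos_pos cmod_shift_pos)

lemma hfun_tendsto_1:
  assumes "filterlim f at_top F"
  shows "((\<lambda>n. hfun u (f n)) \<longlongrightarrow> 1) F"
proof -
  have "((\<lambda>x. hfun u x) \<longlongrightarrow> 1) at_top"
  proof -
    have "((\<lambda>x::real. 1 / cmod (1 + \<i> * of_real u * of_real (inverse x))) \<longlongrightarrow> 1 / cmod (1 + \<i> * of_real u * of_real 0)) at_top"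
      by (intro tendsto_intros tendsto_inverse_0_at_top filterlim_ident) auto
    moreover have "eventually (\<lambda>x. 1 / cmod (1 + \<i> * of_real u * of_real (inverse x)) = hfun u x) at_top"
      using eventually_gt_at_top[of 0]
    proof eventually_elim
      case (elim x)
      have "of_real x + \<i> * of_real u = of_real x * (1 + \<i> * of_real u * of_real (inverse x))"
        using elim by (simp add: field_simps)
      hence "cmod (of_real x + \<i> * of_real u) = x * cmod (1 + \<i> * of_real u * of_real (inverse x))"
        using elim by (simp only: norm_mult norm_of_real)
      thus ?case unfolding hfun_def using elim by simp
    qed
    ultimately show ?thesis
      by (auto intro: Lim_transform_eventually)
  qed
  thus ?thesis using assms by (rule filterlim_compose)
qed

text \<open>For \<open>c \<ge> 2 r\<close> the moduli of the factors of the approximating products telescope with gap \<open>r\<close>,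
  which leaves a decay of order \<open>|u| ^ -r\<close>.\<close>

lemma norm_gfac_le:
  assumes c: "c \<ge> 2 * real r"
  shows "cmod (gfac c u) \<le> (\<Prod>m<r. hfun u (2 + c + 2 * real m))"
proof -
  have c0: "c \<ge> 0" using c by linarith
  define s where "s = (\<lambda>m::nat. 2 + c + 2 * real m)"
  let ?Q = "pochhammer_ratio c"
  have spos: "s m > 0" for m using c0 by (simp add: s_def)
  define R where "R = (\<lambda>n. (\<Prod>m<r. hfun u (s m)) / (\<Prod>m<r. hfun u (s (n + m))))"
  have bound: "cmod (exp (\<i> * of_real u * of_real (ln 2)) * (?Q 0 n / ?Q u n)) \<le> R n" for n
  proof -
    define a where "a = (\<lambda>m::nat. 1 + c + 2 * real m)"
    define b where "b = (\<lambda>m::nat. 2 + 2 * c + 2 * real m)"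
    have pos: "a m > 0" "b m > 0" for m using c0 by (auto simp: a_def b_def)
    have Qprod: "?Q v n = (\<Prod>m<n. (a m + \<i> * v) * (s m + \<i> * v) / ((b m + \<i> * v) / 2)\<^sup>2)" for v
    proof -
      have "(b m + \<i> * v) / 2 = 1 + of_real c + \<i> * of_real v / 2 + of_nat m" for m
        by (simp add: b_def field_simps)
      hence "(\<Prod>m<n. (b m + \<i> * v) / 2) = pochhammer (1 + of_real c + \<i> * of_real v / 2) n"
        by (simp only: prod_pochhammer)
      moreover have "(\<Prod>m<n. (a m + \<i> * v) * (s m + \<i> * v)) = pochhammer (1 + of_real c + \<i> * of_real v) (2 * n)"
        unfolding prod_pochhammer_double[symmetric]
        by (intro prod.cong refl) (simp add: a_def s_def algebra_simps)
      ultimately have "?Q v n = (\<Prod>m<n. (a m + \<i> * v) * (s m + \<i> * v)) / (\<Prod>m<n. (b m + \<i> * v) / 2)\<^sup>2"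
        by (simp only: pochhammer_ratio_def)
      thus ?thesis
        by (simp only: prod_power_distrib prod_dividef[symmetric])
    qed
    have "?Q 0 n / ?Q u n = (\<Prod>m<n. ((a m + \<i> * 0) * (s m + \<i> * 0) / ((b m + \<i> * 0) / 2)\<^sup>2) /
        ((a m + \<i> * u) * (s m + \<i> * u) / ((b m + \<i> * u) / 2)\<^sup>2))"
      unfolding Qprod prod_dividef by simp
    hence "cmod (exp (\<i> * of_real u * of_real (ln 2)) * (?Q 0 n / ?Q u n)) =
        cmod (\<Prod>m<n. ((a m + \<i> * 0) * (s m + \<i> * 0) / ((b m + \<i> * 0) / 2)\<^sup>2) /
        ((a m + \<i> * u) * (s m + \<i> * u) / ((b m + \<i> * u) / 2)\<^sup>2))"
      unfolding norm_mult by (simp only: norm_exp_eq_Re) simp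
    also have "\<dots> = (\<Prod>m<n. hfun u (a m) * hfun u (s m) / (hfun u (b m))\<^sup>2)"
      unfolding prod_norm[symmetric]
    proof (intro prod.cong refl)
      fix m
      show "cmod (((a m + \<i> * 0) * (s m + \<i> * 0) / ((b m + \<i> * 0) / 2)\<^sup>2) /
        ((a m + \<i> * u) * (s m + \<i> * u) / ((b m + \<i> * u) / 2)\<^sup>2)) = hfun u (a m) * hfun u (s m) / (hfun u (b m))\<^sup>2"
        using spos[of m] pos[of m]
        by (simp add: hfun_def norm_mult norm_divide norm_power power_divide mult_ac)
    qed
    also have "\<dots> \<le> (\<Prod>m<n. hfun u (s m) / hfun u (s (m + r)))"
    proof (intro prod_mono conjI)
      fix m
      have h: "hfun u (a m) > 0" "hfun u (s m) > 0" "hfun u (b m) > 0" "hfun u (s (m + r)) > 0"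
        using pos spos by (auto intro: hfun_pos)
      show "0 \<le> hfun u (a m) * hfun u (s m) / (hfun u (b m))\<^sup>2"
        using h by simp
      \<comment> \<open>\<open>a m \<le> b m\<close> cancels one of the two denominators;
        \<open>c \<ge> 2 r\<close> means \<open>s (m + r) \<le> b m\<close>, which bounds the
        other.\<close>
      have "hfun u (a m) \<le> hfun u (b m)"
        using c0 pos by (intro hfun_mono) (auto simp: a_def b_def)
      hence "hfun u (a m) * hfun u (s m) / (hfun u (b m))\<^sup>2 \<le> hfun u (b m) * hfun u (s m) / (hfun u (b m))\<^sup>2"
        using h by (intro divide_right_mono mult_right_mono) auto
      also have "\<dots> = hfun u (s m) / hfun u (b m)"
        using h by (simp add: power2_eq_square)
      also have "\<dots> \<le> hfun u (s m) / hfun u (s (m + r))"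
        using h c spos by (intro divide_left_mono hfun_mono) (auto simp: s_def b_def)
      finally show "hfun u (a m) * hfun u (s m) / (hfun u (b m))\<^sup>2 \<le> hfun u (s m) / hfun u (s (m + r))" .
    qed
    also have "\<dots> = R n"
    proof -
      have nz: "prod (\<lambda>m. hfun u (s (f m))) A \<noteq> 0" if "finite A" for f :: "nat \<Rightarrow> nat" and A
        using that hfun_pos[OF spos] by (auto simp: less_imp_neq[symmetric])
      have split: "(\<Prod>m<k+l. hfun u (s m)) = (\<Prod>m<k. hfun u (s m)) * (\<Prod>m<l. hfun u (s (k + m)))" for k l
        by (induction l) (simp_all add: mult_ac)
      \<comment> \<open>The product over the first \<open>n + r\<close> indices is split in two
        ways; this is the telescoping.\<close>
      have "(\<Prod>m<n. hfun u (s m)) * (\<Prod>m<r. hfun u (s (n + m))) =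
          (\<Prod>m<r. hfun u (s m)) * (\<Prod>m<n. hfun u (s (m + r)))"
        using split[of n r] split[of r n] by (simp add: add.commute)
      thus ?thesis
        unfolding R_def prod_dividef by (subst frac_eq_eq[OF nz nz[where f = "\<lambda>m. n + m"]]) (simp_all add: mult_ac)
    qed
    finally show ?thesis .
  qed
  have "R \<longlonglongrightarrow> (\<Prod>m<r. hfun u (s m)) / (\<Prod>m<r. 1)"
    unfolding R_def
  proof (intro tendsto_intros hfun_tendsto_1)
    fix m
    show "filterlim (\<lambda>n. s (n + m)) at_top sequentially"
      unfolding s_def
      by (intro filterlim_tendsto_add_at_top[OF tendsto_const] filterlim_tendsto_pos_mult_at_top[OF tendsto_const]
          filterlim_compose[OF filterlim_real_sequentially filterlim_add_const_nat_at_top]) auto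
  qed auto
  hence "R \<longlonglongrightarrow> (\<Prod>m<r. hfun u (s m))" by simp
  note R = this
  have lim: "(\<lambda>n. cmod (exp (\<i> * of_real u * of_real (ln 2)) * (?Q 0 n / ?Q u n))) \<longlonglongrightarrow> cmod (gfac c u)"
    by (rule tendsto_norm[OF pochhammer_ratio_tendsto_gfac[OF c0]])
  have "cmod (gfac c u) \<le> (\<Prod>m<r. hfun u (s m))"
    by (rule LIMSEQ_le[OF lim R]) (use bound in blast)
  thus ?thesis by (simp add: s_def)
qed

lemma norm_gfac_le_1: "c \<ge> 0 \<Longrightarrow> cmod (gfac c u) \<le> 1"
  using norm_gfac_le[of 0 c u] by simp

lemma norm_gfac_le_power:
  assumes "c \<ge> 2 * real r" "u \<noteq> 0"
  shows "cmod (gfac c u) \<le> ((2 + c + 2 * real r) / \<bar>u\<bar>) ^ r"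
proof -
  have "cmod (gfac c u) \<le> (\<Prod>m<r. hfun u (2 + c + 2 * real m))"
    by (rule norm_gfac_le[OF assms(1)])
  also have "\<dots> \<le> (\<Prod>m<r. (2 + c + 2 * real r) / \<bar>u\<bar>)"
  proof (intro prod_mono conjI)
    fix m assume m: "m \<in> {..<r}"
    have p: "2 + c + 2 * real m > 0" using assms(1) by (simp add: add_pos_nonneg)
    show "0 \<le> hfun u (2 + c + 2 * real m)" using hfun_pos[OF p] by (simp add: less_imp_le)
    have "hfun u (2 + c + 2 * real m) \<le> (2 + c + 2 * real m) / \<bar>u\<bar>"
      by (rule hfun_le[OF p assms(2)])
    also have "\<dots> \<le> (2 + c + 2 * real r) / \<bar>u\<bar>"
      using m by (intro divide_right_mono) auto
    finally show "hfun u (2 + c + 2 * real m) \<le> (2 + c + 2 * real r) / \<bar>u\<bar>" .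
  qed
  finally show ?thesis by simp
qed

section \<open>The characteristic function\<close>

lemma exp_minus_le_1_minus_half:
  fixes x :: real
  assumes "0 \<le> x" "x \<le> 1"
  shows "exp (-x) \<le> 1 - x / 2"
proof -
  have "1 \<le> (1 + x) * (1 - x / 2)"
  proof -
    have "x * x \<le> 1 * x" using assms by (intro mult_right_mono) auto
    thus ?thesis by (simp add: algebra_simps)
  qed
  also have "\<dots> \<le> exp x * (1 - x / 2)"
    using assms exp_ge_add_one_self[of x] by (intro mult_right_mono) auto
  finally show ?thesis by (simp add: exp_minus field_simps)
qed

text \<open>The right-hand side is chosen because its mean under a tilted law is known from the
  recursion. If \<open>x\<close> is within 1/2 of \<open>c\<close>, a Lipschitz bound and
  \<open>1 - exp (- y) \<ge> y / 2\<close> suffice; otherwise the left side is at most 2 and the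
  last factor at least 1/2, whence the constant 4.\<close>

lemma cmod_iexp_diff_le:
  fixes u x c :: real
  assumes "x \<le> c"
  shows "cmod (exp (\<i> * u * x) - exp (\<i> * u * c)) \<le> (\<bar>u\<bar> + 4) * (1 - exp (2 * (x - c)))"
proof (cases "2 * (c - x) \<le> 1")
  case True
  have "exp (\<i> * u * x) - exp (\<i> * u * c) = exp (\<i> * of_real (u * x)) * (1 - exp (\<i> * of_real (u * (c - x))))"
    unfolding right_diff_distrib exp_add[symmetric] by (simp add: algebra_simps)
  hence "cmod (exp (\<i> * u * x) - exp (\<i> * u * c)) = cmod (exp (\<i> * of_real (u * (c - x))) - 1)"
    by (simp add: norm_mult norm_minus_commute)
  also have "\<dots> \<le> \<bar>u * (c - x)\<bar>"
    using iexp_approx1[of "u * (c - x)" 0] by simp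
  also have "\<dots> = \<bar>u\<bar> * (c - x)"
    using assms by (simp add: abs_mult)
  also have "\<dots> \<le> \<bar>u\<bar> * (1 - exp (2 * (x - c)))"
  proof (intro mult_left_mono)
    have "exp (- (2 * (c - x))) \<le> 1 - 2 * (c - x) / 2"
      using True assms by (intro exp_minus_le_1_minus_half) auto
    also have "1 - 2 * (c - x) / 2 = 1 - (c - x)" by (simp add: field_simps)
    also have "- (2 * (c - x)) = 2 * (x - c)" by simp
    finally show "c - x \<le> 1 - exp (2 * (x - c))" by linarith
  qed auto
  also have "\<dots> \<le> (\<bar>u\<bar> + 4) * (1 - exp (2 * (x - c)))"
    using assms by (intro mult_right_mono) auto
  finally show ?thesis .
next
  case False
  have "cmod (exp (\<i> * u * x) - exp (\<i> * u * c)) \<le> 2"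
    using norm_triangle_ineq4[of "exp (\<i> * u * x)" "exp (\<i> * u * c)"]
    by (simp add: norm_exp_eq_Re)
  also have "2 \<le> 4 * (1 - exp (2 * (x - c)))"
  proof -
    have "exp (2 * (x - c)) \<le> exp (- 1)" using False by simp
    also have "\<dots> \<le> 1 - 1 / 2" by (rule exp_minus_le_1_minus_half) auto
    finally show ?thesis by simp
  qed
  also have "\<dots> \<le> (\<bar>u\<bar> + 4) * (1 - exp (2 * (x - c)))"
    using assms by (intro mult_right_mono) auto
  finally show ?thesis .
qed

section \<open>Tilted laws and their concentration at the maximum\<close>

context cbe
begin

lemma integrable_exp_weight:
  assumes "Re z \<ge> 0"
  shows "integrable (cbe_base N) (\<lambda>t. exp (z * of_real (log_abs_D N \<theta> t)) * of_real (cbe_weight \<beta> N t))"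
  using integrable_lim[OF assms, of "\<lambda>_ _. 1" 1 "\<lambda>_. 1" 0] by (simp add: lim_weight_def)

lemma cbe_weight_nonneg: "cbe_weight \<beta> N t \<ge> 0"
  unfolding cbe_weight_def by (intro prod_nonneg) auto

lemma cbe_weight_pos:
  assumes "cbe_generic \<theta> N t"
  shows "cbe_weight \<beta> N t > 0"
  using exp_reg_energy_0[OF assms, of 0] cbe_weight_nonneg[of t] exp_not_eq_zero[of "reg_energy 0 0 t"]
  by (cases "cbe_weight \<beta> N t = 0") auto

lemma log_abs_D_le:
  assumes "cbe_generic \<theta> N t"
  shows "log_abs_D N \<theta> t \<le> real N * ln 2"
proof -
  have "cmod (char_poly_D N \<theta> t) \<le> (\<Prod>j<N. 2)"
    unfolding char_poly_D_def prod_norm[symmetric]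
  proof (intro prod_mono conjI)
    show "cmod (cis \<theta> - cis (t j)) \<le> 2" for j
      using norm_triangle_ineq4[of "cis \<theta>" "cis (t j)"] by simp
  qed simp
  hence "ln (cmod (char_poly_D N \<theta> t)) \<le> ln (2 ^ N)"
    using char_poly_D_neq_0[OF assms] by (subst ln_le_cancel_iff) auto
  thus ?thesis by (simp add: log_abs_D_def ln_realpow)
qed

definition rmellin :: "real \<Rightarrow> real" where
  "rmellin s = (\<integral>t. exp (s * log_abs_D N \<theta> t) * cbe_weight \<beta> N t \<partial>cbe_base N)"

lemma mellin_of_real: "mellin (of_real s) = of_real (rmellin s)"
  unfolding mellin_def rmellin_def integral_complex_of_real[symmetric] by (simp add: exp_of_real[symmetric])

lemma integrable_rmellin:
  assumes "s \<ge> 0"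
  shows "integrable (cbe_base N) (\<lambda>t. exp (s * log_abs_D N \<theta> t) * cbe_weight \<beta> N t)"
  using integrable_norm[OF integrable_exp_weight[of "of_real s"]] assms
  by (simp add: norm_mult norm_exp_eq_Re cbe_weight_nonneg)

lemma rmellin_pos:
  assumes "s \<ge> 0"
  shows "rmellin s > 0"
proof -
  have nonneg: "0 \<le> rmellin s"
    unfolding rmellin_def by (intro Bochner_Integration.integral_nonneg) (simp add: cbe_weight_nonneg)
  have "rmellin s \<noteq> 0"
  proof
    assume "rmellin s = 0"
    hence "AE t in cbe_base N. exp (s * log_abs_D N \<theta> t) * cbe_weight \<beta> N t = 0"
      unfolding rmellin_def
      by (subst (asm) integral_nonneg_eq_0_iff_AE[OF integrable_rmellin[OF assms]]) (auto simp: cbe_weight_nonneg)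
    with AE_cbe_generic[of \<theta> N] have "AE t in cbe_base N. False"
      by eventually_elim (use cbe_weight_pos in force)
    hence "emeasure (cbe_base N) (space (cbe_base N)) = 0"
      by (subst (asm) AE_iff_measurable[of "space (cbe_base N)"]) auto
    thus False by (simp add: emeasure_space_cbe_base)
  qed
  with nonneg show ?thesis by simp
qed

definition mellin_ratio :: "complex \<Rightarrow> complex" where
  "mellin_ratio z = (\<Prod>j<N. (1 + z + \<beta> / 2 * real j) * (2 + z + \<beta> / 2 * real j) / (1 + z / 2 + \<beta> / 2 * real j)\<^sup>2)"

lemma mellin_step:
  assumes "Re z \<ge> 0"
  shows "mellin (z + 2) = mellin z * mellin_ratio z"
proof -
  have "(\<Prod>j<N. 1 + z / 2 + \<beta> / 2 * real j) \<noteq> 0"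
  proof (subst prod_zero_iff; safe)
    fix j assume "1 + z / 2 + \<beta> / 2 * real j = 0"
    hence "Re (1 + z / 2 + \<beta> / 2 * real j) = 0" by simp
    moreover have "\<beta> * real j \<ge> 0" using \<beta> by simp
    ultimately show False using assms by simp
  qed
  thus ?thesis
    using mellin_rec[OF assms] unfolding mellin_ratio_def prod_dividef prod_power_distrib[symmetric]
    by (simp add: field_simps)
qed

text \<open>Each of the \<open>N\<close> factors tends to \<open>2 * 2 / 1\<close>. The limit is the
  square of the maximal modulus \<open>2 ^ N\<close> of \<open>D\<close>, which is what forces
  concentration.\<close>

lemma mellin_ratio_tendsto: "(\<lambda>n. mellin_ratio (of_nat (2 * n))) \<longlonglongrightarrow> of_real (4 ^ N)"
proof -
  have fac: "(\<lambda>n. (1 + of_nat (2 * n) + b) * (2 + of_nat (2 * n) + b) / (1 + of_nat (2 * n) / 2 + b)\<^sup>2) \<longlonglongrightarrow> (4 :: complex)" for b :: complex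
  proof -
    have inv: "(\<lambda>n. inverse (of_nat n :: complex)) \<longlonglongrightarrow> 0" by (rule lim_inverse_n)
    have "(\<lambda>n. (2 + (1 + b) * inverse (of_nat n)) * (2 + (2 + b) * inverse (of_nat n)) / (1 + (1 + b) * inverse (of_nat n))\<^sup>2)
        \<longlonglongrightarrow> (2 + (1 + b) * 0) * (2 + (2 + b) * 0) / (1 + (1 + b) * 0)\<^sup>2"
      by (intro tendsto_intros inv) auto
    moreover have "eventually (\<lambda>n. (2 + (1 + b) * inverse (of_nat n)) * (2 + (2 + b) * inverse (of_nat n)) / (1 + (1 + b) * inverse (of_nat n))\<^sup>2 =
        (1 + of_nat (2 * n) + b) * (2 + of_nat (2 * n) + b) / (1 + of_nat (2 * n) / 2 + b)\<^sup>2) sequentially"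
      using eventually_gt_at_top[of 0]
    proof eventually_elim
      case (elim n)
      define x where "x = (of_nat n :: complex)"
      have x: "x \<noteq> 0" using elim by (simp add: x_def)
      have "(1 + 2 * x + b) * (2 + 2 * x + b) / (1 + 2 * x / 2 + b)\<^sup>2 =
          ((2 + (1 + b) * inverse x) * x) * ((2 + (2 + b) * inverse x) * x) / ((1 + (1 + b) * inverse x) * x)\<^sup>2"
      proof -
        have "(2 + (1 + b) * inverse x) * x = 1 + 2 * x + b" "(2 + (2 + b) * inverse x) * x = 2 + 2 * x + b"
          "(1 + (1 + b) * inverse x) * x = 1 + 2 * x / 2 + b"
          using x by (simp_all add: field_simps)
        thus ?thesis by (simp only:)
      qed
      also have "\<dots> = (2 + (1 + b) * inverse x) * (2 + (2 + b) * inverse x) / (1 + (1 + b) * inverse x)\<^sup>2"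
        using x by (simp add: power2_eq_square)
      finally show ?case by (simp add: x_def)
    qed
    ultimately show ?thesis by (auto intro: Lim_transform_eventually)
  qed
  have "(\<lambda>n. mellin_ratio (of_nat (2 * n))) \<longlonglongrightarrow> (\<Prod>j<N. 4)"
    unfolding mellin_ratio_def by (intro tendsto_prod fac)
  thus ?thesis by simp
qed

text \<open>\<open>mellin_ratio (2 n)\<close> is the mean of \<open>|D| ^ 2\<close> under the law
  tilted by \<open>|D| ^ (2 n)\<close>. As it tends to the maximal value \<open>4 ^ N\<close>, the
  tilted mean of \<open>1 - exp (2 (X - N ln 2))\<close> tends to 0, and this dominates the
  deviation of the tilted characteristic function from its limit.\<close>

lemma mellin_asymp:
  fixes u :: real
  shows "(\<lambda>n. mellin (of_nat (2 * n) + \<i> * u) / mellin (of_nat (2 * n))) \<longlonglongrightarrow> exp (\<i> * u * (real N * ln 2))"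
proof -
  let ?c = "real N * ln 2"
  let ?X = "log_abs_D N \<theta>" and ?W = "cbe_weight \<beta> N" and ?M = "cbe_base N"
  have rm: "mellin (of_nat (2 * n)) = of_real (rmellin (2 * real n))" for n
    using mellin_of_real[of "2 * real n"] by simp
  have pos: "rmellin (2 * real n) > 0" for n by (rule rmellin_pos) simp
  have exp4: "exp (2 * ?c) = 4 ^ N"
  proof -
    have "exp (2 * ?c) = exp (real N * (2 * ln 2))" by (simp add: mult_ac)
    also have "\<dots> = exp (2 * ln 2) ^ N" by (rule exp_of_nat_mult)
    also have "exp (2 * ln 2) = (4 :: real)" unfolding exp_double by simp
    finally show ?thesis .
  qed
  have bound: "cmod (mellin (of_nat (2 * n) + \<i> * u) / mellin (of_nat (2 * n)) - exp (\<i> * u * ?c)) \<le>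
      (\<bar>u\<bar> + 4) * (1 - cmod (mellin_ratio (of_nat (2 * n))) / 4 ^ N)" for n
  proof -
    let ?s = "2 * real n"
    have diff: "mellin (of_nat (2 * n) + \<i> * u) - exp (\<i> * u * ?c) * mellin (of_nat (2 * n)) =
        (\<integral>t. (exp ((of_nat (2 * n) + \<i> * u) * of_real (?X t)) * of_real (?W t)) -
             exp (\<i> * u * ?c) * (exp (of_nat (2 * n) * of_real (?X t)) * of_real (?W t)) \<partial>?M)"
      unfolding mellin_def
      by (subst Bochner_Integration.integral_diff)
         (auto intro!: integrable_exp_weight integrable_mult_right)
    have "cmod (mellin (of_nat (2 * n) + \<i> * u) - exp (\<i> * u * ?c) * mellin (of_nat (2 * n))) \<le>
        (\<integral>t. (\<bar>u\<bar> + 4) * (exp (?s * ?X t) * ?W t - exp ((?s + 2) * ?X t) * ?W t / 4 ^ N) \<partial>?M)"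
      unfolding diff
    proof (rule order_trans[OF integral_norm_bound integral_mono_AE])
      show "integrable ?M (\<lambda>t. (\<bar>u\<bar> + 4) * (exp (?s * ?X t) * ?W t - exp ((?s + 2) * ?X t) * ?W t / 4 ^ N))"
        by (intro integrable_mult_right Bochner_Integration.integrable_diff integrable_divide integrable_rmellin) auto
      show "integrable ?M (\<lambda>t. cmod ((exp ((of_nat (2 * n) + \<i> * u) * of_real (?X t)) * of_real (?W t)) -
             exp (\<i> * u * ?c) * (exp (of_nat (2 * n) * of_real (?X t)) * of_real (?W t))))"
        by (intro integrable_norm integrable_mult_right Bochner_Integration.integrable_diff integrable_exp_weight) auto
      show "AE t in ?M. cmod ((exp ((of_nat (2 * n) + \<i> * u) * of_real (?X t)) * of_real (?W t)) -
             exp (\<i> * u * ?c) * (exp (of_nat (2 * n) * of_real (?X t)) * of_real (?W t)))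
          \<le> (\<bar>u\<bar> + 4) * (exp (?s * ?X t) * ?W t - exp ((?s + 2) * ?X t) * ?W t / 4 ^ N)"
        using AE_cbe_generic[of \<theta> N]
      proof eventually_elim
        case (elim t)
        have "(exp ((of_nat (2 * n) + \<i> * u) * of_real (?X t)) * of_real (?W t)) -
             exp (\<i> * u * ?c) * (exp (of_nat (2 * n) * of_real (?X t)) * of_real (?W t)) =
            (exp (\<i> * u * ?X t) - exp (\<i> * u * ?c)) * (exp (of_real (?s * ?X t)) * of_real (?W t))"
        proof -
          have "exp ((of_nat (2 * n) + \<i> * u) * of_real (?X t)) = exp (\<i> * u * ?X t) * exp (of_real (?s * ?X t))"
            unfolding exp_add[symmetric] by (simp add: algebra_simps)
          moreover have "exp (of_nat (2 * n) * of_real (?X t)) = exp (complex_of_real (?s * ?X t))"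
            by simp
          ultimately show ?thesis
            by (simp only: left_diff_distrib mult.assoc)
        qed
        also have "cmod \<dots> = cmod (exp (\<i> * u * ?X t) - exp (\<i> * u * ?c)) * (exp (?s * ?X t) * ?W t)"
          by (simp only: norm_mult norm_exp_eq_Re Re_complex_of_real norm_of_real abs_of_nonneg[OF cbe_weight_nonneg])
        also have "\<dots> \<le> (\<bar>u\<bar> + 4) * (1 - exp (2 * (?X t - ?c))) * (exp (?s * ?X t) * ?W t)"
          by (intro mult_right_mono cmod_iexp_diff_le log_abs_D_le elim) (simp add: cbe_weight_nonneg)
        also have "exp (2 * (?X t - ?c)) = exp (2 * ?X t) / 4 ^ N"
          unfolding right_diff_distrib exp_diff exp4 ..
        also have "(\<bar>u\<bar> + 4) * (1 - exp (2 * ?X t) / 4 ^ N) * (exp (?s * ?X t) * ?W t) =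
            (\<bar>u\<bar> + 4) * (exp (?s * ?X t) * ?W t - exp ((?s + 2) * ?X t) * ?W t / 4 ^ N)"
          by (simp add: distrib_right exp_add algebra_simps)
        finally show ?case .
      qed
    qed
    also have "\<dots> = (\<bar>u\<bar> + 4) * (rmellin ?s - rmellin (?s + 2) / 4 ^ N)"
    proof -
      have H: "has_bochner_integral ?M (\<lambda>t. exp (s * ?X t) * ?W t) (rmellin s)" if "s \<ge> 0" for s
        using integrable_rmellin[OF that] by (simp add: rmellin_def has_bochner_integral_integrable)
      show ?thesis
        by (intro has_bochner_integral_integral_eq has_bochner_integral_mult_right has_bochner_integral_diff
            has_bochner_integral_divide H) auto
    qed
    \<comment> \<open>One recursion step evaluates the tilted mean of \<open>|D| ^ 2\<close>; the
      real transforms are positive, so passing to moduli loses nothing.\<close>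
    also have "rmellin (?s + 2) = rmellin ?s * cmod (mellin_ratio (of_nat (2 * n)))"
    proof -
      have "mellin (of_nat (2 * n) + 2) = mellin (of_nat (2 * n)) * mellin_ratio (of_nat (2 * n))"
        by (rule mellin_step) simp
      hence "cmod (mellin (of_real (?s + 2))) = cmod (mellin (of_nat (2 * n))) * cmod (mellin_ratio (of_nat (2 * n)))"
        by (simp add: norm_mult)
      thus ?thesis
        unfolding rm mellin_of_real using pos[of n] rmellin_pos[of "?s + 2"] by simp
    qed
    finally have "cmod (mellin (of_nat (2 * n) + \<i> * u) - exp (\<i> * u * ?c) * mellin (of_nat (2 * n))) \<le>
       (\<bar>u\<bar> + 4) * (1 - cmod (mellin_ratio (of_nat (2 * n))) / 4 ^ N) * rmellin ?s"
      by (simp add: algebra_simps)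
    moreover have "mellin (of_nat (2 * n) + \<i> * u) / mellin (of_nat (2 * n)) - exp (\<i> * u * ?c) =
        (mellin (of_nat (2 * n) + \<i> * u) - exp (\<i> * u * ?c) * mellin (of_nat (2 * n))) / of_real (rmellin ?s)"
      unfolding rm using pos[of n] by (simp add: diff_divide_distrib)
    ultimately show ?thesis
      using pos[of n] by (simp add: norm_divide pos_divide_le_eq)
  qed
  have "(\<lambda>n. (\<bar>u\<bar> + 4) * (1 - cmod (mellin_ratio (of_nat (2 * n))) / 4 ^ N)) \<longlonglongrightarrow>
      (\<bar>u\<bar> + 4) * (1 - cmod (of_real (4 ^ N)) / 4 ^ N)"
    by (intro tendsto_intros mellin_ratio_tendsto) auto
  hence "(\<lambda>n. (\<bar>u\<bar> + 4) * (1 - cmod (mellin_ratio (of_nat (2 * n))) / 4 ^ N)) \<longlonglongrightarrow> 0"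
    by (simp add: norm_power)
  hence "(\<lambda>n. mellin (of_nat (2 * n) + \<i> * u) / mellin (of_nat (2 * n)) - exp (\<i> * u * ?c)) \<longlonglongrightarrow> 0"
    by (rule Lim_null_comparison[OF always_eventually, rotated]) (use bound in simp)
  thus ?thesis by (simp add: LIM_zero_iff)
qed

lemma mellin_iterate:
  "mellin (of_nat (2 * n) + \<i> * u) = mellin (\<i> * u) *
     (\<Prod>j<N. pochhammer_ratio (\<beta> / 2 * real j) u n)"
proof -
  have "mellin (of_nat (2 * n) + \<i> * u) = mellin (\<i> * u) * (\<Prod>m<n. mellin_ratio (of_nat (2 * m) + \<i> * u))"
  proof (induction n)
    case (Suc n)
    have "mellin (of_nat (2 * Suc n) + \<i> * u) = mellin (of_nat (2 * n) + \<i> * u + 2)"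
      by (simp add: add_ac)
    also have "\<dots> = mellin (of_nat (2 * n) + \<i> * u) * mellin_ratio (of_nat (2 * n) + \<i> * u)"
      by (rule mellin_step) simp
    finally show ?case by (simp only: Suc.IH prod.lessThan_Suc mult.assoc)
  qed simp
  also have "(\<Prod>m<n. mellin_ratio (of_nat (2 * m) + \<i> * u)) =
     (\<Prod>j<N. \<Prod>m<n. (1 + (of_nat (2 * m) + \<i> * u) + \<beta> / 2 * real j) * (2 + (of_nat (2 * m) + \<i> * u) + \<beta> / 2 * real j) /
        (1 + (of_nat (2 * m) + \<i> * u) / 2 + \<beta> / 2 * real j)\<^sup>2)"
    unfolding mellin_ratio_def by (rule prod.swap)
  also have "\<dots> = (\<Prod>j<N. pochhammer_ratio (\<beta> / 2 * real j) u n)"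
  proof (intro prod.cong refl)
    fix j
    let ?c = "\<beta> / 2 * real j"
    have "(\<Prod>m<n. (1 + (of_nat (2 * m) + \<i> * of_real u) + ?c) * (2 + (of_nat (2 * m) + \<i> * of_real u) + ?c)) =
        pochhammer (1 + of_real ?c + \<i> * of_real u) (2 * n)"
      unfolding prod_pochhammer_double[symmetric]
      by (intro prod.cong refl arg_cong2[where f = "(*)"]) (simp_all add: add_ac)
    moreover have "(\<Prod>m<n. 1 + (of_nat (2 * m) + \<i> * of_real u) / 2 + ?c) = pochhammer (1 + of_real ?c + \<i> * of_real u / 2) n"
      unfolding prod_pochhammer[symmetric]
      by (intro prod.cong refl) (simp_all add: add_ac add_divide_distrib)
    ultimately show "(\<Prod>m<n. (1 + (of_nat (2 * m) + \<i> * u) + ?c) * (2 + (of_nat (2 * m) + \<i> * u) + ?c) /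
        (1 + (of_nat (2 * m) + \<i> * u) / 2 + ?c)\<^sup>2) = pochhammer_ratio ?c u n"
      unfolding prod_dividef[of "\<lambda>m. (1 + (of_nat (2 * m) + \<i> * u) + ?c) * (2 + (of_nat (2 * m) + \<i> * u) + ?c)"]
        prod_power_distrib[symmetric] pochhammer_ratio_def by (simp only:)
  qed
  finally show ?thesis .
qed

text \<open>The quotient of the two transforms equals, for every \<open>n\<close>, an expression
  whose parts converge; not depending on \<open>n\<close>, it equals the limit. The oscillation
  \<open>exp (i u N ln 2)\<close> of the tilted law cancels against the \<open>N\<close> prefactors
  \<open>exp (i u ln 2)\<close>.\<close>

lemma mellin_imaginary:
  "mellin (\<i> * u) = mellin 0 * (\<Prod>j<N. gfac (\<beta> / 2 * real j) u)"
proof -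
  let ?Q = pochhammer_ratio
  have poch_nz: "pochhammer (1 + of_real c + \<i> * of_real u) k \<noteq> 0" if "c \<ge> 0" for c u :: real and k
  proof -
    have "1 + of_real c + \<i> * of_real u \<notin> (\<int>\<^sub>\<le>\<^sub>0 :: complex set)"
      by (rule not_nonpos_Int_if_Re_pos) (use that in simp)
    thus ?thesis using pochhammer_eq_0_imp_nonpos_Int by blast
  qed
  have Qnz: "?Q c u n \<noteq> 0" if "c \<ge> 0" for c u n
    using poch_nz[OF that, of u] poch_nz[OF that, of "u / 2"] by (simp add: pochhammer_ratio_def)
  have c0: "\<beta> / 2 * real j \<ge> 0" for j using \<beta> by simp
  have it: "mellin (of_nat (2 * n) + \<i> * of_real v) = mellin (\<i> * of_real v) * (\<Prod>j<N. ?Q (\<beta> / 2 * real j) v n)" for n v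
    using mellin_iterate[of n v] by simp
  have m0: "mellin 0 \<noteq> 0"
    using mellin_of_real[of 0] rmellin_pos[of 0] by simp
  have eq: "mellin (\<i> * of_real u) / mellin 0 = (mellin (of_nat (2 * n) + \<i> * u) / mellin (of_nat (2 * n))) / exp (\<i> * u * (real N * ln 2)) *
      (\<Prod>j<N. exp (\<i> * u * of_real (ln 2)) * (?Q (\<beta> / 2 * real j) 0 n / ?Q (\<beta> / 2 * real j) u n))" for n
  proof -
    have E: "(\<Prod>j<N. exp (\<i> * u * of_real (ln 2))) = exp (\<i> * u * (real N * ln 2))"
      by (simp add: exp_of_nat_mult[symmetric] mult_ac)
    have m2: "mellin (of_nat (2 * n)) = mellin 0 * (\<Prod>j<N. ?Q (\<beta> / 2 * real j) 0 n)"
      using it[of n 0] by simp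
    have nz: "(\<Prod>j<N. ?Q (\<beta> / 2 * real j) v n) \<noteq> 0" for v
      using Qnz[OF c0] by simp
    show ?thesis
      unfolding prod.distrib prod_dividef E m2 it using nz[of u] nz[of 0] m0 by (simp add: field_simps)
  qed
  have "(\<lambda>n. (mellin (of_nat (2 * n) + \<i> * u) / mellin (of_nat (2 * n))) / exp (\<i> * u * (real N * ln 2)) *
      (\<Prod>j<N. exp (\<i> * u * of_real (ln 2)) * (?Q (\<beta> / 2 * real j) 0 n / ?Q (\<beta> / 2 * real j) u n))) \<longlonglongrightarrow>
      exp (\<i> * u * (real N * ln 2)) / exp (\<i> * u * (real N * ln 2)) * (\<Prod>j<N. gfac (\<beta> / 2 * real j) u)"
    using pochhammer_ratio_tendsto_gfac[OF c0]
    by (intro tendsto_intros mellin_asymp) auto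
  hence "mellin (\<i> * of_real u) / mellin 0 = (\<Prod>j<N. gfac (\<beta> / 2 * real j) u)"
    unfolding eq[symmetric] by (simp add: LIMSEQ_const_iff)
  thus ?thesis using m0 by (simp add: field_simps)
qed

section \<open>Normalisation and the characteristic function of the ensemble\<close>

lemma prob_space_cbe: "prob_space (circular_beta_ensemble \<beta> N)"
proof
  have Z: "cbe_partition \<beta> N = rmellin 0"
    by (simp add: cbe_partition_def rmellin_def)
  have "emeasure (circular_beta_ensemble \<beta> N) (space (circular_beta_ensemble \<beta> N)) =
      (\<integral>\<^sup>+ t. ennreal (cbe_weight \<beta> N t / cbe_partition \<beta> N) \<partial>cbe_base N)"
    unfolding circular_beta_ensemble_def using measurable_cbe_weight
    by (subst emeasure_density) (auto intro!: nn_integral_cong)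
  also have "\<dots> = ennreal (\<integral>t. cbe_weight \<beta> N t / cbe_partition \<beta> N \<partial>cbe_base N)"
    using integrable_rmellin[of 0] rmellin_pos[of 0]
    by (intro nn_integral_eq_integral) (auto simp: Z cbe_weight_nonneg)
  also have "\<dots> = 1"
    using rmellin_pos[of 0] by (simp add: Z) (simp add: rmellin_def)
  finally show "emeasure (circular_beta_ensemble \<beta> N) (space (circular_beta_ensemble \<beta> N)) = 1" .
qed

lemma measurable_log_abs_D_cbe: "log_abs_D N \<theta> \<in> borel_measurable (circular_beta_ensemble \<beta> N)"
  unfolding circular_beta_ensemble_def using measurable_log_abs_D by simp

lemma char_log_abs_D:
  "(\<integral>t. exp (\<i> * (u * log_abs_D N \<theta> t)) \<partial>circular_beta_ensemble \<beta> N) = (\<Prod>j<N. gfac (\<beta> / 2 * real j) u)"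
proof -
  have Z: "cbe_partition \<beta> N = rmellin 0"
    by (simp add: cbe_partition_def rmellin_def)
  have Zpos: "rmellin 0 > 0" by (rule rmellin_pos) simp
  have "(\<integral>t. exp (\<i> * (u * log_abs_D N \<theta> t)) \<partial>circular_beta_ensemble \<beta> N) =
      (\<integral>t. (cbe_weight \<beta> N t / rmellin 0) *\<^sub>R exp (\<i> * (u * log_abs_D N \<theta> t)) \<partial>cbe_base N)"
    unfolding circular_beta_ensemble_def Z
  proof (rule integral_density)
    show "(\<lambda>t. exp (\<i> * (u * log_abs_D N \<theta> t))) \<in> borel_measurable (cbe_base N)"
      by (intro measurable_compose[OF _ borel_measurable_exp] borel_measurable_times borel_measurable_const
          measurable_compose[OF _ borel_measurable_of_real] measurable_log_abs_D)
    show "(\<lambda>t. cbe_weight \<beta> N t / rmellin 0) \<in> borel_measurable (cbe_base N)"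
      using measurable_cbe_weight by simp
    show "AE t in cbe_base N. 0 \<le> cbe_weight \<beta> N t / rmellin 0"
      using Zpos by (simp add: cbe_weight_nonneg)
  qed
  also have "\<dots> = (\<integral>t. (exp (\<i> * u * log_abs_D N \<theta> t) * cbe_weight \<beta> N t) / of_real (rmellin 0) \<partial>cbe_base N)"
    by (intro Bochner_Integration.integral_cong refl) (simp add: scaleR_conv_of_real mult_ac)
  also have "\<dots> = mellin (\<i> * u) / mellin 0"
    using mellin_of_real[of 0] by (simp add: mellin_def)
  also have "\<dots> = (\<Prod>j<N. gfac (\<beta> / 2 * real j) u)"
    using mellin_of_real[of 0] Zpos by (simp add: mellin_imaginary)
  finally show ?thesis .
qed

end

section \<open>Cumulant bounds\<close>

text \<open>A logarithm of \<open>gfac c u\<close> assembled from \<open>ln_Gamma\<close>, which is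
  smooth on the right half-plane; applying \<open>ln\<close> to the quotient would bring in branch
  cuts. \<open>lg1\<close>, \<open>lg2\<close> and \<open>lg3\<close> are its successive derivatives
  in \<open>u\<close>.\<close>

definition lg0 :: "real \<Rightarrow> real \<Rightarrow> complex" where
  "lg0 c u = ln_Gamma (1 + of_real c + \<i> * of_real u) + ln_Gamma (1 + of_real c) -
     2 * ln_Gamma (1 + of_real c + \<i> * of_real u / 2)"

definition lg1 :: "real \<Rightarrow> real \<Rightarrow> complex" where
  "lg1 c u = \<i> * (Digamma (1 + of_real c + \<i> * of_real u) - Digamma (1 + of_real c + \<i> * of_real u / 2))"

definition lg2 :: "real \<Rightarrow> real \<Rightarrow> complex" where
  "lg2 c u = Polygamma 1 (1 + of_real c + \<i> * of_real u / 2) / 2 - Polygamma 1 (1 + of_real c + \<i> * of_real u)"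

definition lg3 :: "real \<Rightarrow> real \<Rightarrow> complex" where
  "lg3 c u = \<i> * (Polygamma 2 (1 + of_real c + \<i> * of_real u / 2) / 4 - Polygamma 2 (1 + of_real c + \<i> * of_real u))"

lemma not_nonpos_Real_if_Re_pos: "Re z > 0 \<Longrightarrow> z \<notin> \<real>\<^sub>\<le>\<^sub>0"
  by (auto simp: complex_nonpos_Reals_iff)

lemma exp_lg0:
  assumes "c \<ge> 0"
  shows "exp (lg0 c u) = gfac c u"
proof -
  have "Gamma z = exp (ln_Gamma z)" if "Re z > 0" for z :: complex
    using not_nonpos_Int_if_Re_pos[OF that] by (simp add: Gamma_complex_altdef)
  thus ?thesis using assms
    by (simp add: lg0_def gfac_def exp_diff exp_add exp_double)
qed

context
  fixes c :: real
  assumes c: "c \<ge> 0"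
begin

lemma has_vector_derivative_line:
  "((\<lambda>u. 1 + of_real c + \<i> * of_real u) has_vector_derivative \<i>) (at u)"
  "((\<lambda>u. 1 + of_real c + \<i> * of_real u / 2) has_vector_derivative \<i> / 2) (at u)"
  unfolding has_vector_derivative_complex_iff by (auto intro!: derivative_eq_intros)

lemma Re_line_pos: "Re (1 + of_real c + \<i> * of_real u) > 0" "Re (1 + of_real c + \<i> * of_real u / 2) > 0"
  using c by auto

lemma has_vector_derivative_lg0: "(lg0 c has_vector_derivative lg1 c u) (at u)"
proof -
  note D = has_field_derivative_ln_Gamma_complex[OF not_nonpos_Real_if_Re_pos]
  have 1: "((\<lambda>u. ln_Gamma (1 + of_real c + \<i> * of_real u)) has_vector_derivative
      \<i> * Digamma (1 + of_real c + \<i> * of_real u)) (at u)"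
    using field_vector_diff_chain_at[OF has_vector_derivative_line(1) D[OF Re_line_pos(1)]] by (simp add: o_def)
  have 2: "((\<lambda>u. ln_Gamma (1 + of_real c + \<i> * of_real u / 2)) has_vector_derivative
      \<i> / 2 * Digamma (1 + of_real c + \<i> * of_real u / 2)) (at u)"
    using field_vector_diff_chain_at[OF has_vector_derivative_line(2) D[OF Re_line_pos(2)]] by (simp add: o_def)
  have "((\<lambda>u. ln_Gamma (1 + of_real c + \<i> * of_real u) + ln_Gamma (1 + of_real c) -
     2 * ln_Gamma (1 + of_real c + \<i> * of_real u / 2)) has_vector_derivative
      (\<i> * Digamma (1 + of_real c + \<i> * of_real u) + 0) - 2 * (\<i> / 2 * Digamma (1 + of_real c + \<i> * of_real u / 2))) (at u)"
    by (intro has_vector_derivative_diff has_vector_derivative_add has_vector_derivative_mult_right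
        has_vector_derivative_const 1 2)
  thus ?thesis by (simp add: lg0_def[abs_def] lg1_def right_diff_distrib)
qed

lemma has_vector_derivative_Polygamma_line:
  "((\<lambda>u. Polygamma n (1 + of_real c + \<i> * of_real u)) has_vector_derivative
      \<i> * Polygamma (Suc n) (1 + of_real c + \<i> * of_real u)) (at u)"
  "((\<lambda>u. Polygamma n (1 + of_real c + \<i> * of_real u / 2)) has_vector_derivative
      \<i> / 2 * Polygamma (Suc n) (1 + of_real c + \<i> * of_real u / 2)) (at u)"
proof -
  note D = has_field_derivative_Polygamma[OF not_nonpos_Int_if_Re_pos]
  show "((\<lambda>u. Polygamma n (1 + of_real c + \<i> * of_real u)) has_vector_derivative
      \<i> * Polygamma (Suc n) (1 + of_real c + \<i> * of_real u)) (at u)"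
    using field_vector_diff_chain_at[OF has_vector_derivative_line(1) D[OF Re_line_pos(1)]] by (simp add: o_def)
  show "((\<lambda>u. Polygamma n (1 + of_real c + \<i> * of_real u / 2)) has_vector_derivative
      \<i> / 2 * Polygamma (Suc n) (1 + of_real c + \<i> * of_real u / 2)) (at u)"
    using field_vector_diff_chain_at[OF has_vector_derivative_line(2) D[OF Re_line_pos(2)]] by (simp add: o_def)
qed

lemma has_vector_derivative_lg1: "(lg1 c has_vector_derivative lg2 c u) (at u)"
proof -
  have "(lg1 c has_vector_derivative
      \<i> * (\<i> * Polygamma (Suc 0) (1 + of_real c + \<i> * of_real u) -
            \<i> / 2 * Polygamma (Suc 0) (1 + of_real c + \<i> * of_real u / 2))) (at u)"
    unfolding lg1_def[abs_def]
    by (intro has_vector_derivative_diff has_vector_derivative_mult_right has_vector_derivative_Polygamma_line)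
  thus ?thesis by (simp add: lg2_def right_diff_distrib)
qed

lemma has_vector_derivative_lg2: "(lg2 c has_vector_derivative lg3 c u) (at u)"
proof -
  have "(lg2 c has_vector_derivative
      (\<i> / 2 * Polygamma (Suc 1) (1 + of_real c + \<i> * of_real u / 2)) / 2 -
       \<i> * Polygamma (Suc 1) (1 + of_real c + \<i> * of_real u)) (at u)"
    unfolding lg2_def[abs_def]
    by (intro has_vector_derivative_diff has_vector_derivative_divide has_vector_derivative_Polygamma_line)
  thus ?thesis by (simp add: lg3_def right_diff_distrib numeral_2_eq_2)
qed

end

text \<open>The vanishing first derivative reflects that \<open>X\<close> has mean 0; the second
  gives the contribution of one index to the variance.\<close>

lemma lg_at_0: "lg0 c 0 = 0" "lg1 c 0 = 0" "lg2 c 0 = - Polygamma 1 (1 + of_real c) / 2"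
  by (simp_all add: lg0_def lg1_def lg2_def field_simps)

lemma summable_3_2: "summable (\<lambda>k. (1 + real k) powr (-3/2))"
proof -
  have "summable (\<lambda>n. real n powr (-3/2))"
    by (subst summable_real_powr_iff) simp
  hence "summable (\<lambda>n. real (Suc n) powr (-3/2))"
    by (subst summable_Suc_iff)
  thus ?thesis by (simp add: add.commute)
qed

text \<open>Since \<open>(1 + k) (1 + c) \<le> (1 + c + k)^2\<close>, the cubic denominator splits
  into powers 3/2 of \<open>1 + k\<close> and of \<open>1 + c\<close>. The exponent exceeds 1 in
  both, so the sum over \<open>k\<close> and later the sum over \<open>c = b j\<close>
  converge.\<close>

lemma norm_Polygamma_2_le:
  assumes c: "c \<ge> 0" and z: "Re z = 1 + c"
  shows "norm (Polygamma 2 z) \<le> 2 * (\<Sum>k. (1 + real k) powr (-3/2)) * (1 + c) powr (-3/2)"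
proof -
  have z0: "z \<noteq> 0" using assms by auto
  have bound: "norm (inverse ((z + of_nat k) ^ 3)) \<le> (1 + real k) powr (-3/2) * (1 + c) powr (-3/2)" for k
  proof -
    have "1 + c + real k \<le> norm (z + of_nat k)"
      using complex_Re_le_cmod[of "z + of_nat k"] z by simp
    moreover have "((1 + real k) * (1 + c)) powr (3/2) \<le> (1 + c + real k) ^ 3"
    proof -
      have "(1 + real k) * (1 + c) \<le> (1 + c + real k) * (1 + c + real k)"
        using c by (intro mult_mono) auto
      hence "((1 + real k) * (1 + c)) powr (3/2) \<le> ((1 + c + real k) * (1 + c + real k)) powr (3/2)"
        using c by (intro powr_mono2) auto
      also have "\<dots> = (1 + c + real k) powr (3/2 + 3/2)"
        using c by (subst powr_mult) (auto simp: powr_add[symmetric])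
      also have "\<dots> = (1 + c + real k) powr (real 3)" by simp
      also have "\<dots> = (1 + c + real k) ^ 3"
        using c by (subst powr_realpow) auto
      finally show ?thesis .
    qed
    ultimately have "((1 + real k) * (1 + c)) powr (3/2) \<le> norm (z + of_nat k) ^ 3"
      using c power_mono[of "1 + c + real k" "norm (z + of_nat k)" 3] by linarith
    hence "inverse (norm (z + of_nat k) ^ 3) \<le> inverse (((1 + real k) * (1 + c)) powr (3/2))"
      using c by (intro le_imp_inverse_le) auto
    also have "\<dots> = (1 + real k) powr (-3/2) * (1 + c) powr (-3/2)"
      using c by (simp add: powr_minus[symmetric] powr_mult)
    finally show ?thesis by (simp add: norm_inverse norm_power)
  qed
  have sm: "summable (\<lambda>k. (1 + real k) powr (-3/2) * (1 + c) powr (-3/2))"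
    by (intro summable_mult2 summable_3_2)
  have "Polygamma 2 z = - 2 * (\<Sum>k. inverse ((z + of_nat k) ^ 3))"
    by (simp add: Polygamma_def numeral_3_eq_3 numeral_2_eq_2)
  also have "norm \<dots> = 2 * norm (\<Sum>k. inverse ((z + of_nat k) ^ 3))"
    by (simp add: norm_mult)
  also have "norm (\<Sum>k. inverse ((z + of_nat k) ^ 3)) \<le> (\<Sum>k. (1 + real k) powr (-3/2) * (1 + c) powr (-3/2))"
    by (rule norm_suminf_le) (use bound sm in auto)
  also have "\<dots> = (\<Sum>k. (1 + real k) powr (-3/2)) * (1 + c) powr (-3/2)"
    by (rule suminf_mult2[symmetric, OF summable_3_2])
  finally show ?thesis by simp
qed

lemma norm_lg3_le:
  assumes "c \<ge> 0"
  shows "norm (lg3 c u) \<le> 4 * (\<Sum>k. (1 + real k) powr (-3/2)) * (1 + c) powr (-3/2)"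
proof -
  let ?S = "2 * (\<Sum>k. (1 + real k) powr (-3/2)) * (1 + c) powr (-3/2)"
  have 1: "norm (Polygamma 2 (1 + of_real c + \<i> * of_real u / 2 :: complex)) \<le> ?S"
    "norm (Polygamma 2 (1 + of_real c + \<i> * of_real u :: complex)) \<le> ?S"
    by (intro norm_Polygamma_2_le assms; simp)+
  have "norm (lg3 c u) \<le> norm (Polygamma 2 (1 + of_real c + \<i> * of_real u / 2 :: complex) / 4) +
      norm (Polygamma 2 (1 + of_real c + \<i> * of_real u :: complex))"
  proof -
    have "norm (lg3 c u) = norm (Polygamma 2 (1 + of_real c + \<i> * of_real u / 2 :: complex) / 4 -
        Polygamma 2 (1 + of_real c + \<i> * of_real u))"
      by (simp add: lg3_def norm_mult)
    also note norm_triangle_ineq4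
    finally show ?thesis .
  qed
  also have "\<dots> \<le> ?S / 4 + ?S"
    using 1 by (intro add_mono) (simp_all only: norm_divide norm_numeral divide_right_mono zero_le_numeral)
  also have "\<dots> \<le> ?S + ?S"
    using norm_ge_zero[of "Polygamma 2 (1 + of_real c + \<i> * of_real u :: complex)"] 1(2) by linarith
  finally show ?thesis by (simp add: mult_ac)
qed

text \<open>Bounds the third derivative of the log characteristic function uniformly in
  \<open>N\<close>; the summand 1 gives positivity without discussing the series.\<close>

definition cum_const :: "real \<Rightarrow> real" where
  "cum_const b = 4 * (\<Sum>k. (1 + real k) powr (-3/2)) * (\<Sum>j. (1 + b * real j) powr (-3/2)) + 1"

lemma summable_scaled_3_2:
  assumes b: "b > 0"
  shows "summable (\<lambda>j. (1 + b * real j) powr (-3/2))"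
proof (rule summable_comparison_test)
  let ?m = "min 1 b"
  have "(1 + b * real j) powr (-3/2) \<le> ?m powr (-3/2) * (1 + real j) powr (-3/2)" for j
  proof -
    have "?m * (1 + real j) = ?m * 1 + ?m * real j" by (simp add: algebra_simps)
    also have "\<dots> \<le> 1 + b * real j"
      by (intro add_mono mult_right_mono) auto
    finally have "?m * (1 + real j) \<le> 1 + b * real j" .
    hence "(1 + b * real j) powr (-3/2) \<le> (?m * (1 + real j)) powr (-3/2)"
      using b by (intro powr_mono2') auto
    thus ?thesis using b by (simp add: powr_mult)
  qed
  thus "\<exists>N. \<forall>n\<ge>N. norm ((1 + b * real n) powr (-3/2)) \<le> ?m powr (-3/2) * (1 + real n) powr (-3/2)"
    by simp
  show "summable (\<lambda>n. ?m powr (-3/2) * (1 + real n) powr (-3/2))"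
    by (intro summable_mult summable_3_2)
qed

lemma cum_const_pos: "b > 0 \<Longrightarrow> cum_const b > 0"
  unfolding cum_const_def
  by (intro add_nonneg_pos mult_nonneg_nonneg suminf_nonneg summable_3_2 summable_scaled_3_2) auto

lemma norm_sum_lg3_le:
  assumes b: "b > 0"
  shows "norm (\<Sum>j<N. lg3 (b * real j) u) \<le> cum_const b"
proof -
  let ?S = "\<Sum>k. (1 + real k) powr (-3/2)"
  have S: "?S \<ge> 0" by (intro suminf_nonneg summable_3_2) auto
  have "norm (\<Sum>j<N. lg3 (b * real j) u) \<le> (\<Sum>j<N. 4 * ?S * (1 + b * real j) powr (-3/2))"
    using b by (intro sum_norm_le norm_lg3_le) auto
  also have "\<dots> = 4 * ?S * (\<Sum>j<N. (1 + b * real j) powr (-3/2))"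
    by (simp add: sum_distrib_left)
  also have "\<dots> \<le> 4 * ?S * (\<Sum>j. (1 + b * real j) powr (-3/2))"
    using S by (intro mult_left_mono sum_le_suminf summable_scaled_3_2 b) auto
  finally show ?thesis by (simp add: cum_const_def)
qed

text \<open>For \<open>b = \<beta> / 2\<close>, the variance as it can be read off the
  characteristic function; that it is the second moment is shown separately.\<close>

definition cum_var :: "real \<Rightarrow> nat \<Rightarrow> real" where
  "cum_var b N = (\<Sum>j<N. Polygamma 1 (1 + b * real j) / 2)"

lemma sum_lg2_0:
  assumes "b > 0"
  shows "(\<Sum>j<N. lg2 (b * real j) 0) = - of_real (cum_var b N)"
proof -
  have "lg2 (b * real j) 0 = - of_real (Polygamma 1 (1 + b * real j) / 2)" for j
  proof -
    have "1 + b * real j > 0" using assms by (simp add: add_pos_nonneg)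
    hence "Polygamma 1 (complex_of_real (1 + b * real j)) = of_real (Polygamma 1 (1 + b * real j))"
      by (intro Polygamma_of_real) auto
    thus ?thesis by (simp add: lg_at_0)
  qed
  thus ?thesis by (simp add: cum_var_def sum_negf)
qed

text \<open>Each term \<open>1 / (x + k)^2\<close> of the trigamma series exceeds the telescoping
  difference \<open>1 / (x + k) - 1 / (x + k + 1)\<close>.\<close>

lemma Polygamma_1_ge:
  fixes x :: real
  assumes x: "x > 0"
  shows "Polygamma 1 x \<ge> 1 / x"
proof -
  have lim: "(\<lambda>k. 1 / (x + real k)) \<longlonglongrightarrow> 0"
    by real_asymp
  have s: "(\<lambda>k. 1 / (x + real k) - 1 / (x + real (Suc k))) sums (1 / (x + real 0) - 0)"
    by (rule telescope_sums'[OF lim])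
  have "1 / x = (\<Sum>k. 1 / (x + real k) - 1 / (x + real (Suc k)))"
    using s by (simp add: sums_iff)
  also have "\<dots> \<le> (\<Sum>k. inverse ((x + real k)\<^sup>2))"
  proof (rule suminf_le)
    fix k
    have "1 / (x + real k) - 1 / (x + real (Suc k)) = 1 / ((x + real k) * (x + real (Suc k)))"
      using x by (simp add: field_simps)
    also have "\<dots> \<le> 1 / ((x + real k) * (x + real k))"
      using x by (intro divide_left_mono mult_left_mono) auto
    finally show "1 / (x + real k) - 1 / (x + real (Suc k)) \<le> inverse ((x + real k)\<^sup>2)"
      by (simp add: power2_eq_square divide_inverse)
    show "summable (\<lambda>k. inverse ((x + real k)\<^sup>2))"
      using Polygamma_converges'[of x 2] x by simp
  qed (use s in \<open>simp add: sums_iff\<close>)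
  also have "\<dots> = Polygamma 1 x"
    by (simp add: Polygamma_def numeral_2_eq_2)
  finally show ?thesis .
qed

text \<open>The trigamma bound reduces the sum to a harmonic one, so the variance grows at least
  like a multiple of \<open>ln N\<close>.\<close>

lemma cum_var_at_top:
  assumes b: "b > 0"
  shows "filterlim (cum_var b) at_top sequentially"
proof (rule filterlim_at_top_mono)
  let ?m = "max 1 b"
  show "eventually (\<lambda>N. ln (real N + 1) / (2 * ?m) \<le> cum_var b N) sequentially"
  proof (rule always_eventually, rule allI)
    fix N
    have "ln (real N + 1) / (2 * ?m) \<le> harm N / (2 * ?m)"
      using ln_le_harm[of N] by (intro divide_right_mono) auto
    also have "harm N = (\<Sum>j<N. inverse (1 + real j))"
      by (induction N) (auto simp: harm_Suc harm_expand add.commute)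
    also have "(\<Sum>j<N. inverse (1 + real j)) / (2 * ?m) = (\<Sum>j<N. inverse (1 + real j) / (2 * ?m))"
      by (rule sum_divide_distrib)
    also have "\<dots> \<le> cum_var b N"
      unfolding cum_var_def
    proof (rule sum_mono)
      fix j
      have "1 + b * real j \<le> ?m * (1 + real j)"
      proof -
        have "b * real j \<le> ?m * real j" by (intro mult_right_mono) auto
        thus ?thesis by (simp add: algebra_simps)
      qed
      hence "1 / (?m * (1 + real j)) \<le> 1 / (1 + b * real j)"
        using b by (intro divide_left_mono) (auto intro!: mult_pos_pos add_pos_nonneg)
      also have "\<dots> \<le> Polygamma 1 (1 + b * real j)"
        using b by (intro Polygamma_1_ge) (simp add: add_pos_nonneg)
      finally show "inverse (1 + real j) / (2 * ?m) \<le> Polygamma 1 (1 + b * real j) / 2"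
        by (simp add: divide_simps mult_ac)
    qed
    finally show "ln (real N + 1) / (2 * ?m) \<le> cum_var b N" .
  qed
  have m: "?m > 0" by simp
  show "filterlim (\<lambda>N. ln (real N + 1) / (2 * ?m)) at_top sequentially"
    using m by real_asymp
qed

lemma norm_diff_le_deriv:
  fixes f :: "real \<Rightarrow> complex"
  assumes "\<And>x. (f has_vector_derivative f' x) (at x)" "\<And>x. \<bar>x\<bar> \<le> \<bar>u\<bar> \<Longrightarrow> norm (f' x) \<le> B"
  shows "norm (f u - f 0) \<le> B * \<bar>u\<bar>"
proof -
  have "norm (f u - f 0) \<le> B * norm (u - 0)"
  proof (rule differentiable_bound[where S = "{-\<bar>u\<bar>..\<bar>u\<bar>}" and f' = "\<lambda>x h. h *\<^sub>R f' x"])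
    fix x assume "x \<in> {-\<bar>u\<bar>..\<bar>u\<bar>}"
    hence x: "\<bar>x\<bar> \<le> \<bar>u\<bar>" by auto
    show "(f has_derivative (\<lambda>h. h *\<^sub>R f' x)) (at x within {-\<bar>u\<bar>..\<bar>u\<bar>})"
      using assms(1)[of x] by (auto simp: has_vector_derivative_def intro: has_derivative_at_withinI)
    show "onorm (\<lambda>h. h *\<^sub>R f' x) \<le> B"
      using assms(2)[OF x] by (intro onorm_le) (simp add: mult.commute[of "\<bar>_\<bar>"] mult_right_mono)
  qed auto
  thus ?thesis by simp
qed

text \<open>The mean value inequality is applied three times, starting from the bounded third
  derivative; at each level the remainder vanishes at 0. Factorials are given away, so one constant
  serves all three bounds.\<close>

lemma cum_bounds:
  assumes b: "b > 0"
  shows "norm ((\<Sum>j<N. lg2 (b * real j) u) + of_real (cum_var b N)) \<le> cum_const b * \<bar>u\<bar>" (is ?B2)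
    and "norm ((\<Sum>j<N. lg1 (b * real j) u) + of_real (cum_var b N * u)) \<le> cum_const b * u\<^sup>2" (is ?B1)
    and "norm ((\<Sum>j<N. lg0 (b * real j) u) + of_real (cum_var b N * u\<^sup>2 / 2)) \<le> cum_const b * \<bar>u\<bar> ^ 3" (is ?B0)
proof -
  let ?V = "cum_var b N" and ?K = "cum_const b"
  have K: "?K \<ge> 0" using cum_const_pos[OF b] by simp
  have c0: "b * real j \<ge> 0" for j using b by simp
  have B2: "norm ((\<Sum>j<N. lg2 (b * real j) u) + of_real ?V) \<le> ?K * \<bar>u\<bar>" for u
  proof -
    have "norm ((\<Sum>j<N. lg2 (b * real j) u) - (\<Sum>j<N. lg2 (b * real j) 0)) \<le> ?K * \<bar>u\<bar>"
      by (rule norm_diff_le_deriv[where f' = "\<lambda>u. \<Sum>j<N. lg3 (b * real j) u"])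
         (auto intro!: has_vector_derivative_sum has_vector_derivative_lg2 c0 norm_sum_lg3_le b)
    thus ?thesis by (simp add: sum_lg2_0[OF b])
  qed
  have B1: "norm ((\<Sum>j<N. lg1 (b * real j) u) + of_real (?V * u)) \<le> ?K * u\<^sup>2" for u
  proof -
    let ?f = "\<lambda>u. (\<Sum>j<N. lg1 (b * real j) u) + of_real (?V * u)"
    have "norm (?f u - ?f 0) \<le> ?K * \<bar>u\<bar> * \<bar>u\<bar>"
    proof (rule norm_diff_le_deriv)
      fix x
      have "((\<lambda>u. complex_of_real (?V * u)) has_vector_derivative of_real ?V) (at x)"
        by (intro has_vector_derivative_of_real) (auto intro!: derivative_eq_intros)
      thus "(?f has_vector_derivative (\<Sum>j<N. lg2 (b * real j) x) + of_real ?V) (at x)"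
        by (intro has_vector_derivative_add has_vector_derivative_sum has_vector_derivative_lg1 c0)
      assume "\<bar>x\<bar> \<le> \<bar>u\<bar>"
      thus "norm ((\<Sum>j<N. lg2 (b * real j) x) + of_real ?V) \<le> ?K * \<bar>u\<bar>"
        using order_trans[OF B2 mult_left_mono[OF _ K]] by simp
    qed
    thus ?thesis by (simp add: lg_at_0 power2_eq_square mult.assoc)
  qed
  have B0: "norm ((\<Sum>j<N. lg0 (b * real j) u) + of_real (?V * u\<^sup>2 / 2)) \<le> ?K * \<bar>u\<bar> ^ 3"
  proof -
    let ?f = "\<lambda>u. (\<Sum>j<N. lg0 (b * real j) u) + of_real (?V * u\<^sup>2 / 2)"
    have "norm (?f u - ?f 0) \<le> ?K * u\<^sup>2 * \<bar>u\<bar>"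
    proof (rule norm_diff_le_deriv)
      fix x
      have "((\<lambda>u. complex_of_real (?V * u\<^sup>2 / 2)) has_vector_derivative of_real (?V * x)) (at x)"
        by (intro has_vector_derivative_of_real) (auto intro!: derivative_eq_intros)
      thus "(?f has_vector_derivative (\<Sum>j<N. lg1 (b * real j) x) + of_real (?V * x)) (at x)"
        by (intro has_vector_derivative_add has_vector_derivative_sum has_vector_derivative_lg0 c0)
      assume "\<bar>x\<bar> \<le> \<bar>u\<bar>"
      hence "x\<^sup>2 \<le> u\<^sup>2" by (simp add: abs_le_square_iff)
      thus "norm ((\<Sum>j<N. lg1 (b * real j) x) + of_real (?V * x)) \<le> ?K * u\<^sup>2"
        using order_trans[OF B1 mult_left_mono[OF _ K]] by simp
    qed
    thus ?thesis by (simp add: lg_at_0 power2_eq_square power3_eq_cube mult.assoc)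
  qed
  show ?B2 ?B1 ?B0 using B2 B1 B0 by auto
qed

section \<open>Comparison with the Gaussian\<close>

text \<open>The constant is \<open>2 * 16 ^ 4\<close>, from \<open>x \<le> exp x\<close> at
  \<open>x = (1 + t^2) / 16\<close> and \<open>exp (1 / 4) \<le> 2\<close>. In the central range
  three of the powers absorb polynomial prefactors and one pays for
  \<open>1 / (1 + t^2)\<close>.\<close>

lemma power4_exp_bound: "(1 + t\<^sup>2) ^ 4 * exp (- (t\<^sup>2 / 4)) \<le> 131072" for t :: real
proof -
  let ?s = "1 + t\<^sup>2"
  have "(?s / 16) ^ 4 \<le> exp (?s / 16) ^ 4"
    using exp_ge_add_one_self[of "?s / 16"] by (intro power_mono) (auto simp: divide_simps)
  also have "\<dots> = exp (?s / 4)"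
    by (simp add: exp_of_nat_mult[symmetric])
  also have "\<dots> = exp (1 / 4) * exp (t\<^sup>2 / 4)"
    by (simp add: exp_add[symmetric] add_divide_distrib)
  also have "exp (1 / 4 :: real) \<le> 2"
    using exp_bound[of "1/4"] by (simp add: power2_eq_square)
  finally have "(?s / 16) ^ 4 \<le> 2 * exp (t\<^sup>2 / 4)" by simp
  hence "?s ^ 4 \<le> 131072 * exp (t\<^sup>2 / 4)"
    by (simp add: power_divide)
  thus ?thesis by (simp add: exp_minus field_simps)
qed

lemma norm_exp_minus_1_le:
  fixes w :: complex
  shows "norm (exp w - 1) \<le> norm w * exp (norm w)"
proof -
  have "norm (exp w - exp 0) \<le> exp (norm w) * norm (w - 0)"
  proof (rule field_differentiable_bound[where S = "cball 0 (norm w)" and f' = exp])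
    show "(exp has_field_derivative exp z) (at z within cball 0 (norm w))" for z :: complex
      by (rule DERIV_exp[THEN has_field_derivative_at_within])
    show "norm (exp z) \<le> exp (norm w)" if "z \<in> cball 0 (norm w)" for z :: complex
      using that complex_Re_le_cmod[of z] by (auto simp: norm_exp_eq_Re)
  qed auto
  thus ?thesis by (simp add: mult.commute)
qed

text \<open>\<open>A\<close> and \<open>B\<close> stand for the first two derivatives of
  \<open>l\<close>; the references are \<open>g\<close>, \<open>- t g\<close> and
  \<open>(t^2 - 1) g\<close>. As long as \<open>4 \<kappa> |t| \<le> 1\<close>, the deviation of
  \<open>l\<close> from \<open>- t^2 / 2\<close> is at most \<open>t^2 / 4\<close>, so
  \<open>exp l\<close> keeps a Gaussian decay and each error is \<kappa> times a polynomial times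
  \<open>exp (- t^2 / 4)\<close>.\<close>

lemma gaussian_comparison_central:
  fixes l A B :: complex and t \<kappa> :: real
  assumes \<kappa>: "0 \<le> \<kappa>" "4 * \<kappa> * \<bar>t\<bar> \<le> 1"
    and l: "norm (l + of_real (t\<^sup>2 / 2)) \<le> \<kappa> * \<bar>t\<bar> ^ 3"
    and A: "norm (A + of_real t) \<le> \<kappa> * t\<^sup>2"
    and B: "norm (B + 1) \<le> \<kappa> * \<bar>t\<bar>"
  defines "g \<equiv> of_real (exp (- (t\<^sup>2 / 2)))"
  shows "norm (exp l - g) \<le> 655360 * \<kappa> / (1 + t\<^sup>2)"
    and "norm (A * exp l + of_real t * g) \<le> 655360 * \<kappa> / (1 + t\<^sup>2)"
    and "norm ((B + A\<^sup>2) * exp l - of_real (t\<^sup>2 - 1) * g) \<le> 655360 * \<kappa> / (1 + t\<^sup>2)"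
proof -
  let ?s = "1 + t\<^sup>2" and ?E = "exp (- (t\<^sup>2 / 4))"
  have s1: "?s \<ge> 1" by simp
  have ts: "\<bar>t\<bar> \<le> ?s" 
  proof -
    have "0 \<le> (\<bar>t\<bar> - 1)\<^sup>2" by simp
    hence "2 * \<bar>t\<bar> \<le> 1 + t\<^sup>2" by (simp add: power2_eq_square algebra_simps)
    thus ?thesis by simp
  qed
  have t3: "\<bar>t\<bar> ^ 3 \<le> ?s\<^sup>2"
  proof -
    have "\<bar>t\<bar> ^ 3 = \<bar>t\<bar> * t\<^sup>2" by (simp add: power2_eq_square power3_eq_cube)
    also have "\<dots> \<le> ?s * ?s" using ts by (intro mult_mono) auto
    finally show ?thesis by (simp add: power2_eq_square)
  qed
  define w where "w = l + of_real (t\<^sup>2 / 2)"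
  have tm: "\<bar>t\<^sup>2 - 1\<bar> \<le> ?s"
    using zero_le_power2[of t] by linarith
  have w4: "norm w \<le> t\<^sup>2 / 4"
  proof -
    have "norm w \<le> (4 * \<kappa> * \<bar>t\<bar>) * t\<^sup>2 / 4"
      using l by (simp add: w_def power3_eq_cube power2_eq_square mult_ac)
    also have "\<dots> \<le> 1 * t\<^sup>2 / 4"
      using \<kappa> by (intro divide_right_mono mult_right_mono) auto
    finally show ?thesis by simp
  qed
  have el: "exp l = g * exp w"
    unfolding g_def w_def exp_of_real[symmetric] exp_add[symmetric] by simp
  have g: "norm g = exp (- (t\<^sup>2 / 2))" by (simp add: g_def)
  have gE: "exp (- (t\<^sup>2 / 2)) * exp (t\<^sup>2 / 4) = ?E"
    by (simp add: exp_add[symmetric])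
  have nl: "norm (exp l) \<le> ?E"
  proof -
    have "norm (exp l) = exp (- (t\<^sup>2 / 2)) * exp (Re w)"
      unfolding el norm_mult g by (simp add: norm_exp_eq_Re)
    also have "\<dots> \<le> exp (- (t\<^sup>2 / 2)) * exp (t\<^sup>2 / 4)"
      using w4 complex_Re_le_cmod[of w] by (intro mult_left_mono) auto
    finally show ?thesis by (simp add: gE)
  qed
  have d: "norm (exp l - g) \<le> \<kappa> * \<bar>t\<bar> ^ 3 * ?E"
  proof -
    have "norm (exp l - g) = exp (- (t\<^sup>2 / 2)) * norm (exp w - 1)"
      unfolding el g[symmetric] norm_mult[symmetric] by (simp add: algebra_simps)
    also have "\<dots> \<le> exp (- (t\<^sup>2 / 2)) * (norm w * exp (norm w))"
      by (intro mult_left_mono norm_exp_minus_1_le) auto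
    also have "\<dots> \<le> exp (- (t\<^sup>2 / 2)) * ((\<kappa> * \<bar>t\<bar> ^ 3) * exp (t\<^sup>2 / 4))"
      using l w4 \<kappa> by (intro mult_left_mono mult_mono) (auto simp: w_def)
    also have "\<dots> = \<kappa> * \<bar>t\<bar> ^ 3 * (exp (- (t\<^sup>2 / 2)) * exp (t\<^sup>2 / 4))"
      by (simp only: mult_ac)
    finally show ?thesis unfolding gE .
  qed
  \<comment> \<open>All three estimates are brought to this form;
    \<open>655360 = 5 * 131072\<close>.\<close>
  have fin: "x \<le> 655360 * \<kappa> / ?s" if "x \<le> 5 * \<kappa> * ?s ^ 3 * ?E" for x
  proof -
    have "x * ?s \<le> 5 * \<kappa> * (?s ^ 4 * ?E)"
    proof -
      have eq: "a * s ^ 3 * e * s = a * (s ^ 4 * e)" for a s e :: real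
        by (simp add: power_numeral_reduce)
      have "x * ?s \<le> 5 * \<kappa> * ?s ^ 3 * ?E * ?s"
        using s1 by (intro mult_right_mono that) auto
      thus ?thesis unfolding eq .
    qed
    also have "\<dots> \<le> 5 * \<kappa> * 131072"
      using \<kappa> power4_exp_bound[of t] by (intro mult_left_mono) auto
    finally show ?thesis using s1 by (simp add: pos_le_divide_eq add_pos_nonneg)
  qed
  have s23: "?s\<^sup>2 \<le> ?s ^ 3" "?s \<le> ?s ^ 3"
    using s1 power_increasing[of 2 3 ?s] power_increasing[of 1 3 ?s] by simp_all
  have s3: "?s ^ 3 \<ge> 0" by simp
  show "norm (exp l - g) \<le> 655360 * \<kappa> / ?s"
  proof (rule fin, rule order_trans[OF d])
    have "\<bar>t\<bar> ^ 3 \<le> 5 * ?s ^ 3" using t3 s23(1) s3 by linarith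
    hence "\<kappa> * \<bar>t\<bar> ^ 3 * ?E \<le> \<kappa> * (5 * ?s ^ 3) * ?E"
      using \<kappa> by (intro mult_right_mono mult_left_mono) auto
    thus "\<kappa> * \<bar>t\<bar> ^ 3 * ?E \<le> 5 * \<kappa> * ?s ^ 3 * ?E" by (simp add: mult_ac)
  qed
  show "norm (A * exp l + of_real t * g) \<le> 655360 * \<kappa> / ?s"
  proof (rule fin)
    have "A * exp l + of_real t * g = (A + of_real t) * exp l - of_real t * (exp l - g)"
      by (simp add: algebra_simps)
    also have "norm \<dots> \<le> norm (A + of_real t) * norm (exp l) + \<bar>t\<bar> * norm (exp l - g)"
      using norm_triangle_ineq4[of "(A + of_real t) * exp l" "of_real t * (exp l - g)"]
      by (simp add: norm_mult)
    also have "\<dots> \<le> \<kappa> * t\<^sup>2 * ?E + \<bar>t\<bar> * (\<kappa> * \<bar>t\<bar> ^ 3 * ?E)"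
      using A nl d \<kappa> by (intro add_mono mult_mono) auto
    also have "\<dots> = \<kappa> * (t\<^sup>2 + \<bar>t\<bar> * \<bar>t\<bar> ^ 3) * ?E"
      by (simp add: algebra_simps)
    also have "\<dots> \<le> \<kappa> * (5 * ?s ^ 3) * ?E"
    proof (intro mult_right_mono mult_left_mono)
      have "\<bar>t\<bar> * \<bar>t\<bar> ^ 3 \<le> ?s * ?s\<^sup>2" using ts t3 by (intro mult_mono) auto
      hence "\<bar>t\<bar> * \<bar>t\<bar> ^ 3 \<le> ?s ^ 3" by (simp add: power3_eq_cube power2_eq_square mult_ac)
      moreover have "t\<^sup>2 \<le> ?s" by simp
      ultimately show "t\<^sup>2 + \<bar>t\<bar> * \<bar>t\<bar> ^ 3 \<le> 5 * ?s ^ 3" using s23 s3 by linarith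
    qed (use \<kappa> in auto)
    finally show "norm (A * exp l + of_real t * g) \<le> 5 * \<kappa> * ?s ^ 3 * ?E" by (simp add: mult_ac)
  qed
  show "norm ((B + A\<^sup>2) * exp l - of_real (t\<^sup>2 - 1) * g) \<le> 655360 * \<kappa> / ?s"
  proof (rule fin)
    \<comment> \<open>A difference of squares: \<open>A + t\<close> is small and
      \<open>A - t\<close> is close to \<open>- 2 t\<close>.\<close>
    have A2: "norm (A\<^sup>2 - of_real (t\<^sup>2)) \<le> 3 * \<kappa> * \<bar>t\<bar> ^ 3"
    proof -
      have k4: "\<kappa> * t\<^sup>2 \<le> \<bar>t\<bar>"
      proof -
        have "\<kappa> * t\<^sup>2 = (4 * \<kappa> * \<bar>t\<bar>) * \<bar>t\<bar> / 4" by (simp add: power2_eq_square)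
        also have "\<dots> \<le> 1 * \<bar>t\<bar> / 4" using \<kappa> by (intro divide_right_mono mult_right_mono) auto
        finally show ?thesis by simp
      qed
      have "A\<^sup>2 - of_real (t\<^sup>2) = (A + of_real t) * ((A + of_real t) - of_real (2 * t))"
        by (simp add: power2_eq_square algebra_simps)
      also have "norm \<dots> \<le> (\<kappa> * t\<^sup>2) * (\<kappa> * t\<^sup>2 + 2 * \<bar>t\<bar>)"
        unfolding norm_mult
        using A norm_triangle_ineq4[of "A + of_real t" "of_real (2 * t)"] \<kappa>
        by (intro mult_mono) (auto simp: norm_mult abs_mult)
      also have "\<dots> \<le> (\<kappa> * t\<^sup>2) * (3 * \<bar>t\<bar>)"
        using k4 \<kappa> by (intro mult_left_mono) auto
      also have "\<dots> = 3 * \<kappa> * \<bar>t\<bar> ^ 3" by (simp add: power2_eq_square power3_eq_cube)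
      finally show ?thesis .
    qed
    have "(B + A\<^sup>2) * exp l - of_real (t\<^sup>2 - 1) * g =
        ((B + 1) + (A\<^sup>2 - of_real (t\<^sup>2))) * exp l + of_real (t\<^sup>2 - 1) * (exp l - g)"
      by (simp add: algebra_simps)
    also have "norm \<dots> \<le> (norm (B + 1) + norm (A\<^sup>2 - of_real (t\<^sup>2))) * norm (exp l) + \<bar>t\<^sup>2 - 1\<bar> * norm (exp l - g)"
      using norm_triangle_ineq[of "((B + 1) + (A\<^sup>2 - of_real (t\<^sup>2))) * exp l" "of_real (t\<^sup>2 - 1) * (exp l - g)"]
        mult_right_mono[OF norm_triangle_ineq[of "B + 1" "A\<^sup>2 - of_real (t\<^sup>2)"] norm_ge_zero[of "exp l"]]
      unfolding norm_mult norm_of_real by linarith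
    also have "\<dots> \<le> (\<kappa> * \<bar>t\<bar> + 3 * \<kappa> * \<bar>t\<bar> ^ 3) * ?E + ?s * (\<kappa> * \<bar>t\<bar> ^ 3 * ?E)"
      using B A2 nl d \<kappa> by (intro add_mono mult_mono tm) auto
    also have "\<dots> = \<kappa> * (\<bar>t\<bar> + 3 * \<bar>t\<bar> ^ 3 + ?s * \<bar>t\<bar> ^ 3) * ?E"
      by (simp add: algebra_simps)
    also have "\<dots> \<le> \<kappa> * (5 * ?s ^ 3) * ?E"
    proof (intro mult_right_mono mult_left_mono)
      have "?s * \<bar>t\<bar> ^ 3 \<le> ?s * ?s\<^sup>2" using t3 by (intro mult_left_mono) auto
      hence "?s * \<bar>t\<bar> ^ 3 \<le> ?s ^ 3" by (simp add: power3_eq_cube power2_eq_square mult_ac)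
      thus "\<bar>t\<bar> + 3 * \<bar>t\<bar> ^ 3 + ?s * \<bar>t\<bar> ^ 3 \<le> 5 * ?s ^ 3" using s23 s3 ts t3 by linarith
    qed (use \<kappa> in auto)
    finally show "norm ((B + A\<^sup>2) * exp l - of_real (t\<^sup>2 - 1) * g) \<le> 5 * \<kappa> * ?s ^ 3 * ?E" by (simp add: mult_ac)
  qed
qed

text \<open>With no cancellation left to exploit, \<open>exp l\<close> and \<open>g\<close> are
  estimated separately. The condition \<open>4 \<kappa> |t| \<ge> 1\<close> extracts a factor
  \<kappa> from the Gaussian; the cubic weight on \<open>exp l\<close> covers
  \<open>|B + A^2|\<close>, of order \<open>(1 + t^2)^2\<close>, and the final
  \<open>1 / (1 + t^2)\<close>.\<close>

lemma gaussian_comparison_tail: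
  fixes l A B :: complex and t \<kappa> C :: real
  assumes \<kappa>: "0 \<le> \<kappa>" "\<kappa> \<le> 1" "4 * \<kappa> * \<bar>t\<bar> \<ge> 1"
    and l: "norm (exp l) * (1 + t\<^sup>2) ^ 3 \<le> C * \<kappa>"
    and A: "norm (A + of_real t) \<le> \<kappa> * t\<^sup>2"
    and B: "norm (B + 1) \<le> \<kappa> * \<bar>t\<bar>"
  defines "g \<equiv> of_real (exp (- (t\<^sup>2 / 2)))"
  shows "norm (exp l - g) \<le> (6 * C + 524288) * \<kappa> / (1 + t\<^sup>2)"
    and "norm (A * exp l + of_real t * g) \<le> (6 * C + 524288) * \<kappa> / (1 + t\<^sup>2)"
    and "norm ((B + A\<^sup>2) * exp l - of_real (t\<^sup>2 - 1) * g) \<le> (6 * C + 524288) * \<kappa> / (1 + t\<^sup>2)"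
proof -
  let ?s = "1 + t\<^sup>2"
  have s1: "?s \<ge> 1" by simp
  have ts: "\<bar>t\<bar> \<le> ?s" 
  proof -
    have "0 \<le> (\<bar>t\<bar> - 1)\<^sup>2" by simp
    hence "2 * \<bar>t\<bar> \<le> 1 + t\<^sup>2" by (simp add: power2_eq_square algebra_simps)
    thus ?thesis by simp
  qed
  have ss: "?s \<le> ?s\<^sup>2" "1 \<le> ?s\<^sup>2" using s1 power_increasing[of 1 2 ?s] by auto
  have ng: "norm g = exp (- (t\<^sup>2 / 2))" by (simp add: g_def)
  \<comment> \<open>The factor 1 is replaced by \<open>4 \<kappa> |t|\<close>; then the fourth power
    bound applies, and \<open>524288 = 4 * 131072\<close>.\<close>
  have sg: "?s * norm g * ?s \<le> 524288 * \<kappa>"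
  proof -
    have "?s * norm g * ?s = ?s\<^sup>2 * exp (- (t\<^sup>2 / 2)) * 1" unfolding ng by (simp add: power2_eq_square)
    also have "\<dots> \<le> ?s\<^sup>2 * exp (- (t\<^sup>2 / 4)) * (4 * \<kappa> * \<bar>t\<bar>)"
      using \<kappa> by (intro mult_mono) auto
    also have "\<dots> \<le> ?s\<^sup>2 * exp (- (t\<^sup>2 / 4)) * (4 * \<kappa> * ?s\<^sup>2)"
      using \<kappa> ts ss by (intro mult_left_mono) auto
    also have "\<dots> = 4 * \<kappa> * (?s ^ 4 * exp (- (t\<^sup>2 / 4)))" by (simp add: power_numeral_reduce mult_ac)
    also have "\<dots> \<le> 4 * \<kappa> * 131072"
      using \<kappa> power4_exp_bound[of t] by (intro mult_left_mono) auto
    finally show ?thesis by simp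
  qed
  \<comment> \<open>The 6 is \<open>2 + 4\<close>, the coefficients in the bounds for
    \<open>|B|\<close> and for \<open>|A|^2\<close>.\<close>
  have fin: "norm x \<le> (6 * C + 524288) * \<kappa> / ?s" if "norm x \<le> 6 * ?s\<^sup>2 * norm (exp l) + ?s * norm g" for x :: complex
  proof -
    have "norm x * ?s \<le> (6 * ?s\<^sup>2 * norm (exp l) + ?s * norm g) * ?s"
      using that by (intro mult_right_mono) auto
    also have "\<dots> = 6 * (norm (exp l) * ?s ^ 3) + ?s * norm g * ?s"
      by (simp add: power_numeral_reduce algebra_simps)
    also have "\<dots> \<le> 6 * (C * \<kappa>) + 524288 * \<kappa>"
      using l sg by linarith
    finally show ?thesis by (simp add: pos_le_divide_eq add_pos_nonneg algebra_simps)
  qed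
  have tm: "\<bar>t\<^sup>2 - 1\<bar> \<le> ?s"
    using zero_le_power2[of t] by linarith
  have nA: "norm A \<le> 2 * ?s"
  proof -
    have "norm A \<le> norm (A + of_real t) + \<bar>t\<bar>"
      using norm_triangle_ineq4[of "A + of_real t" "of_real t"] by simp
    also have "\<dots> \<le> 1 * t\<^sup>2 + ?s"
      using A ts mult_right_mono[OF \<kappa>(2), of "t\<^sup>2"] by simp
    finally show ?thesis by simp
  qed
  have nB: "norm B \<le> 2 * ?s"
  proof -
    have "norm B \<le> norm (B + 1) + 1"
      using norm_triangle_ineq4[of "B + 1" 1] by simp
    also have "\<dots> \<le> 1 * \<bar>t\<bar> + ?s"
      using B zero_le_power2[of t] mult_right_mono[OF \<kappa>(2), of "\<bar>t\<bar>"] by linarith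
    finally show ?thesis using ts by simp
  qed
  have el: "norm (exp l) \<ge> 0" by simp
  show "norm (exp l - g) \<le> (6 * C + 524288) * \<kappa> / ?s"
  proof (rule fin)
    have "norm (exp l - g) \<le> 1 * norm (exp l) + 1 * norm g"
      using norm_triangle_ineq4[of "exp l" g] by simp
    also have "\<dots> \<le> 6 * ?s\<^sup>2 * norm (exp l) + ?s * norm g"
    proof (intro add_mono mult_right_mono)
      show "1 \<le> 6 * ?s\<^sup>2" using ss by linarith
    qed auto
    finally show "norm (exp l - g) \<le> 6 * ?s\<^sup>2 * norm (exp l) + ?s * norm g" .
  qed
  show "norm (A * exp l + of_real t * g) \<le> (6 * C + 524288) * \<kappa> / ?s"
  proof (rule fin)
    have "norm (A * exp l + of_real t * g) \<le> norm A * norm (exp l) + \<bar>t\<bar> * norm g"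
      using norm_triangle_ineq[of "A * exp l" "of_real t * g"] by (simp add: norm_mult)
    also have "\<dots> \<le> 6 * ?s\<^sup>2 * norm (exp l) + ?s * norm g"
    proof (intro add_mono mult_right_mono)
      show "norm A \<le> 6 * ?s\<^sup>2"
        by (rule order_trans[OF nA mult_mono]) (use ss in auto)
    qed (use ts in auto)
    finally show "norm (A * exp l + of_real t * g) \<le> 6 * ?s\<^sup>2 * norm (exp l) + ?s * norm g" .
  qed
  show "norm ((B + A\<^sup>2) * exp l - of_real (t\<^sup>2 - 1) * g) \<le> (6 * C + 524288) * \<kappa> / ?s"
  proof (rule fin)
    have "norm ((B + A\<^sup>2) * exp l - of_real (t\<^sup>2 - 1) * g) \<le> norm (B + A\<^sup>2) * norm (exp l) + \<bar>t\<^sup>2 - 1\<bar> * norm g"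
      using norm_triangle_ineq4[of "(B + A\<^sup>2) * exp l" "of_real (t\<^sup>2 - 1) * g"] unfolding norm_mult norm_of_real .
    also have "\<dots> \<le> 6 * ?s\<^sup>2 * norm (exp l) + ?s * norm g"
    proof (intro add_mono mult_right_mono)
      have "norm (B + A\<^sup>2) \<le> norm B + (norm A)\<^sup>2"
        using norm_triangle_ineq[of B "A\<^sup>2"] by (simp add: norm_power)
      also have "(norm A)\<^sup>2 \<le> (2 * ?s)\<^sup>2" using nA by (intro power_mono) auto
      also have "(2 * ?s)\<^sup>2 = 4 * ?s\<^sup>2" by (simp only: power_mult_distrib) simp
      also have "norm B \<le> 2 * ?s\<^sup>2"
        by (rule order_trans[OF nB mult_left_mono]) (use ss in auto)
      finally show "norm (B + A\<^sup>2) \<le> 6 * ?s\<^sup>2" by simp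
    qed (use tm in auto)
    finally show "norm ((B + A\<^sup>2) * exp l - of_real (t\<^sup>2 - 1) * g) \<le> 6 * ?s\<^sup>2 * norm (exp l) + ?s * norm g" .
  qed
qed

text \<open>With exponent \<open>11\<close>, six powers of \<open>|t|\<close> can be given up for integrability, and the remaining factor
  \<open>T ^ 11 / |t| ^ 5\<close> is still of order \<open>T ^ -4\<close> once \<open>|t|\<close> exceeds a multiple of \<open>T ^ 3\<close>.\<close>

lemma norm_exp_cum_tail:
  assumes b: "b > 0" and j: "j < N" "b * real j \<ge> 22" and u: "u \<noteq> 0"
  shows "norm (exp (\<Sum>j<N. lg0 (b * real j) u)) \<le> ((24 + b * real j) / \<bar>u\<bar>) ^ 11"
proof -
  have c0: "b * real i \<ge> 0" for i using b by simp
  have "norm (exp (\<Sum>j<N. lg0 (b * real j) u)) = (\<Prod>i<N. norm (gfac (b * real i) u))"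
    by (simp add: exp_sum exp_lg0 c0 prod_norm)
  also have "\<dots> = norm (gfac (b * real j) u) * (\<Prod>i\<in>{..<N}-{j}. norm (gfac (b * real i) u))"
    using j by (intro prod.remove) auto
  \<comment> \<open>One index provides the decay; the remaining factors have modulus at most
    1.\<close>
  also have "\<dots> \<le> norm (gfac (b * real j) u) * 1"
    by (intro mult_left_mono prod_le_1) (auto intro: norm_gfac_le_1 c0)
  \<comment> \<open>The choice \<open>r = 11\<close> requires \<open>b j \<ge> 22\<close> and
    produces \<open>2 + 2 * 11 = 24\<close>.\<close>
  also have "\<dots> \<le> ((2 + b * real j + 2 * real 11) / \<bar>u\<bar>) ^ 11"
    using norm_gfac_le_power[of 11 "b * real j" u] j u by simp
  finally show ?thesis by (simp add: add_ac)
qed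

text \<open>Substituting \<open>u = t / T\<close> turns the cubic remainder into
  \<open>\<kappa> |t| ^ 3\<close> with \<open>\<kappa> = K / T ^ 3\<close>, and its derivatives
  scale accordingly. The line is split at \<open>|t| = 1 / (4 \<kappa>)\<close>, a multiple of
  \<open>T ^ 3\<close>.\<close>

lemma normalized_cum_bounds:
  assumes b: "b > 0"
  obtains C where "\<And>l A B t T N. T = sqrt (cum_var b N) \<Longrightarrow> T \<ge> 1 \<Longrightarrow> 4 * cum_const b \<le> T ^ 3 \<Longrightarrow>
      N > nat \<lceil>22 / b\<rceil> \<Longrightarrow>
      l = (\<Sum>j<N. lg0 (b * real j) (t / T)) \<Longrightarrow>
      A = (\<Sum>j<N. lg1 (b * real j) (t / T)) / T \<Longrightarrow>
      B = (\<Sum>j<N. lg2 (b * real j) (t / T)) / T\<^sup>2 \<Longrightarrow>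
      norm (exp l - of_real (exp (- (t\<^sup>2 / 2)))) \<le> (C / T ^ 3) / (1 + t\<^sup>2) \<and>
      norm (A * exp l + of_real t * of_real (exp (- (t\<^sup>2 / 2)))) \<le> (C / T ^ 3) / (1 + t\<^sup>2) \<and>
      norm ((B + A\<^sup>2) * exp l - of_real (t\<^sup>2 - 1) * of_real (exp (- (t\<^sup>2 / 2)))) \<le> (C / T ^ 3) / (1 + t\<^sup>2)"
proof -
  define K where "K = cum_const b"
  have K: "K > 0" using cum_const_pos[OF b] by (simp add: K_def)
  \<comment> \<open>An index independent of \<open>N\<close> whose Gamma factor decays fast enough;
    it must occur in the product, hence the lower bound on \<open>N\<close>.\<close>
  define j where "j = nat \<lceil>22 / b\<rceil>"
  have j22: "b * real j \<ge> 22"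
  proof -
    have "22 / b \<le> real j" unfolding j_def by (rule real_nat_ceiling_ge)
    thus ?thesis using b by (simp add: field_simps)
  qed
  define D where "D = 24 + b * real j"
  have D: "D > 0" using j22 by (simp add: D_def)
  \<comment> \<open>Chosen so that \<open>C * \<kappa>\<close> is the outcome of the tail estimate,
    \<open>8 D^11 (4 K)^5 / T^3\<close>.\<close>
  define C where "C = 8 * D ^ 11 * (4 * K) ^ 5 / K"
  have C: "C \<ge> 0" using K D by (simp add: C_def)
  define C' where "C' = (6 * C + 655360) * K"
  show ?thesis
  proof (rule that[of C'])
    fix l A B :: complex and t T :: real and N :: nat
    assume T: "T = sqrt (cum_var b N)" "T \<ge> 1" "4 * cum_const b \<le> T ^ 3" and N: "N > nat \<lceil>22 / b\<rceil>"
      and l: "l = (\<Sum>j<N. lg0 (b * real j) (t / T))"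
      and A: "A = (\<Sum>j<N. lg1 (b * real j) (t / T)) / T"
      and B: "B = (\<Sum>j<N. lg2 (b * real j) (t / T)) / T\<^sup>2"
    have T0: "T > 0" using T by simp
    have V: "cum_var b N = T\<^sup>2"
      using T(2) unfolding T(1) by (simp add: real_sqrt_ge_1_iff)
    define \<kappa> where "\<kappa> = K / T ^ 3"
    have \<kappa>: "0 \<le> \<kappa>" "4 * \<kappa> \<le> 1"
      using K T0 T(3) by (auto simp: \<kappa>_def K_def)
    have bl: "norm (l + of_real (t\<^sup>2 / 2)) \<le> \<kappa> * \<bar>t\<bar> ^ 3"
    proof -
      have "cum_var b N * (t / T)\<^sup>2 / 2 = t\<^sup>2 / 2"
        unfolding V using T0 by (simp add: power_divide)
      moreover have "K * \<bar>t / T\<bar> ^ 3 = \<kappa> * \<bar>t\<bar> ^ 3"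
        using T0 by (simp add: \<kappa>_def power_divide)
      ultimately show ?thesis
        using cum_bounds(3)[OF b, where N = N and u = "t / T"] unfolding l K_def[symmetric] by simp
    qed
    have bA: "norm (A + of_real t) \<le> \<kappa> * t\<^sup>2"
    proof -
      have "A + of_real t = ((\<Sum>j<N. lg1 (b * real j) (t / T)) + of_real (cum_var b N * (t / T))) / of_real T"
        unfolding A V using T0 by (simp add: field_simps power2_eq_square)
      also have "norm \<dots> = norm ((\<Sum>j<N. lg1 (b * real j) (t / T)) + of_real (cum_var b N * (t / T))) / T"
        using T0 by (simp only: norm_divide norm_of_real abs_of_pos)
      also have "\<dots> \<le> K * (t / T)\<^sup>2 / T"
        using cum_bounds(2)[OF b, where N = N and u = "t / T"] T0 unfolding K_def by (intro divide_right_mono) auto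
      also have "\<dots> = \<kappa> * t\<^sup>2"
        by (simp add: \<kappa>_def power_divide power2_eq_square power3_eq_cube)
      finally show ?thesis .
    qed
    have bB: "norm (B + 1) \<le> \<kappa> * \<bar>t\<bar>"
    proof -
      have "B + 1 = ((\<Sum>j<N. lg2 (b * real j) (t / T)) + of_real (cum_var b N)) / of_real (T\<^sup>2)"
        unfolding B V using T0 by (simp add: field_simps)
      also have "norm \<dots> = norm ((\<Sum>j<N. lg2 (b * real j) (t / T)) + of_real (cum_var b N)) / T\<^sup>2"
        unfolding norm_divide norm_of_real by simp
      also have "\<dots> \<le> K * \<bar>t / T\<bar> / T\<^sup>2"
        using cum_bounds(1)[OF b, where N = N and u = "t / T"] T0 unfolding K_def by (intro divide_right_mono) auto
      also have "\<dots> = \<kappa> * \<bar>t\<bar>"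
        using T0 by (simp add: \<kappa>_def power2_eq_square power3_eq_cube)
      finally show ?thesis .
    qed
    have C'eq: "C' / T ^ 3 = (6 * C + 655360) * \<kappa>"
      by (simp add: C'_def \<kappa>_def)
    have s: "1 + t\<^sup>2 > 0" by (simp add: add_pos_nonneg)
    show "norm (exp l - of_real (exp (- (t\<^sup>2 / 2)))) \<le> (C' / T ^ 3) / (1 + t\<^sup>2) \<and>
      norm (A * exp l + of_real t * of_real (exp (- (t\<^sup>2 / 2)))) \<le> (C' / T ^ 3) / (1 + t\<^sup>2) \<and>
      norm ((B + A\<^sup>2) * exp l - of_real (t\<^sup>2 - 1) * of_real (exp (- (t\<^sup>2 / 2)))) \<le> (C' / T ^ 3) / (1 + t\<^sup>2)"
    proof (cases "4 * \<kappa> * \<bar>t\<bar> \<le> 1")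
      case True
      have "655360 * \<kappa> / (1 + t\<^sup>2) \<le> (C' / T ^ 3) / (1 + t\<^sup>2)"
        unfolding C'eq using s C \<kappa> by (intro divide_right_mono mult_right_mono) auto
      thus ?thesis
        using gaussian_comparison_central[OF \<kappa>(1) True bl bA bB] by (meson order_trans)
    next
      case False
      \<comment> \<open>Because \<open>4 \<kappa> \<le> 1\<close>, the tail range stays away from
        small \<open>t\<close>, and \<open>1 + t^2\<close> may be replaced by
        \<open>2 t^2\<close>.\<close>
      have t1: "\<bar>t\<bar> \<ge> 1"
      proof (rule ccontr)
        assume "\<not> \<bar>t\<bar> \<ge> 1"
        hence "4 * \<kappa> * \<bar>t\<bar> \<le> 4 * \<kappa> * 1" using \<kappa> by (intro mult_left_mono) auto
        thus False using False \<kappa> by simp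
      qed
      have tail: "norm (exp l) * (1 + t\<^sup>2) ^ 3 \<le> C * \<kappa>"
      proof -
        have "norm (exp l) \<le> (D / \<bar>t / T\<bar>) ^ 11"
          unfolding l D_def using b N j22 t1 T0
          by (intro norm_exp_cum_tail) (auto simp: j_def)
        also have "\<dots> = D ^ 11 * T ^ 11 / \<bar>t\<bar> ^ 11"
          using T0 by (simp add: power_divide power_mult_distrib)
        finally have 1: "norm (exp l) \<le> D ^ 11 * T ^ 11 / \<bar>t\<bar> ^ 11" .
        have "1 + t\<^sup>2 \<le> 2 * \<bar>t\<bar>\<^sup>2"
          using t1 power_mono[of 1 "\<bar>t\<bar>" 2] by simp
        hence "(1 + t\<^sup>2) ^ 3 \<le> (2 * \<bar>t\<bar>\<^sup>2) ^ 3"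
          using s by (intro power_mono) auto
        also have "\<dots> = 8 * \<bar>t\<bar> ^ 6"
          by (simp add: power_mult_distrib)
        finally have 2: "(1 + t\<^sup>2) ^ 3 \<le> 8 * \<bar>t\<bar> ^ 6" .
        have "norm (exp l) * (1 + t\<^sup>2) ^ 3 \<le> (D ^ 11 * T ^ 11 / \<bar>t\<bar> ^ 11) * (8 * \<bar>t\<bar> ^ 6)"
          using 1 2 s D T0 by (intro mult_mono) auto
        also have "\<dots> = 8 * D ^ 11 * T ^ 11 * (1 / \<bar>t\<bar>) ^ 5"
        proof -
          have "\<bar>t\<bar> ^ 11 = \<bar>t\<bar> ^ 6 * \<bar>t\<bar> ^ 5"
            using power_add[of "\<bar>t\<bar>" 6 5] by simp
          thus ?thesis using t1 by (simp add: power_divide)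
        qed
        also have "\<dots> \<le> 8 * D ^ 11 * T ^ 11 * (4 * K / T ^ 3) ^ 5"
        proof (intro mult_left_mono power_mono)
          have "1 \<le> (4 * K / T ^ 3) * \<bar>t\<bar>"
            using False by (simp add: \<kappa>_def)
          thus "1 / \<bar>t\<bar> \<le> 4 * K / T ^ 3"
            using t1 by (subst pos_divide_le_eq) auto
        qed (use D T0 in auto)
        also have "\<dots> = 8 * D ^ 11 * (4 * K) ^ 5 / T ^ 4"
        proof -
          have eq: "(T ^ 3) ^ 5 = T ^ 11 * T ^ 4" by (simp flip: power_add power_mult)
          have alg: "x * a * (y / (a * c)) = x * y / c" if "a \<noteq> 0" for x a y c :: real
            using that by simp
          show ?thesis unfolding power_divide eq by (rule alg) (use T0 in simp)
        qed
        also have "\<dots> \<le> 8 * D ^ 11 * (4 * K) ^ 5 / T ^ 3"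
          using T0 T(2) D K power_increasing[of 3 4 T] by (intro divide_left_mono) auto
        also have "\<dots> = C * \<kappa>"
          using K by (simp add: C_def \<kappa>_def)
        finally show ?thesis .
      qed
      have k1: "\<kappa> \<le> 1" "4 * \<kappa> * \<bar>t\<bar> \<ge> 1" using \<kappa> False by auto
      have "(6 * C + 524288) * \<kappa> / (1 + t\<^sup>2) \<le> (C' / T ^ 3) / (1 + t\<^sup>2)"
        unfolding C'eq using s C \<kappa> by (intro divide_right_mono mult_right_mono) auto
      thus ?thesis
        using gaussian_comparison_tail[OF \<kappa>(1) k1 tail bA bB] by (meson order_trans)
    qed
  qed
qed

section \<open>Moments and conclusion\<close>

text \<open>Square integrability comes from Fatou's lemma applied to \<open>2 (1 - cos (u X)) / u\<^sup>2\<close>.\<close>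

lemma (in prob_space) moments_from_char_expansion:
  assumes X [measurable]: "X \<in> borel_measurable M"
    and exp: "\<And>u. 0 < u \<Longrightarrow> u \<le> 1 \<Longrightarrow>
      norm (expectation (\<lambda>x. exp (\<i> * complex_of_real (u * X x))) - of_real (1 - V * u\<^sup>2 / 2)) \<le> K * u ^ 3"
  shows "integrable M X" "integrable M (\<lambda>x. (X x)\<^sup>2)" "expectation X = 0" "expectation (\<lambda>x. (X x)\<^sup>2) = V"
proof -
  define u where "u = (\<lambda>n. inverse (real (Suc n)))"
  have u: "0 < u n" "u n \<le> 1" for n by (auto simp: u_def divide_simps)
  have u0: "u \<longlonglongrightarrow> 0" unfolding u_def by (rule LIMSEQ_inverse_real_of_nat)
  define \<phi> where "\<phi> = (\<lambda>u. expectation (\<lambda>x. exp (\<i> * complex_of_real (u * X x))))"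
  have int: "integrable M (\<lambda>x. exp (\<i> * complex_of_real (v * X x)))" for v
    by (rule integrable_const_bound[where B = 1]) auto
  have Re: "Re (\<phi> v) = expectation (\<lambda>x. cos (v * X x))" and Im: "Im (\<phi> v) = expectation (\<lambda>x. sin (v * X x))" for v
    using int[of v] by (simp_all add: \<phi>_def Re_exp Im_exp flip: integral_Re integral_Im)
  define h where "h = (\<lambda>n x. 2 * (1 - cos (u n * X x)) / (u n)\<^sup>2)"
  have h_meas [measurable]: "h n \<in> borel_measurable M" for n unfolding h_def by measurable
  have h0: "h n x \<ge> 0" for n x unfolding h_def by simp
  have intcos: "integrable M (\<lambda>x. cos (v * X x))" for v
    by (rule integrable_const_bound[where B = 1]) auto
  have inth: "integrable M (h n)" for n
    unfolding h_def using intcos by (intro integrable_divide integrable_mult_right Bochner_Integration.integrable_diff) auto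
  have Eh: "expectation (h n) = 2 * (1 - Re (\<phi> (u n))) / (u n)\<^sup>2" for n
    unfolding h_def Re using intcos by (simp add: prob_space)
  have K0: "K \<ge> 0"
    using order_trans[OF norm_ge_zero exp[of 1]] by simp
  \<comment> \<open>The real part of the expansion gives \<open>V\<close>; the cubic error divided
    by \<open>(u n)^2\<close> vanishes.\<close>
  have limh: "(\<lambda>n. expectation (h n)) \<longlonglongrightarrow> V"
  proof -
    have bound: "norm (expectation (h n) - V) \<le> 2 * K * u n" for n
    proof -
      have "\<bar>Re (\<phi> (u n)) - (1 - V * (u n)\<^sup>2 / 2)\<bar> \<le> K * u n ^ 3"
        using order_trans[OF abs_Re_le_cmod exp[OF u]] by (simp add: \<phi>_def)
      hence 1: "2 * \<bar>Re (\<phi> (u n)) - (1 - V * (u n)\<^sup>2 / 2)\<bar> / (u n)\<^sup>2 \<le> 2 * (K * u n ^ 3) / (u n)\<^sup>2"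
        by (intro divide_right_mono) auto
      have "expectation (h n) - V = - (2 * (Re (\<phi> (u n)) - (1 - V * (u n)\<^sup>2 / 2)) / (u n)\<^sup>2)"
      proof -
        have "2 * (1 - r) / x - V = - (2 * (r - (1 - V * x / 2)) / x)" if "x > 0" for r x :: real
          using that by (simp add: field_simps)
        thus ?thesis unfolding Eh using u(1)[of n] by simp
      qed
      hence "norm (expectation (h n) - V) = 2 * \<bar>Re (\<phi> (u n)) - (1 - V * (u n)\<^sup>2 / 2)\<bar> / (u n)\<^sup>2"
        by (simp only: real_norm_def abs_minus_cancel abs_divide abs_mult abs_numeral abs_power2)
      also have "\<dots> \<le> 2 * (K * u n ^ 3) / (u n)\<^sup>2" by (rule 1)
      also have "\<dots> = 2 * K * u n"
        using u(1)[of n] by (simp add: power2_eq_square power3_eq_cube)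
      finally show ?thesis .
    qed
    have lim: "(\<lambda>n. 2 * K * u n) \<longlonglongrightarrow> 0"
      using tendsto_mult_left[OF u0, of "2 * K"] by simp
    have "(\<lambda>n. expectation (h n) - V) \<longlonglongrightarrow> 0"
      by (rule Lim_null_comparison[OF always_eventually lim]) (use bound in blast)
    thus ?thesis by (simp add: LIM_zero_iff)
  qed
  have u0': "filterlim u (at 0) sequentially"
    using u0 u(1) by (auto simp: filterlim_at less_imp_neq[symmetric])
  have cos_lim: "((\<lambda>v. 2 * (1 - cos (v * y)) / v\<^sup>2) \<longlongrightarrow> y\<^sup>2) (at 0)" for y :: real
    unfolding power2_eq_square[of y] by real_asymp
  have sin_lim: "((\<lambda>v. sin (v * y) / v) \<longlongrightarrow> y) (at 0)" for y :: real
    by real_asymp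
  have hlim: "(\<lambda>n. h n x) \<longlonglongrightarrow> (X x)\<^sup>2" for x
    unfolding h_def by (rule filterlim_compose[OF cos_lim u0'])
  show int2: "integrable M (\<lambda>x. (X x)\<^sup>2)"
  proof (rule integrableI_bounded)
    have "(\<integral>\<^sup>+ x. ennreal (norm ((X x)\<^sup>2)) \<partial>M) = (\<integral>\<^sup>+ x. liminf (\<lambda>n. ennreal (h n x)) \<partial>M)"
    proof (rule nn_integral_cong)
      fix x
      have "(\<lambda>n. ennreal (h n x)) \<longlonglongrightarrow> ennreal ((X x)\<^sup>2)"
        by (intro tendsto_ennrealI hlim)
      hence "liminf (\<lambda>n. ennreal (h n x)) = ennreal ((X x)\<^sup>2)"
        by (intro lim_imp_Liminf) auto
      thus "ennreal (norm ((X x)\<^sup>2)) = liminf (\<lambda>n. ennreal (h n x))" by simp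
    qed
    also have "\<dots> \<le> liminf (\<lambda>n. \<integral>\<^sup>+ x. ennreal (h n x) \<partial>M)"
      by (rule nn_integral_liminf) measurable
    also have "\<dots> = liminf (\<lambda>n. ennreal (expectation (h n)))"
      using inth h0 by (simp add: nn_integral_eq_integral)
    also have "\<dots> = ennreal V"
      by (intro lim_imp_Liminf tendsto_ennrealI limh) auto
    finally show "(\<integral>\<^sup>+ x. ennreal (norm ((X x)\<^sup>2)) \<partial>M) < \<infinity>"
      using order_le_less_trans by fastforce
  qed measurable
  show intX: "integrable M X"
    using square_integrable_imp_integrable[OF X int2] .
  \<comment> \<open>Fatou gave only an inequality. Now the square of \<open>X\<close> is integrable
    and dominates \<open>h n\<close>, so equality holds in the limit.\<close>
  have "(\<lambda>n. expectation (h n)) \<longlonglongrightarrow> expectation (\<lambda>x. (X x)\<^sup>2)"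
  proof (rule integral_dominated_convergence[where w = "\<lambda>x. (X x)\<^sup>2"])
    show "AE x in M. norm (h n x) \<le> (X x)\<^sup>2" for n
    proof (rule AE_I2)
      fix x
      have "1 - cos (u n * X x) \<le> (u n * X x)\<^sup>2 / 2"
      proof -
        have "cos (u n * X x) = 1 - 2 * (sin (u n * X x / 2))\<^sup>2"
          using cos_double_sin[of "u n * X x / 2"] by simp
        moreover have "(sin (u n * X x / 2))\<^sup>2 \<le> (u n * X x / 2)\<^sup>2"
          using abs_sin_x_le_abs_x[of "u n * X x / 2"] abs_le_square_iff by blast
        ultimately show ?thesis by (simp add: power_divide)
      qed
      hence "2 * (1 - cos (u n * X x)) / (u n)\<^sup>2 \<le> (u n * X x)\<^sup>2 / (u n)\<^sup>2"
        by (intro divide_right_mono) auto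
      also have "\<dots> = (X x)\<^sup>2" using u(1)[of n] by (simp add: power_mult_distrib)
      finally show "norm (h n x) \<le> (X x)\<^sup>2" using h0[of n x] by (simp add: h_def)
    qed
  qed (use int2 hlim in auto)
  thus "expectation (\<lambda>x. (X x)\<^sup>2) = V" using limh LIMSEQ_unique by blast
  have "(\<lambda>n. expectation (\<lambda>x. sin (u n * X x) / u n)) \<longlonglongrightarrow> expectation X"
  proof (rule integral_dominated_convergence[where w = "\<lambda>x. \<bar>X x\<bar>"])
    show "AE x in M. norm (sin (u n * X x) / u n) \<le> \<bar>X x\<bar>" for n
    proof (rule AE_I2)
      fix x
      show "norm (sin (u n * X x) / u n) \<le> \<bar>X x\<bar>"
        using abs_sin_x_le_abs_x[of "u n * X x"] u(1)[of n] by (simp add: abs_mult divide_le_eq mult.commute)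
    qed
    show "AE x in M. (\<lambda>n. sin (u n * X x) / u n) \<longlonglongrightarrow> X x"
      by (intro AE_I2 filterlim_compose[OF sin_lim u0'])
  qed (use intX in auto)
  \<comment> \<open>The main term of the expansion is real, so the mean of \<open>sin (u X)\<close>
    is bounded by the cubic error alone.\<close>
  moreover have "(\<lambda>n. expectation (\<lambda>x. sin (u n * X x) / u n)) \<longlonglongrightarrow> 0"
  proof (rule Lim_null_comparison[where g = "\<lambda>n. K * u n"])
    have "norm (expectation (\<lambda>x. sin (u n * X x) / u n)) \<le> K * u n" for n
    proof -
      have "\<bar>Im (\<phi> (u n))\<bar> \<le> K * u n ^ 3"
        using order_trans[OF abs_Im_le_cmod exp[OF u]] by (simp add: \<phi>_def)
      also have "\<dots> \<le> K * (u n)\<^sup>2"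
        using u[of n] K0 power_decreasing[of 2 3 "u n"] by (intro mult_left_mono) auto
      finally have "\<bar>Im (\<phi> (u n))\<bar> / u n \<le> K * (u n)\<^sup>2 / u n"
        using u(1)[of n] by (intro divide_right_mono) auto
      thus ?thesis using u(1)[of n] by (simp add: Im power2_eq_square)
    qed
    thus "eventually (\<lambda>n. norm (expectation (\<lambda>x. sin (u n * X x) / u n)) \<le> K * u n) sequentially" by simp
    have "(\<lambda>n. K * u n) \<longlonglongrightarrow> K * 0" by (intro tendsto_intros u0)
    thus "(\<lambda>n. K * u n) \<longlonglongrightarrow> 0" by simp
  qed
  ultimately show "expectation X = 0" using LIMSEQ_unique by blast
qed

text \<open>Identifying moments is a matter of fixed \<open>N\<close>, so the constant may depend on
  the variance.\<close>

lemma exp_cum_expansion: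
  assumes b: "b > 0"
  shows "\<exists>K. \<forall>u. 0 < u \<longrightarrow> u \<le> 1 \<longrightarrow>
    norm (exp (\<Sum>j<N. lg0 (b * real j) u) - of_real (1 - cum_var b N * u\<^sup>2 / 2)) \<le> K * u ^ 3"
proof (intro exI allI impI)
  let ?V = "cum_var b N" and ?K = "cum_const b"
  fix u :: real assume u: "0 < u" "u \<le> 1"
  have K: "?K > 0" by (rule cum_const_pos[OF b])
  have V: "?V \<ge> 0"
    unfolding cum_var_def
  proof (intro sum_nonneg)
    fix j
    have p: "1 + b * real j > 0" using b by (simp add: add_pos_nonneg)
    hence "0 \<le> 1 / (1 + b * real j)" by simp
    also have "\<dots> \<le> Polygamma 1 (1 + b * real j)" by (rule Polygamma_1_ge[OF p])
    finally show "0 \<le> Polygamma 1 (1 + b * real j) / 2" by simp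
  qed
  define y where "y = ?V * u\<^sup>2 / 2"
  have y: "y \<ge> 0" using V by (simp add: y_def)
  define w where "w = (\<Sum>j<N. lg0 (b * real j) u) + of_real y"
  have w: "norm w \<le> ?K * u ^ 3"
    using cum_bounds(3)[OF b, where N = N and u = u] u by (simp add: w_def y_def)
  have wK: "norm w \<le> ?K"
  proof -
    have "u ^ 3 \<le> 1" using u by (intro power_le_one) auto
    hence "?K * u ^ 3 \<le> ?K * 1" using K by (intro mult_left_mono) auto
    thus ?thesis using w by simp
  qed
  have "exp (\<Sum>j<N. lg0 (b * real j) u) = of_real (exp (- y)) * exp w"
    unfolding exp_of_real[symmetric] exp_add[symmetric] by (simp add: w_def)
  hence "exp (\<Sum>j<N. lg0 (b * real j) u) - of_real (1 - y) =
      of_real (exp (- y)) * (exp w - 1) + of_real (exp (- y) - 1 + y)"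
    by (simp add: algebra_simps)
  also have "norm \<dots> \<le> exp (- y) * norm (exp w - 1) + \<bar>exp (- y) - 1 + y\<bar>"
    using norm_triangle_ineq[of "of_real (exp (- y)) * (exp w - 1)" "of_real (exp (- y) - 1 + y)"]
    unfolding norm_mult norm_of_real by simp
  also have "\<dots> \<le> 1 * (?K * u ^ 3 * exp ?K) + y\<^sup>2"
  proof (intro add_mono mult_mono)
    show "norm (exp w - 1) \<le> ?K * u ^ 3 * exp ?K"
      by (rule order_trans[OF norm_exp_minus_1_le]) (use w wK K u in \<open>auto intro!: mult_mono\<close>)
    have 1: "exp (- y) - 1 + y \<ge> 0" using exp_ge_add_one_self[of "- y"] by linarith
    have "exp (- y) \<le> 1 / (1 + y)"
      using exp_ge_add_one_self[of y] y by (simp add: exp_minus divide_simps)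
    also have "\<dots> \<le> 1 - y + y\<^sup>2"
    proof -
      have "1 \<le> (1 - y + y\<^sup>2) * (1 + y)"
        using y by (simp add: algebra_simps power2_eq_square)
      thus ?thesis using y by (simp add: pos_divide_le_eq)
    qed
    finally show "\<bar>exp (- y) - 1 + y\<bar> \<le> y\<^sup>2" using 1 by simp
  qed (use y K u in auto)
  also have "y\<^sup>2 \<le> ?V\<^sup>2 * u ^ 3"
  proof -
    have "y\<^sup>2 = ?V\<^sup>2 * u ^ 4 / 4" by (simp add: y_def power_divide power_mult_distrib flip: power_mult)
    also have "\<dots> \<le> ?V\<^sup>2 * u ^ 4" by simp
    also have "\<dots> \<le> ?V\<^sup>2 * u ^ 3"
      using u power_decreasing[of 3 4 u] by (intro mult_left_mono) auto
    finally show ?thesis .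
  qed
  finally show "norm (exp (\<Sum>j<N. lg0 (b * real j) u) - of_real (1 - ?V * u\<^sup>2 / 2)) \<le> (?K * exp ?K + ?V\<^sup>2) * u ^ 3"
    by (simp add: y_def algebra_simps)
qed

context cbe
begin

lemma char_log_abs_D_exp:
  "(\<integral>t. exp (\<i> * of_real (u * log_abs_D N \<theta> t)) \<partial>circular_beta_ensemble \<beta> N) =
     exp (\<Sum>j<N. lg0 (\<beta> / 2 * real j) u)"
  using char_log_abs_D[of u] \<beta> by (simp add: exp_sum exp_lg0)

text \<open>The mean vanishes, so the variance is the second moment. Both are read off the expansion
  at 0; integrability comes out of the same argument, so the Bochner integrals in
  \<open>cbe_T\<close> do not fall back to their default 0.\<close>

lemma cbe_T_eq: "cbe_T \<beta> \<theta> N = sqrt (cum_var (\<beta> / 2) N)"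
proof -
  interpret prob_space "circular_beta_ensemble \<beta> N" by (rule prob_space_cbe)
  have b: "\<beta> / 2 > 0" using \<beta> by simp
  obtain K where K: "\<And>u. 0 < u \<Longrightarrow> u \<le> 1 \<Longrightarrow>
    norm (exp (\<Sum>j<N. lg0 (\<beta> / 2 * real j) u) - of_real (1 - cum_var (\<beta> / 2) N * u\<^sup>2 / 2)) \<le> K * u ^ 3"
    using exp_cum_expansion[OF b] by blast
  have "expectation (log_abs_D N \<theta>) = 0" "expectation (\<lambda>t. (log_abs_D N \<theta> t)\<^sup>2) = cum_var (\<beta> / 2) N"
    by (rule moments_from_char_expansion[OF measurable_log_abs_D_cbe, of "cum_var (\<beta> / 2) N" K],
        unfold char_log_abs_D_exp, erule (1) K)+
  thus ?thesis by (simp add: cbe_T_def Let_def)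
qed

text \<open>\<open>l\<close>, \<open>A\<close> and \<open>B\<close> are the log characteristic
  function of \<open>X / T\<close> and its first two derivatives; the chain rule accounts for the
  powers of \<open>T\<close>.\<close>

lemma cbe_borel_distance_le:
  assumes T: "T = cbe_T \<beta> \<theta> N" "T > 0"
    and l: "l = (\<lambda>t. \<Sum>j<N. lg0 (\<beta> / 2 * real j) (t / T))"
      "A = (\<lambda>t. (\<Sum>j<N. lg1 (\<beta> / 2 * real j) (t / T)) / of_real T)"
      "B = (\<lambda>t. (\<Sum>j<N. lg2 (\<beta> / 2 * real j) (t / T)) / of_real (T\<^sup>2))"
    and bounds: "\<And>t. norm (exp (l t) - of_real (exp (- (t\<^sup>2 / 2)))) \<le> C / (1 + t\<^sup>2)"
      "\<And>t. norm (A t * exp (l t) + of_real t * of_real (exp (- (t\<^sup>2 / 2)))) \<le> C / (1 + t\<^sup>2)"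
      "\<And>t. norm ((B t + (A t)\<^sup>2) * exp (l t) - of_real (t\<^sup>2 - 1) * of_real (exp (- (t\<^sup>2 / 2)))) \<le> C / (1 + t\<^sup>2)"
  shows "0 \<le> cbe_borel_distance \<beta> \<theta> N" "cbe_borel_distance \<beta> \<theta> N \<le> C * pi"
proof -
  let ?M = "circular_beta_ensemble \<beta> N" and ?X = "log_abs_D N \<theta>"
  interpret prob_space ?M by (rule prob_space_cbe)
  have [measurable]: "?X \<in> borel_measurable ?M" by (rule measurable_log_abs_D_cbe)
  have c0: "\<beta> / 2 * real j \<ge> 0" for j using \<beta> by simp
  define \<mu> where "\<mu> = distr ?M borel (\<lambda>t. ?X t / T)"
  have \<mu>: "real_distribution \<mu>" unfolding \<mu>_def by (rule real_distribution_distr) measurable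
  have sn: "std_normal_measure = std_normal_distribution" by (simp add: std_normal_measure_def)
  have char\<mu>: "char \<mu> t = exp (l t)" for t
  proof -
    have "char \<mu> t = (\<integral>x. exp (\<i> * of_real (t * (?X x / T))) \<partial>?M)"
      unfolding char_def \<mu>_def by (subst integral_distr) (auto simp: mult_ac)
    also have "\<dots> = (\<integral>x. exp (\<i> * of_real (t / T * ?X x)) \<partial>?M)"
      by (simp add: mult_ac)
    finally show ?thesis unfolding char_log_abs_D_exp l .
  qed
  let ?g = "\<lambda>t. complex_of_real (exp (- (t\<^sup>2 / 2)))"
  have charn: "char std_normal_distribution t = ?g t" for t
    by (simp add: char_std_normal_distribution)
  have dg: "(?g has_vector_derivative - (of_real t * ?g t)) (at t)" for t
  proof -
    have "((\<lambda>t. exp (- (t\<^sup>2 / 2))) has_real_derivative - (t * exp (- (t\<^sup>2 / 2)))) (at t)"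
      by (auto intro!: derivative_eq_intros)
    from has_vector_derivative_of_real[OF this] show ?thesis by simp
  qed
  have scale: "((\<lambda>t. f (t / T)) has_vector_derivative f' (t / T) / of_real T) (at t)"
    if "\<And>u. (f has_vector_derivative f' u) (at u)" for f f' :: "real \<Rightarrow> complex" and t
  proof -
    have "((\<lambda>t. t / T) has_vector_derivative 1 / T) (at t)"
      using DERIV_cdivide[OF DERIV_ident, of T t] by (simp add: has_real_derivative_iff_has_vector_derivative)
    from vector_diff_chain_at[OF this that] show ?thesis
      by (simp add: o_def scaleR_conv_of_real)
  qed
  have dl: "(l has_vector_derivative A t) (at t)" for t
    unfolding l by (intro scale has_vector_derivative_sum has_vector_derivative_lg0 c0)
  have dA: "(A has_vector_derivative B t) (at t)" for t
  proof -
    have "((\<lambda>t. (\<Sum>j<N. lg1 (\<beta> / 2 * real j) (t / T)) / of_real T) has_vector_derivative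
        ((\<Sum>j<N. lg2 (\<beta> / 2 * real j) (t / T)) / of_real T) / of_real T) (at t)"
      by (intro has_vector_derivative_divide scale has_vector_derivative_sum has_vector_derivative_lg1 c0)
    thus ?thesis by (simp add: l power2_eq_square)
  qed
  have contB: "continuous_on UNIV B"
  proof -
    have "((\<lambda>t. (\<Sum>j<N. lg2 (\<beta> / 2 * real j) (t / T)) / of_real (T\<^sup>2)) has_vector_derivative
        ((\<Sum>j<N. lg3 (\<beta> / 2 * real j) (t / T)) / of_real T) / of_real (T\<^sup>2)) (at t)" for t
      by (intro has_vector_derivative_divide scale has_vector_derivative_sum has_vector_derivative_lg2 c0)
    hence "isCont B t" for t unfolding l by (rule has_vector_derivative_continuous)
    thus ?thesis by (simp add: continuous_at_imp_continuous_on)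
  qed
  have contl: "continuous_on UNIV l" "continuous_on UNIV A"
    using dl dA by (auto intro!: continuous_at_imp_continuous_on has_vector_derivative_continuous)
  have dexp: "((\<lambda>t. exp (l t)) has_vector_derivative A t * exp (l t)) (at t)" for t
    using field_vector_diff_chain_at[OF dl DERIV_exp] by (simp add: o_def)
  define d1 where "d1 = (\<lambda>t. A t * exp (l t) + of_real t * ?g t)"
  define d2 where "d2 = (\<lambda>t. (B t + (A t)\<^sup>2) * exp (l t) - of_real (t\<^sup>2 - 1) * ?g t)"
  have D1: "((\<lambda>t. char \<mu> t - char std_normal_distribution t) has_vector_derivative d1 t) (at t)" for t
    unfolding char\<mu> charn d1_def using has_vector_derivative_diff[OF dexp dg] by simp
  have D2: "(d1 has_vector_derivative d2 t) (at t)" for t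
  proof -
    have "((\<lambda>t. complex_of_real t) has_vector_derivative 1) (at t)"
      using has_vector_derivative_of_real[OF DERIV_ident] by simp
    from has_vector_derivative_add[OF has_vector_derivative_mult[OF dA dexp] has_vector_derivative_mult[OF this dg]]
    have "(d1 has_vector_derivative (A t * (A t * exp (l t)) + B t * exp (l t)) + (of_real t * - (of_real t * ?g t) + 1 * ?g t)) (at t)"
      unfolding d1_def .
    thus ?thesis by (simp add: d2_def algebra_simps power2_eq_square)
  qed
  have contd2: "continuous_on UNIV d2"
    unfolding d2_def by (intro continuous_intros contB contl) auto
  have dist: "\<bar>measure ?M {t \<in> space ?M. ?X t / cbe_T \<beta> \<theta> N \<in> U} - measure std_normal_measure U\<bar> \<le> C * pi"
    if U: "U \<in> sets borel" for U
  proof -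
    have "measure \<mu> U = measure ?M ((\<lambda>t. ?X t / T) -` U \<inter> space ?M)"
      unfolding \<mu>_def by (rule measure_distr) (use U in auto)
    also have "(\<lambda>t. ?X t / T) -` U \<inter> space ?M = {t \<in> space ?M. ?X t / T \<in> U}" by auto
    finally have "measure ?M {t \<in> space ?M. ?X t / cbe_T \<beta> \<theta> N \<in> U} = measure \<mu> U"
      by (simp add: T)
    moreover have "\<bar>measure \<mu> U - measure std_normal_distribution U\<bar> \<le> C * pi"
      by (rule total_variation_char_bound[OF \<mu> real_dist_normal_dist D1 D2 contd2 _ _ _ U])
         (use bounds in \<open>auto simp: char\<mu> charn d1_def d2_def\<close>)
    ultimately show ?thesis by (simp add: sn)
  qed
  show "cbe_borel_distance \<beta> \<theta> N \<le> C * pi"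
    unfolding cbe_borel_distance_def by (rule cSUP_least) (use dist in auto)
  \<comment> \<open>A real supremum is an upper bound only for a bounded family; the empty set then
    witnesses nonnegativity.\<close>
  have "bdd_above ((\<lambda>U. \<bar>measure ?M {t \<in> space ?M. ?X t / cbe_T \<beta> \<theta> N \<in> U} - measure std_normal_measure U\<bar>) ` sets borel)"
    by (rule bdd_aboveI[of _ "C * pi"]) (use dist in auto)
  hence "\<bar>measure ?M {t \<in> space ?M. ?X t / cbe_T \<beta> \<theta> N \<in> {}} - measure std_normal_measure {}\<bar> \<le> cbe_borel_distance \<beta> \<theta> N"
    unfolding cbe_borel_distance_def by (rule cSUP_upper[rotated]) simp
  thus "0 \<le> cbe_borel_distance \<beta> \<theta> N" by simp
qed

end

theorem theorem3p6:
  fixes \<beta> \<theta> \<epsilon> :: real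
  assumes "\<beta> > 0" and "0 \<le> \<theta>" and "\<theta> < 2 * pi" and "\<epsilon> > 0"
  shows "(\<lambda>N. cbe_borel_distance \<beta> \<theta> N)
           \<in> o[sequentially](\<lambda>N. 1 / cbe_T \<beta> \<theta> N powr (3 - \<epsilon>))"
proof -
  have b: "\<beta> / 2 > 0" using assms by simp
  have cbe: "cbe \<beta>" using assms by (simp add: cbe_def)
  let ?T = "cbe_T \<beta> \<theta>"
  have T_eq: "?T N = sqrt (cum_var (\<beta> / 2) N)" for N
    by (rule cbe.cbe_T_eq[OF cbe])
  have T_top: "filterlim ?T at_top sequentially"
    unfolding T_eq by (rule filterlim_compose[OF sqrt_at_top cum_var_at_top[OF b]])
  obtain C where C: "\<And>l A B t T N. T = sqrt (cum_var (\<beta> / 2) N) \<Longrightarrow> T \<ge> 1 \<Longrightarrow> 4 * cum_const (\<beta> / 2) \<le> T ^ 3 \<Longrightarrow>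
      N > nat \<lceil>22 / (\<beta> / 2)\<rceil> \<Longrightarrow>
      l = (\<Sum>j<N. lg0 (\<beta> / 2 * real j) (t / T)) \<Longrightarrow>
      A = (\<Sum>j<N. lg1 (\<beta> / 2 * real j) (t / T)) / T \<Longrightarrow>
      B = (\<Sum>j<N. lg2 (\<beta> / 2 * real j) (t / T)) / T\<^sup>2 \<Longrightarrow>
      norm (exp l - of_real (exp (- (t\<^sup>2 / 2)))) \<le> (C / T ^ 3) / (1 + t\<^sup>2) \<and>
      norm (A * exp l + of_real t * of_real (exp (- (t\<^sup>2 / 2)))) \<le> (C / T ^ 3) / (1 + t\<^sup>2) \<and>
      norm ((B + A\<^sup>2) * exp l - of_real (t\<^sup>2 - 1) * of_real (exp (- (t\<^sup>2 / 2)))) \<le> (C / T ^ 3) / (1 + t\<^sup>2)"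
    using normalized_cum_bounds[OF b] by metis
  have T3: "filterlim (\<lambda>N. ?T N ^ 3) at_top sequentially"
    by (rule filterlim_compose[OF _ T_top]) real_asymp
  have ev: "eventually (\<lambda>N. norm (cbe_borel_distance \<beta> \<theta> N) \<le> (\<bar>C\<bar> * pi) * norm (1 / ?T N powr 3)) sequentially"
    using eventually_ge_at_top[of "Suc (nat \<lceil>22 / (\<beta> / 2)\<rceil>)"]
      T_top[unfolded filterlim_at_top, rule_format, of 1]
      T3[unfolded filterlim_at_top, rule_format, of "4 * cum_const (\<beta> / 2)"]
  proof eventually_elim
    case (elim N)
    have T0: "?T N > 0" using elim by simp
    note bounds = C[OF T_eq elim(2,3) _ refl refl refl]
    have N: "N > nat \<lceil>22 / (\<beta> / 2)\<rceil>" using elim(1) by simp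
    note le = cbe.cbe_borel_distance_le[OF cbe refl T0 refl refl refl
        bounds[OF N, THEN conjunct1] bounds[OF N, THEN conjunct2, THEN conjunct1]
        bounds[OF N, THEN conjunct2, THEN conjunct2]]
    \<comment> \<open>\<open>C\<close> comes without a sign, so it is replaced by its absolute
      value.\<close>
    have "C / ?T N ^ 3 * pi \<le> \<bar>C\<bar> / ?T N ^ 3 * pi"
      using T0 by (intro mult_right_mono divide_right_mono) auto
    moreover have "?T N powr 3 = ?T N ^ 3"
      using T0 powr_realpow[of "?T N" 3] by simp
    ultimately show ?case
      using le T0 by simp
  qed
  \<comment> \<open>The distance is of order \<open>T ^ -3\<close>; giving up \<epsilon> in the
    exponent turns big O into little o because \<open>T\<close> tends to infinity.\<close>
  have "(\<lambda>N. cbe_borel_distance \<beta> \<theta> N) \<in> O[sequentially](\<lambda>N. 1 / ?T N powr 3)"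
    using ev by (rule bigoI)
  also have "(\<lambda>N. 1 / ?T N powr 3) \<in> o[sequentially](\<lambda>N. 1 / ?T N powr (3 - \<epsilon>))"
  proof -
    have "(\<lambda>x::real. 1 / x powr 3) \<in> o[at_top](\<lambda>x. 1 / x powr (3 - \<epsilon>))"
      using assms(4) by real_asymp
    from landau_o.small.compose[OF this T_top] show ?thesis by simp
  qed
  finally show ?thesis .
qed

end
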